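(* Let $k$ be a commutative unital ring. The functor $N^+_\bullet: S^+\mathrm{Mod}(k)\to\mathrm{Ch}(k)$ has a right adjoint $\Gamma^+:\mathrm{Ch}(k)\to S^+\mathrm{Mod}(k)$, given by $$\Gamma^+(C_\bullet)=\mathrm{Ch}(k)\left(N^+_\bullet(\Delta^{(-)};k),C_\bullet\right):\mathbf{\Delta}_+^{op}\to\mathrm{Mod}(k)$$ for all chain complexes $C_\bullet$. Moreover, the restriction $N^+_\bullet: S^+\mathrm{Mod}(k)\rightleftarrows\mathrm{Ch}_{\geq 0}(k):\Gamma^+$ is an adjoint equivalence of categories.
   Context: $\mathbf{\Delta}_+$ is the augmented simplex category: objects $[n]=\{0,\dots,n\}$ for $n\ge-1$ ($[-1]=\emptyset$), morphisms order-preserving maps. $S^+\mathrm{Mod}(k)=\mathrm{Fun}(\mathbf{\Delta}_+^{op},\mathrm{Mod}(k))$ is the category of augmented simplicial $k$-modules. $\mathrm{Ch}(k)$ is the category of (unbounded, homologically graded) chain complexes of $k$-modules and $\mathrm{Ch}_{\ge0}(k)$ its full subcategory of complexes concentrated in non-negative degrees; $\mathrm{Ch}(k)(-,-)$ denotes the $k$-module of chain maps. For an augmented simplicial module $A$, $N^+_\bullet(A)$ is the complex obtained from the normalized chain complex $N_\bullet(A_{\ge0})$ of the underlying simplicial module (quotient by degenerate simplices) by shifting it up by one degree (without changing the differential) and placing $A_{-1}$ in degree $0$, with $d_0:A_0\to A_{-1}$ as lowest differential. That is, $N^+_n(A)\simeq A_{n-1}/\sum_{i=0}^{n-2}s_i(A_{n-2})$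 for $n\ge0$, with differential $\partial_{n+1}=\sum_{i=0}^n(-1)^i\overline{d}_i:N^+_{n+1}(A)\to N^+_n(A)$, where $\overline d_i$ is induced by the face map $d_i:A_n\to A_{n-1}$. For $n\ge-1$, $\Delta^n=\mathbf{\Delta}_+(-,[n])$ is the representable augmented simplicial set and $N^+_\bullet(\Delta^n;k)$ is $N^+_\bullet$ of the free augmented simplicial $k$-module on $\Delta^n$. *)

theory Defs
  imports "HOL-Algebra.Module" "HOL-Algebra.AbelCoset" "HOL-Library.FuncSet"
begin

section \<open>Modules\<close>

text \<open>
  Throughout, morphisms are extensional functions (equal to \<open>undefined\<close> off the carrier of the
  source), so that equality of morphisms is equality in HOL. The \<open>mult\<close> and \<open>one\<close> fields of the
  record type \<open>module\<close> carry no meaning for a module and are left \<open>undefined\<close>.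

  Source and target of a morphism may have carriers in different types. A statement that is
  polymorphic in these types thus speaks about all modules at once; this takes the place of a fixed
  universe, which would have to be closed under the formation of quotients and of modules of
  chain maps.
\<close>

definition mod_hom ::
  "('r, 'x) ring_scheme \<Rightarrow> ('r, 'a) module \<Rightarrow> ('r, 'b) module \<Rightarrow> ('a \<Rightarrow> 'b) set" where
  "mod_hom k M N = {f \<in> carrier M \<rightarrow>\<^sub>E carrier N.
     (\<forall>x\<in>carrier M. \<forall>y\<in>carrier M. f (x \<oplus>\<^bsub>M\<^esub> y) = f x \<oplus>\<^bsub>N\<^esub> f y) \<and>
     (\<forall>r\<in>carrier k. \<forall>x\<in>carrier M. f (r \<odot>\<^bsub>M\<^esub> x) = r \<odot>\<^bsub>N\<^esub> f x)}"

definition zero_module :: "'a \<Rightarrow> ('r, 'a) module" where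
  "zero_module z = \<lparr>carrier = {z}, mult = undefined, one = undefined,
     zero = z, add = (\<lambda>_ _. z), smult = (\<lambda>_ _. z)\<rparr>"

definition quot_module :: "('r, 'a) module \<Rightarrow> 'a set \<Rightarrow> ('r, 'a set) module" where
  "quot_module M H = \<lparr>carrier = a_rcosets\<^bsub>M\<^esub> H, mult = undefined, one = undefined,
     zero = H, add = (\<lambda>X Y. X <+>\<^bsub>M\<^esub> Y), smult = (\<lambda>r X. \<Union>x\<in>X. H +>\<^bsub>M\<^esub> (r \<odot>\<^bsub>M\<^esub> x))\<rparr>"

text \<open>
  The map \<open>M/H \<rightarrow> N/K\<close> induced by \<open>f : M \<rightarrow> N\<close> with \<open>f(H) \<subseteq> K\<close>. Under this condition all the
  cosets in the union coincide.
\<close>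

definition quot_map ::
  "('r, 'a) module \<Rightarrow> 'a set \<Rightarrow> ('r, 'b) module \<Rightarrow> 'b set \<Rightarrow> ('a \<Rightarrow> 'b) \<Rightarrow> 'a set \<Rightarrow> 'b set" where
  "quot_map M H N K f = (\<lambda>X\<in>carrier (quot_module M H). \<Union>x\<in>X. K +>\<^bsub>N\<^esub> f x)"

definition free_module :: "('r, 'x) ring_scheme \<Rightarrow> 's set \<Rightarrow> ('r, 's \<Rightarrow> 'r) module" where
  "free_module k S = \<lparr>carrier = {c \<in> S \<rightarrow>\<^sub>E carrier k. finite {s \<in> S. c s \<noteq> \<zero>\<^bsub>k\<^esub>}},
     mult = undefined, one = undefined,
     zero = (\<lambda>s\<in>S. \<zero>\<^bsub>k\<^esub>), add = (\<lambda>c d. \<lambda>s\<in>S. c s \<oplus>\<^bsub>k\<^esub> d s),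
     smult = (\<lambda>r c. \<lambda>s\<in>S. r \<otimes>\<^bsub>k\<^esub> c s)\<rparr>"

definition free_gen :: "('r, 'x) ring_scheme \<Rightarrow> 's set \<Rightarrow> 's \<Rightarrow> 's \<Rightarrow> 'r" where
  "free_gen k S s = (\<lambda>t\<in>S. if t = s then \<one>\<^bsub>k\<^esub> else \<zero>\<^bsub>k\<^esub>)"

text \<open>The linear map \<open>k[S] \<rightarrow> k[T]\<close> given on generators by \<open>f : S \<rightarrow> T\<close>.\<close>

definition free_map ::
  "('r, 'x) ring_scheme \<Rightarrow> 's set \<Rightarrow> 't set \<Rightarrow> ('s \<Rightarrow> 't) \<Rightarrow> ('s \<Rightarrow> 'r) \<Rightarrow> ('t \<Rightarrow> 'r)" where
  "free_map k S T f = (\<lambda>c\<in>carrier (free_module k S). \<lambda>t\<in>T.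
     (\<Oplus>\<^bsub>k\<^esub>s\<in>{s \<in> S. c s \<noteq> \<zero>\<^bsub>k\<^esub> \<and> f s = t}. c s))"


section \<open>The augmented simplex category and augmented simplicial modules\<close>

text \<open>
  The object \<open>[n] = {0, \<dots>, n}\<close>, for \<open>n \<ge> -1\<close>, is represented by its cardinality \<open>m = n + 1\<close>, a
  natural number, and is identified with \<open>{..<m}\<close>. So the degree \<open>n\<close> part of an augmented
  simplicial object sits at index \<open>n + 1\<close>, which is also its degree in the complex \<open>N\<^sup>+\<close> below.
\<close>

definition Delta_hom :: "nat \<Rightarrow> nat \<Rightarrow> (nat \<Rightarrow> nat) set" where
  "Delta_hom p m = {\<theta> \<in> {..<p} \<rightarrow>\<^sub>E {..<m}. mono_on {..<p} \<theta>}"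

definition Delta_id :: "nat \<Rightarrow> nat \<Rightarrow> nat" where
  "Delta_id m = (\<lambda>j\<in>{..<m}. j)"

text \<open>
  \<open>coface m i : {..<m} \<rightarrow> {..<m + 1}\<close> omits the value \<open>i \<le> m\<close>, and
  \<open>codegen m i : {..<m + 1} \<rightarrow> {..<m}\<close> takes the value \<open>i < m\<close> twice.
\<close>

definition coface :: "nat \<Rightarrow> nat \<Rightarrow> nat \<Rightarrow> nat" where
  "coface m i = (\<lambda>j\<in>{..<m}. if j < i then j else j + 1)"

definition codegen :: "nat \<Rightarrow> nat \<Rightarrow> nat \<Rightarrow> nat" where
  "codegen m i = (\<lambda>j\<in>{..<m + 1}. if j \<le> i then j else j - 1)"

text \<open>For \<open>\<theta> \<in> Delta_hom p m\<close>, \<open>sact A p m \<theta>\<close> is the map \<open>A(\<theta>)\<close> from index \<open>m\<close> to index \<open>p\<close>.\<close>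

record ('r, 'a) asmod =
  smod :: "nat \<Rightarrow> ('r, 'a) module"
  sact :: "nat \<Rightarrow> nat \<Rightarrow> (nat \<Rightarrow> nat) \<Rightarrow> 'a \<Rightarrow> 'a"

definition SpMod :: "('r, 'x) ring_scheme \<Rightarrow> ('r, 'a) asmod set" where
  "SpMod k = {A.
     (\<forall>m. module k (smod A m)) \<and>
     (\<forall>p m. \<forall>\<theta>\<in>Delta_hom p m. sact A p m \<theta> \<in> mod_hom k (smod A m) (smod A p)) \<and>
     (\<forall>m. sact A m m (Delta_id m) = (\<lambda>x\<in>carrier (smod A m). x)) \<and>
     (\<forall>q p m. \<forall>\<psi>\<in>Delta_hom q p. \<forall>\<theta>\<in>Delta_hom p m.
        sact A q m (compose {..<q} \<theta> \<psi>)
          = compose (carrier (smod A m)) (sact A q p \<psi>) (sact A p m \<theta>))}"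

definition Sp_hom ::
  "('r, 'x) ring_scheme \<Rightarrow> ('r, 'a) asmod \<Rightarrow> ('r, 'b) asmod \<Rightarrow> (nat \<Rightarrow> 'a \<Rightarrow> 'b) set" where
  "Sp_hom k A B = {f.
     (\<forall>m. f m \<in> mod_hom k (smod A m) (smod B m)) \<and>
     (\<forall>p m. \<forall>\<theta>\<in>Delta_hom p m. \<forall>x\<in>carrier (smod A m).
        f p (sact A p m \<theta> x) = sact B p m \<theta> (f m x))}"

definition Sp_id :: "('r, 'a) asmod \<Rightarrow> nat \<Rightarrow> 'a \<Rightarrow> 'a" where
  "Sp_id A = (\<lambda>m. \<lambda>x\<in>carrier (smod A m). x)"

text \<open>The composite \<open>g \<circ> f\<close>, where \<open>A\<close> is the source of \<open>f\<close>.\<close>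

definition Sp_comp ::
  "('r, 'a) asmod \<Rightarrow> (nat \<Rightarrow> 'b \<Rightarrow> 'd) \<Rightarrow> (nat \<Rightarrow> 'a \<Rightarrow> 'b) \<Rightarrow> nat \<Rightarrow> 'a \<Rightarrow> 'd" where
  "Sp_comp A g f = (\<lambda>m. compose (carrier (smod A m)) (g m) (f m))"

definition Sp_iso ::
  "('r, 'x) ring_scheme \<Rightarrow> ('r, 'a) asmod \<Rightarrow> ('r, 'b) asmod \<Rightarrow> (nat \<Rightarrow> 'a \<Rightarrow> 'b) \<Rightarrow> bool" where
  "Sp_iso k A B f \<longleftrightarrow> f \<in> Sp_hom k A B \<and>
     (\<exists>g\<in>Sp_hom k B A. Sp_comp A g f = Sp_id A \<and> Sp_comp B f g = Sp_id B)"


section \<open>Chain complexes\<close>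

text \<open>The differential \<open>cdiff C n\<close> goes from degree \<open>n\<close> to degree \<open>n - 1\<close>.\<close>

record ('r, 'a) complx =
  cmod :: "int \<Rightarrow> ('r, 'a) module"
  cdiff :: "int \<Rightarrow> 'a \<Rightarrow> 'a"

definition Ch :: "('r, 'x) ring_scheme \<Rightarrow> ('r, 'a) complx set" where
  "Ch k = {C.
     (\<forall>n. module k (cmod C n)) \<and>
     (\<forall>n. cdiff C n \<in> mod_hom k (cmod C n) (cmod C (n - 1))) \<and>
     (\<forall>n. \<forall>x\<in>carrier (cmod C n). cdiff C (n - 1) (cdiff C n x) = \<zero>\<^bsub>cmod C (n - 2)\<^esub>)}"

definition Ch_nonneg :: "('r, 'x) ring_scheme \<Rightarrow> ('r, 'a) complx set" where
  "Ch_nonneg k = {C \<in> Ch k. \<forall>n<0. carrier (cmod C n) = {\<zero>\<^bsub>cmod C n\<^esub>}}"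

definition Ch_hom ::
  "('r, 'x) ring_scheme \<Rightarrow> ('r, 'a) complx \<Rightarrow> ('r, 'b) complx \<Rightarrow> (int \<Rightarrow> 'a \<Rightarrow> 'b) set" where
  "Ch_hom k C D = {f.
     (\<forall>n. f n \<in> mod_hom k (cmod C n) (cmod D n)) \<and>
     (\<forall>n. \<forall>x\<in>carrier (cmod C n). f (n - 1) (cdiff C n x) = cdiff D n (f n x))}"

definition Ch_id :: "('r, 'a) complx \<Rightarrow> int \<Rightarrow> 'a \<Rightarrow> 'a" where
  "Ch_id C = (\<lambda>n. \<lambda>x\<in>carrier (cmod C n). x)"

definition Ch_comp ::
  "('r, 'a) complx \<Rightarrow> (int \<Rightarrow> 'b \<Rightarrow> 'd) \<Rightarrow> (int \<Rightarrow> 'a \<Rightarrow> 'b) \<Rightarrow> int \<Rightarrow> 'a \<Rightarrow> 'd" where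
  "Ch_comp C g f = (\<lambda>n. compose (carrier (cmod C n)) (g n) (f n))"

definition Ch_iso ::
  "('r, 'x) ring_scheme \<Rightarrow> ('r, 'a) complx \<Rightarrow> ('r, 'b) complx \<Rightarrow> (int \<Rightarrow> 'a \<Rightarrow> 'b) \<Rightarrow> bool" where
  "Ch_iso k C D f \<longleftrightarrow> f \<in> Ch_hom k C D \<and>
     (\<exists>g\<in>Ch_hom k D C. Ch_comp C g f = Ch_id C \<and> Ch_comp D f g = Ch_id D)"

definition Ch_module ::
  "('r, 'x) ring_scheme \<Rightarrow> ('r, 'a) complx \<Rightarrow> ('r, 'b) complx \<Rightarrow> ('r, int \<Rightarrow> 'a \<Rightarrow> 'b) module" where
  "Ch_module k C D = \<lparr>carrier = Ch_hom k C D, mult = undefined, one = undefined,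
     zero = (\<lambda>n. \<lambda>x\<in>carrier (cmod C n). \<zero>\<^bsub>cmod D n\<^esub>),
     add = (\<lambda>f g n. \<lambda>x\<in>carrier (cmod C n). f n x \<oplus>\<^bsub>cmod D n\<^esub> g n x),
     smult = (\<lambda>r f n. \<lambda>x\<in>carrier (cmod C n). r \<odot>\<^bsub>cmod D n\<^esub> f n x)\<rparr>"


section \<open>The normalized augmented chain complex\<close>

text \<open>
  With \<open>m = n\<close> this is the sum of the images \<open>s\<^sub>i(A\<^bsub>n-2\<^esub>) \<subseteq> A\<^bsub>n-1\<^esub>\<close> for \<open>0 \<le> i \<le> n - 2\<close>. For \<open>m = 0\<close>
  and \<open>m = 1\<close> the index set is empty and only zero remains.
\<close>

definition degenerate :: "('r, 'a) asmod \<Rightarrow> nat \<Rightarrow> 'a set" where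
  "degenerate A m =
     {(\<Oplus>\<^bsub>smod A m\<^esub>i\<in>{..<m - 1}. sact A m (m - 1) (codegen (m - 1) i) (x i)) | x.
        x \<in> {..<m - 1} \<rightarrow> carrier (smod A (m - 1))}"

text \<open>
  The alternating sum of the faces from index \<open>m\<close> to index \<open>m - 1\<close>, for \<open>m \<ge> 1\<close>. The single faces
  do not preserve degenerate elements, but this sum does; it is what descends to the quotients.
\<close>

definition alt_face :: "('r, 'a) asmod \<Rightarrow> nat \<Rightarrow> 'a \<Rightarrow> 'a" where
  "alt_face A m x = (\<Oplus>\<^bsub>smod A (m - 1)\<^esub>i\<in>{..<m}.
     if even i then sact A (m - 1) m (coface (m - 1) i) x
     else \<ominus>\<^bsub>smod A (m - 1)\<^esub> sact A (m - 1) m (coface (m - 1) i) x)"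

definition Nplus_mod :: "('r, 'a) asmod \<Rightarrow> int \<Rightarrow> ('r, 'a set) module" where
  "Nplus_mod A n =
     (if 0 \<le> n then quot_module (smod A (nat n)) (degenerate A (nat n)) else zero_module {})"

definition Nplus :: "('r, 'a) asmod \<Rightarrow> ('r, 'a set) complx" where
  "Nplus A = \<lparr>cmod = Nplus_mod A,
     cdiff = (\<lambda>n.
       if 1 \<le> n then
         quot_map (smod A (nat n)) (degenerate A (nat n))
                  (smod A (nat n - 1)) (degenerate A (nat n - 1)) (alt_face A (nat n))
       else (\<lambda>x\<in>carrier (Nplus_mod A n). \<zero>\<^bsub>Nplus_mod A (n - 1)\<^esub>))\<rparr>"

definition Nplus_map ::
  "('r, 'a) asmod \<Rightarrow> ('r, 'b) asmod \<Rightarrow> (nat \<Rightarrow> 'a \<Rightarrow> 'b) \<Rightarrow> int \<Rightarrow> 'a set \<Rightarrow> 'b set" where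
  "Nplus_map A B f = (\<lambda>n.
     if 0 \<le> n then
       quot_map (smod A (nat n)) (degenerate A (nat n))
                (smod B (nat n)) (degenerate B (nat n)) (f (nat n))
     else (\<lambda>x\<in>carrier (Nplus_mod A n). \<zero>\<^bsub>Nplus_mod B n\<^esub>))"


section \<open>Representables and the functor \<open>\<Gamma>\<^sup>+\<close>\<close>

record 's asset =
  sset :: "nat \<Rightarrow> 's set"
  sset_act :: "nat \<Rightarrow> nat \<Rightarrow> (nat \<Rightarrow> nat) \<Rightarrow> 's \<Rightarrow> 's"

text \<open>\<open>simplex m\<close> is \<open>\<Delta>\<^sup>n\<close> for \<open>n = m - 1\<close>.\<close>

definition simplex :: "nat \<Rightarrow> (nat \<Rightarrow> nat) asset" where
  "simplex m = \<lparr>sset = (\<lambda>p. Delta_hom p m),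
     sset_act = (\<lambda>q p \<psi>. \<lambda>\<phi>\<in>Delta_hom p m. compose {..<q} \<phi> \<psi>)\<rparr>"

definition free_asmod :: "('r, 'x) ring_scheme \<Rightarrow> 's asset \<Rightarrow> ('r, 's \<Rightarrow> 'r) asmod" where
  "free_asmod k X = \<lparr>smod = (\<lambda>p. free_module k (sset X p)),
     sact = (\<lambda>q p \<psi>. free_map k (sset X p) (sset X q) (sset_act X q p \<psi>))\<rparr>"

abbreviation k_simplex :: "('r, 'x) ring_scheme \<Rightarrow> nat \<Rightarrow> ('r, (nat \<Rightarrow> nat) \<Rightarrow> 'r) asmod" where
  "k_simplex k m \<equiv> free_asmod k (simplex m)"

text \<open>The map \<open>k[\<Delta>(-, p)] \<rightarrow> k[\<Delta>(-, m)]\<close> given by postcomposition with \<open>\<theta> \<in> Delta_hom p m\<close>.\<close>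

definition k_simplex_map ::
  "('r, 'x) ring_scheme \<Rightarrow> nat \<Rightarrow> nat \<Rightarrow> (nat \<Rightarrow> nat)
     \<Rightarrow> nat \<Rightarrow> ((nat \<Rightarrow> nat) \<Rightarrow> 'r) \<Rightarrow> ((nat \<Rightarrow> nat) \<Rightarrow> 'r)" where
  "k_simplex_map k p m \<theta> =
     (\<lambda>q. free_map k (Delta_hom q p) (Delta_hom q m) (\<lambda>\<phi>. compose {..<q} \<theta> \<phi>))"

definition Gamma_plus ::
  "('r, 'x) ring_scheme \<Rightarrow> ('r, 'c) complx
     \<Rightarrow> ('r, int \<Rightarrow> ((nat \<Rightarrow> nat) \<Rightarrow> 'r) set \<Rightarrow> 'c) asmod" where
  "Gamma_plus k C = \<lparr>smod = (\<lambda>m. Ch_module k (Nplus (k_simplex k m)) C),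
     sact = (\<lambda>p m \<theta>. \<lambda>f\<in>Ch_hom k (Nplus (k_simplex k m)) C.
       Ch_comp (Nplus (k_simplex k p)) f
         (Nplus_map (k_simplex k p) (k_simplex k m) (k_simplex_map k p m \<theta>)))\<rparr>"

definition Gamma_plus_map ::
  "('r, 'x) ring_scheme \<Rightarrow> ('r, 'c) complx \<Rightarrow> (int \<Rightarrow> 'c \<Rightarrow> 'd) \<Rightarrow> nat
     \<Rightarrow> (int \<Rightarrow> ((nat \<Rightarrow> nat) \<Rightarrow> 'r) set \<Rightarrow> 'c)
     \<Rightarrow> (int \<Rightarrow> ((nat \<Rightarrow> nat) \<Rightarrow> 'r) set \<Rightarrow> 'd)" where
  "Gamma_plus_map k C g = (\<lambda>m. \<lambda>f\<in>Ch_hom k (Nplus (k_simplex k m)) C.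
     Ch_comp (Nplus (k_simplex k m)) g f)"


section \<open>Unit and counit\<close>

text \<open>
  The map \<open>k[\<Delta>(-, m)] \<rightarrow> A\<close> corresponding, by the Yoneda lemma, to an element \<open>a\<close> of \<open>A\<close> at
  index \<open>m\<close>. The unit sends \<open>a\<close> to the chain map induced by it.
\<close>

definition yoneda ::
  "('r, 'x) ring_scheme \<Rightarrow> ('r, 'a) asmod \<Rightarrow> nat \<Rightarrow> 'a \<Rightarrow> nat \<Rightarrow> ((nat \<Rightarrow> nat) \<Rightarrow> 'r) \<Rightarrow> 'a" where
  "yoneda k A m a = (\<lambda>p. \<lambda>c\<in>carrier (free_module k (Delta_hom p m)).
     (\<Oplus>\<^bsub>smod A p\<^esub>\<phi>\<in>{\<phi> \<in> Delta_hom p m. c \<phi> \<noteq> \<zero>\<^bsub>k\<^esub>}. c \<phi> \<odot>\<^bsub>smod A p\<^esub> sact A p m \<phi> a))"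

definition unit_NG ::
  "('r, 'x) ring_scheme \<Rightarrow> ('r, 'a) asmod \<Rightarrow> nat \<Rightarrow> 'a
     \<Rightarrow> (int \<Rightarrow> ((nat \<Rightarrow> nat) \<Rightarrow> 'r) set \<Rightarrow> 'a set)" where
  "unit_NG k A = (\<lambda>m. \<lambda>a\<in>carrier (smod A m). Nplus_map (k_simplex k m) A (yoneda k A m a))"

text \<open>
  The class of the identity of \<open>{..<m}\<close> in degree \<open>m\<close> of \<open>N\<^sup>+(k[\<Delta>(-, m)])\<close>. The counit sends the
  class \<open>X\<close> of a chain map \<open>f\<close> to the value of \<open>f\<close> on it, which is the same for all \<open>f \<in> X\<close>.
\<close>

definition top_class :: "('r, 'x) ring_scheme \<Rightarrow> nat \<Rightarrow> ((nat \<Rightarrow> nat) \<Rightarrow> 'r) set" where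
  "top_class k m = degenerate (k_simplex k m) m
     +>\<^bsub>smod (k_simplex k m) m\<^esub> free_gen k (Delta_hom m m) (Delta_id m)"

definition counit_NG ::
  "('r, 'x) ring_scheme \<Rightarrow> ('r, 'c) complx \<Rightarrow> int
     \<Rightarrow> (int \<Rightarrow> ((nat \<Rightarrow> nat) \<Rightarrow> 'r) set \<Rightarrow> 'c) set \<Rightarrow> 'c" where
  "counit_NG k C = (\<lambda>n. \<lambda>X\<in>carrier (cmod (Nplus (Gamma_plus k C)) n).
     if 0 \<le> n then the_elem ((\<lambda>f. f n (top_class k (nat n))) ` X) else \<zero>\<^bsub>cmod C n\<^esub>)"

end

theory Submission
  imports Defs
begin

text \<open>
  A chain map out of \<open>N\<^sup>+(k[\<Delta>(-, m)])\<close> is determined by its values on the classes of the generators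
  \<open>\<phi>\<close>, and the class of \<open>\<phi>\<close> is the image of the top class under \<open>\<phi>\<^sub>*\<close>. Functoriality, naturality and
  the triangle identities thus reduce to computations with generators.

  The counit is surjective on a non-negative complex: given \<open>c\<close> in degree \<open>m\<close>, send the identity to
  \<open>c\<close>, the zeroth coface to \<open>\<partial>c\<close> and all other generators to zero. It is injective because every element
  is the sum of a degenerate one and one killed by all faces except the zeroth, and a chain map of
  the second kind that vanishes on the top class vanishes on all generators.

  By the triangle identity \<open>N\<^sup>+\<close> of the unit is then bijective, and \<open>N\<^sup>+\<close> reflects
  isomorphisms: by induction on the degree, surjectivity propagates through degenerate elements, and
  injectivity holds since a degenerate element whose faces all vanish is zero.
\<close>

section \<open>Linear maps\<close>

text \<open>\<open>Nplus\<close> is a quotient, while the combinatorics is transparent on elements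
  killed by all faces but the zeroth; \<open>decompose\<close> passes from one to the other by
  choosing such an element in every class. For a chain map g of this kind, compatibility with the
  differential at the identity simplex has a single surviving term, the value at the zeroth coface.
  This is how vanishing on the top class spreads to that coface.

  Non-negativity enters only through surjectivity of the counit. Since N^+ is zero in degree -1, a
  chain map out of it has cycles as values in degree 0, so over a general complex a degree 0 element
  that is not a cycle is never reached.

  A direct proof that the unit is bijective would have to lift a chain map N^+(k[\<Delta>(-, m)])
  \<rightarrow> N^+(A) to an element of A. Reflecting isomorphisms along N^+ replaces this lifting
  by an induction that looks only one index down.\<close>

lemma (in abelian_group) a_inv_zero [simp]: "\<ominus> \<zero> = \<zero>"
  by (rule minus_equality) simp_all

lemma (in abelian_group) diff_eq_zero:
  "x \<in> carrier G \<Longrightarrow> y \<in> carrier G \<Longrightarrow> x \<ominus> y = \<zero> \<longleftrightarrow> x = y"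
  using minus_equality[of x "\<ominus> y"] by (auto simp: a_minus_def r_neg)

lemma (in abelian_group) neg_add_cancel:
  "x \<in> carrier G \<Longrightarrow> y \<in> carrier G \<Longrightarrow> \<ominus> y \<oplus> (x \<oplus> y) = x"
  by (simp add: a_comm[of x y] r_neg1)

text \<open>\<open>mod_hom\<close> also demands extensionality, which composites and pointwise sums
  written as plain abstractions do not have. The locale keeps only linearity;
  \<open>restrict_in_mod_hom\<close> and \<open>in_mod_hom_iff\<close> lead back to
  \<open>mod_hom\<close>.\<close>

locale linear_map = source: module k M + target: module k N
  for k :: "('r, 'x) ring_scheme" and M :: "('r, 'a) module" and N :: "('r, 'b) module" +
  fixes f :: "'a \<Rightarrow> 'b"
  assumes closed [simp, intro]: "x \<in> carrier M \<Longrightarrow> f x \<in> carrier N"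
    and add: "x \<in> carrier M \<Longrightarrow> y \<in> carrier M \<Longrightarrow> f (x \<oplus>\<^bsub>M\<^esub> y) = f x \<oplus>\<^bsub>N\<^esub> f y"
    and smult: "r \<in> carrier k \<Longrightarrow> x \<in> carrier M \<Longrightarrow> f (r \<odot>\<^bsub>M\<^esub> x) = r \<odot>\<^bsub>N\<^esub> f x"
begin

lemma zero [simp]: "f \<zero>\<^bsub>M\<^esub> = \<zero>\<^bsub>N\<^esub>"
  using add[of "\<zero>\<^bsub>M\<^esub>" "\<zero>\<^bsub>M\<^esub>"] target.add.r_cancel_one'[of "f \<zero>\<^bsub>M\<^esub>" "f \<zero>\<^bsub>M\<^esub>"] by simp

lemma minus: "x \<in> carrier M \<Longrightarrow> f (\<ominus>\<^bsub>M\<^esub> x) = \<ominus>\<^bsub>N\<^esub> f x"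
  using add[of "\<ominus>\<^bsub>M\<^esub> x" x] by (simp add: source.M.l_neg target.M.minus_equality)

lemma diff: "x \<in> carrier M \<Longrightarrow> y \<in> carrier M \<Longrightarrow> f (x \<ominus>\<^bsub>M\<^esub> y) = f x \<ominus>\<^bsub>N\<^esub> f y"
  by (simp add: a_minus_def add minus)

lemma finsum:
  assumes "\<And>i. i \<in> I \<Longrightarrow> g i \<in> carrier M"
  shows "f (\<Oplus>\<^bsub>M\<^esub>i\<in>I. g i) = (\<Oplus>\<^bsub>N\<^esub>i\<in>I. f (g i))"
  using assms
\<comment> \<open>Over an infinite index set \<open>finsum\<close> is zero by convention on both
  sides, and this case closes with \<open>f\<close> preserving zero.\<close>
proof (induction I rule: infinite_finite_induct)
  case (insert i I)
  then show ?case by (simp add: Pi_def add)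
qed simp_all

lemma restrict_in_mod_hom: "restrict f (carrier M) \<in> mod_hom k M N"
  by (auto simp: mod_hom_def add smult)

lemma in_mod_hom_iff: "f \<in> mod_hom k M N \<longleftrightarrow> f \<in> extensional (carrier M)"
  by (auto simp: mod_hom_def add smult PiE_def)

end

lemma mod_hom_linear_map:
  "module k M \<Longrightarrow> module k N \<Longrightarrow> f \<in> mod_hom k M N \<Longrightarrow> linear_map k M N f"
  by (auto simp: mod_hom_def linear_map_def linear_map_axioms_def)

lemma mod_hom_extensional: "f \<in> mod_hom k M N \<Longrightarrow> f \<in> extensional (carrier M)"
  by (simp add: mod_hom_def PiE_def)

lemma linear_map_comp:
  "linear_map k M N f \<Longrightarrow> linear_map k N P g \<Longrightarrow> linear_map k M P (\<lambda>x. g (f x))"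
  by (simp add: linear_map_def linear_map_axioms_def)

lemma linear_map_cong:
  assumes "\<And>x. x \<in> carrier M \<Longrightarrow> f x = g x"
  shows "linear_map k M N f \<longleftrightarrow> linear_map k M N g"
proof -
  have "linear_map k M N h" if h: "linear_map k M N h'" and eq: "\<And>x. x \<in> carrier M \<Longrightarrow> h x = h' x" for h h'
  proof -
    interpret h': linear_map k M N h' by fact
    show ?thesis by unfold_locales (simp_all add: eq h'.add h'.smult)
  qed
  from this[of f g] this[of g f] assms show ?thesis by auto
qed

lemma zero_module_module:
  assumes "cring k" shows "module k (zero_module z)"
proof -
  interpret cring k by fact
  show ?thesis
  by (rule moduleI) (auto simp: zero_module_def assms intro!: abelian_groupI)
qed

lemma zero_module_carrier [simp]: "carrier (zero_module z) = {z}"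
  and zero_module_zero [simp]: "\<zero>\<^bsub>zero_module z\<^esub> = z"
  by (simp_all add: zero_module_def)

lemma linear_map_bij_inv:
  assumes "linear_map k M N f" "bij_betw f (carrier M) (carrier N)"
  shows "linear_map k N M (inv_into (carrier M) f)"
proof -
  interpret f: linear_map k M N f by fact
  let ?g = "inv_into (carrier M) f"
  have g: "?g y \<in> carrier M" "f (?g y) = y" if "y \<in> carrier N" for y
    using that assms(2) by (auto simp: bij_betw_def inv_into_into f_inv_into_f)
  have inj: "x = y" if "x \<in> carrier M" "y \<in> carrier M" "f x = f y" for x y
    using that assms(2) by (auto simp: bij_betw_def inj_on_def)
  show ?thesis
    by unfold_locales (auto intro!: inj simp: g f.add f.smult)
qed

section \<open>Quotient modules\<close>

locale submodule_of = module k M for k :: "('r, 'x) ring_scheme" and M :: "('r, 'a) module" (structure) +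
  fixes H :: "'a set"
  assumes sub: "submodule H k M"
begin

lemma subset: "H \<subseteq> carrier M" and zero_in [simp]: "\<zero> \<in> H"
  and minus_in: "x \<in> H \<Longrightarrow> \<ominus> x \<in> H"
  and add_in: "x \<in> H \<Longrightarrow> y \<in> H \<Longrightarrow> x \<oplus> y \<in> H"
  and smult_in: "r \<in> carrier k \<Longrightarrow> x \<in> H \<Longrightarrow> r \<odot> x \<in> H"
  using submoduleE[OF sub] subgroup.one_closed[OF submodule.axioms(1)[OF sub]] by auto

lemma in_carrier: "x \<in> H \<Longrightarrow> x \<in> carrier M"
  using subset by blast

lemma finsum_in: "(\<And>i. i \<in> I \<Longrightarrow> g i \<in> H) \<Longrightarrow> (\<Oplus>i\<in>I. g i) \<in> H"
proof (induction I rule: infinite_finite_induct)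
  case (insert i I)
  then have "g \<in> I \<rightarrow> carrier M" "g i \<in> carrier M" using in_carrier by auto
  with insert show ?case by (simp add: add_in)
qed simp_all

sublocale sg: abelian_subgroup H M
  by (rule abelian_subgroupI3)
    (simp_all add: additive_subgroup_def submodule.axioms(1)[OF sub] is_abelian_group M.abelian_group_axioms)

lemma carrier_quot: "carrier (quot_module M H) = (\<lambda>x. H +> x) ` carrier M"
  by (auto simp: quot_module_def A_RCOSETS_def' )

lemma coset_eq_iff:
  "x \<in> carrier M \<Longrightarrow> y \<in> carrier M \<Longrightarrow> H +> x = H +> y \<longleftrightarrow> x \<ominus> y \<in> H"
  using sg.a_rcos_module_imp[of y x] sg.a_rcos_module_rev[of y x] sg.a_rcos_self[of x]
    sg.a_repr_independence'[of x y]
  by (auto simp: a_minus_def)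

lemma coset_eq_zero_iff: "x \<in> carrier M \<Longrightarrow> H +> x = H \<longleftrightarrow> x \<in> H"
  using coset_eq_iff[of x \<zero>] subset by (simp add: a_minus_def)

lemma zero_quot: "\<zero>\<^bsub>quot_module M H\<^esub> = H"
  by (simp add: quot_module_def)

lemma add_quot: "x \<in> carrier M \<Longrightarrow> y \<in> carrier M \<Longrightarrow> (H +> x) \<oplus>\<^bsub>quot_module M H\<^esub> (H +> y) = H +> (x \<oplus> y)"
  by (simp add: quot_module_def sg.a_rcos_sum)

lemma coset_member: "x \<in> carrier M \<Longrightarrow> y \<in> H +> x \<longleftrightarrow> y \<in> carrier M \<and> y \<ominus> x \<in> H"
  by (metis coset_eq_iff sg.a_elemrcos_carrier sg.a_rcos_self sg.a_repr_independence')

text \<open>\<open>quot_module\<close> and \<open>quot_map\<close> are defined by unions over all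
  representatives; this collapses such a union to one representative when the summands agree on the
  coset.\<close>

lemma UN_coset:
  assumes "x \<in> carrier M" "\<And>y. y \<in> carrier M \<Longrightarrow> y \<ominus> x \<in> H \<Longrightarrow> F y = F x"
  shows "(\<Union>y\<in>H +> x. F y) = F x"
proof -
  have "F y = F x" if "y \<in> H +> x" for y using that assms by (auto simp: coset_member)
  moreover have "x \<in> H +> x" using assms(1) by (rule sg.a_rcos_self)
  ultimately show ?thesis by blast
qed

lemma smult_quot:
  assumes "r \<in> carrier k" "x \<in> carrier M"
  shows "r \<odot>\<^bsub>quot_module M H\<^esub> (H +> x) = H +> (r \<odot> x)"
proof -
  have "H +> (r \<odot> y) = H +> (r \<odot> x)" if "y \<in> carrier M" "y \<ominus> x \<in> H" for y
  proof -
    have "r \<odot> y \<ominus> r \<odot> x = r \<odot> (y \<ominus> x)"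
      using assms that by (simp add: a_minus_def smult_r_distr smult_r_minus)
    then show ?thesis using assms that smult_in by (simp add: coset_eq_iff)
  qed
  then show ?thesis using UN_coset[of x "\<lambda>y. H +> (r \<odot> y)"] assms by (simp add: quot_module_def)
qed

lemma abelian_group_quot: "abelian_group (quot_module M H)"
proof (rule abelian_groupI)
  fix X assume "X \<in> carrier (quot_module M H)"
  then obtain x where x: "x \<in> carrier M" "X = H +> x" by (auto simp: carrier_quot)
  then show "\<exists>Y\<in>carrier (quot_module M H). Y \<oplus>\<^bsub>quot_module M H\<^esub> X = \<zero>\<^bsub>quot_module M H\<^esub>"
    by (intro bexI[of _ "H +> (\<ominus> x)"])
      (auto simp: add_quot zero_quot coset_eq_zero_iff l_neg M.l_neg carrier_quot)
  show "\<zero>\<^bsub>quot_module M H\<^esub> \<oplus>\<^bsub>quot_module M H\<^esub> X = X"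
    using x add_quot[of \<zero> x] by (simp add: zero_quot coset_eq_zero_iff[THEN iffD2])
next
  show "\<zero>\<^bsub>quot_module M H\<^esub> \<in> carrier (quot_module M H)"
    unfolding carrier_quot zero_quot by (rule image_eqI[of _ _ \<zero>]) (simp_all add: coset_eq_zero_iff[THEN iffD2])
qed (auto simp: carrier_quot add_quot M.a_ac)

lemma module_quot: "module k (quot_module M H)"
  by (rule moduleI)
    (auto simp: carrier_quot smult_quot add_quot abelian_group_quot R.is_cring smult_l_distr
      smult_r_distr smult_assoc1)

lemma linear_map_proj: "linear_map k M (quot_module M H) (\<lambda>x. H +> x)"
proof -
  interpret q: module k "quot_module M H" by (rule module_quot)
  show ?thesis by unfold_locales (auto simp: carrier_quot add_quot smult_quot)
qed

lemma quot_cases: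
  assumes "X \<in> carrier (quot_module M H)"
  obtains x where "x \<in> carrier M" "X = H +> x"
  using assms by (auto simp: carrier_quot)

lemma quot_map_extensional: "quot_map M H N K f \<in> extensional (carrier (quot_module M H))"
  by (simp add: quot_map_def)

end

lemma
  assumes f: "linear_map k M N f" and H: "submodule H k M" and K: "submodule K k N"
    and sub: "f ` H \<subseteq> K"
  shows quot_map_coset: "x \<in> carrier M \<Longrightarrow> quot_map M H N K f (H +>\<^bsub>M\<^esub> x) = K +>\<^bsub>N\<^esub> f x"
    and quot_map_in_mod_hom: "quot_map M H N K f \<in> mod_hom k (quot_module M H) (quot_module N K)"
proof -
  interpret linear_map k M N f by fact
  interpret H: submodule_of k M H using H by (simp add: submodule_of_def submodule_of_axioms_def source.module_axioms)
  interpret K: submodule_of k N K using K by (simp add: submodule_of_def submodule_of_axioms_def target.module_axioms)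
  have val: "quot_map M H N K f (H +>\<^bsub>M\<^esub> x) = K +>\<^bsub>N\<^esub> f x" if x: "x \<in> carrier M" for x
  proof -
    have "K +>\<^bsub>N\<^esub> f y = K +>\<^bsub>N\<^esub> f x" if y: "y \<in> carrier M" "y \<ominus>\<^bsub>M\<^esub> x \<in> H" for y
      using x y sub by (auto simp: K.coset_eq_iff diff[symmetric])
    then show ?thesis
      using x H.UN_coset[of x "\<lambda>y. K +>\<^bsub>N\<^esub> f y"] by (simp add: quot_map_def H.carrier_quot)
  qed
  then show "x \<in> carrier M \<Longrightarrow> quot_map M H N K f (H +>\<^bsub>M\<^esub> x) = K +>\<^bsub>N\<^esub> f x" .
  show "quot_map M H N K f \<in> mod_hom k (quot_module M H) (quot_module N K)"
    unfolding mod_hom_def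
    using H.quot_map_extensional
    by (auto simp: PiE_def val H.carrier_quot K.carrier_quot H.add_quot H.smult_quot add smult K.add_quot K.smult_quot)
qed

context submodule_of
begin

lemma quot_linearI:
  assumes "linear_map k M N (\<lambda>x. F (H +> x))"
  shows "linear_map k (quot_module M H) N F"
proof -
  interpret q: module k "quot_module M H" by (rule module_quot)
  interpret F: linear_map k M N "\<lambda>x. F (H +> x)" by fact
  show ?thesis
    by unfold_locales
      (auto elim!: quot_cases simp: add_quot smult_quot F.add F.smult intro: F.closed)
qed

text \<open>The factorization through M/H of a linear map that kills H, written with
  \<open>the_elem\<close> because \<open>counit_NG\<close> has this form.\<close>

lemma
  assumes u: "linear_map k M N u" and ker: "\<And>x. x \<in> H \<Longrightarrow> u x = \<zero>\<^bsub>N\<^esub>"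
  shows the_elem_coset: "x \<in> carrier M \<Longrightarrow> the_elem (u ` (H +> x)) = u x"
    and the_elem_coset_linear: "linear_map k (quot_module M H) N (\<lambda>X. the_elem (u ` X))"
proof -
  interpret u: linear_map k M N u by fact
  have val: "the_elem (u ` (H +> x)) = u x" if x: "x \<in> carrier M" for x
  proof -
    have "u y = u x" if "y \<in> H +> x" for y
    proof -
      from that x have y: "y \<in> carrier M" "y \<ominus> x \<in> H" by (simp_all add: coset_member)
      then have "u y \<ominus>\<^bsub>N\<^esub> u x = \<zero>\<^bsub>N\<^esub>" using ker x u.diff by metis
      then show ?thesis using x y by (simp add: u.target.M.diff_eq_zero)
    qed
    moreover have "x \<in> H +> x" using x by (rule sg.a_rcos_self)
    ultimately have "u ` (H +> x) = {u x}" by blast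
    then show ?thesis by simp
  qed
  then show "x \<in> carrier M \<Longrightarrow> the_elem (u ` (H +> x)) = u x" .
  have "linear_map k M N (\<lambda>x. the_elem (u ` (H +> x)))"
    using u linear_map_cong[of M "\<lambda>x. the_elem (u ` (H +> x))" u k N] val by blast
  then show "linear_map k (quot_module M H) N (\<lambda>X. the_elem (u ` X))"
    by (rule quot_linearI)
qed

end

section \<open>Sums of linear maps\<close>

lemma linear_map_zero:
  assumes "module k M" "module k N"
  shows "linear_map k M N (\<lambda>_. \<zero>\<^bsub>N\<^esub>)"
proof -
  interpret M: module k M by fact
  interpret N: module k N by fact
  show ?thesis by unfold_locales simp_all
qed

lemma linear_map_add:
  assumes "linear_map k M N f" "linear_map k M N g"
  shows "linear_map k M N (\<lambda>x. f x \<oplus>\<^bsub>N\<^esub> g x)"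
proof -
  interpret f: linear_map k M N f by fact
  interpret g: linear_map k M N g by fact
  show ?thesis
    by unfold_locales (simp_all add: f.add g.add f.smult g.smult f.target.M.a_ac f.target.smult_r_distr)
qed

lemma linear_map_finsum:
  assumes "module k M" "module k N" "\<And>i. i \<in> I \<Longrightarrow> linear_map k M N (F i)"
  shows "linear_map k M N (\<lambda>x. \<Oplus>\<^bsub>N\<^esub>i\<in>I. F i x)"
proof -
  interpret N: module k N by fact
  show ?thesis
    using assms(3)
  proof (induction I rule: infinite_finite_induct)
    case (insert i I)
    have "(\<Oplus>\<^bsub>N\<^esub>j\<in>insert i I. F j x) = F i x \<oplus>\<^bsub>N\<^esub> (\<Oplus>\<^bsub>N\<^esub>j\<in>I. F j x)" if "x \<in> carrier M" for x
      using insert that by (intro N.M.finsum_insert) (auto intro: linear_map.closed)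
    moreover have "linear_map k M N (\<lambda>x. F i x \<oplus>\<^bsub>N\<^esub> (\<Oplus>\<^bsub>N\<^esub>j\<in>I. F j x))"
      using insert by (intro linear_map_add) auto
    ultimately show ?case
      by (rule linear_map_cong[THEN iffD2])
  qed (simp_all add: linear_map_zero assms)
qed

text \<open>Preimages of submodules are the test sets for \<open>degenerate_least\<close>: they
  reduce claims about all degenerate elements to single degeneracies.\<close>

lemma (in linear_map) submodule_vimage:
  assumes "submodule K k N"
  shows "submodule {x \<in> carrier M. f x \<in> K} k M"
proof -
  interpret K: submodule_of k N K
    using assms by (simp add: submodule_of_def submodule_of_axioms_def target.module_axioms)
  show ?thesis
    by (rule source.submoduleI) (auto simp: add smult minus K.add_in K.smult_in K.minus_in)
qed

lemma (in linear_map) inj_onI_kernel: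
  assumes "\<And>x. x \<in> carrier M \<Longrightarrow> f x = \<zero>\<^bsub>N\<^esub> \<Longrightarrow> x = \<zero>\<^bsub>M\<^esub>"
  shows "inj_on f (carrier M)"
proof (rule inj_onI)
  fix x y assume xy: "x \<in> carrier M" "y \<in> carrier M" "f x = f y"
  then have "f (x \<ominus>\<^bsub>M\<^esub> y) = \<zero>\<^bsub>N\<^esub>" by (simp add: diff target.M.diff_eq_zero)
  then have "x \<ominus>\<^bsub>M\<^esub> y = \<zero>\<^bsub>M\<^esub>" using xy by (intro assms) simp_all
  with xy show "x = y" by (simp add: source.M.diff_eq_zero)
qed

lemma (in linear_map) submodule_image: "submodule (f ` carrier M) k N"
proof (rule target.submoduleI)
  show "\<zero>\<^bsub>N\<^esub> \<in> f ` carrier M" by (rule image_eqI[of _ _ "\<zero>\<^bsub>M\<^esub>"]) simp_all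
qed (auto simp: add[symmetric] smult[symmetric] minus[symmetric])

section \<open>Signs and cancellation in alternating sums\<close>

definition signed :: "('r, 'a) module \<Rightarrow> nat \<Rightarrow> 'a \<Rightarrow> 'a" where
  "signed M i x = (if even i then x else \<ominus>\<^bsub>M\<^esub> x)"

context abelian_group
begin

text \<open>The entry (i, j) with j < i cancels against (j, i - 1). In the induction step the new
  row \<open>t (Suc n) j\<close> cancels against the new column \<open>t j n\<close>, and the
  remaining square is covered by the induction hypothesis.\<close>

lemma alternating_double_sum:
  assumes "\<And>i j. i \<le> n \<Longrightarrow> j < n \<Longrightarrow> t i j \<in> carrier G"
    and "\<And>i j. j < i \<Longrightarrow> i \<le> n \<Longrightarrow> t i j = \<ominus> t j (i - 1)"
  shows "(\<Oplus>i\<in>{..<Suc n}. \<Oplus>j\<in>{..<n}. t i j) = \<zero>"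
  using assms
proof (induction n)
  case (Suc n)
  note t = Suc.prems(1)
  have row: "(\<Oplus>j\<in>{..<Suc n}. t i j) = t i n \<oplus> (\<Oplus>j\<in>{..<n}. t i j)" if "i \<le> Suc n" for i
    unfolding lessThan_Suc using that t by (intro finsum_insert) auto
  have "(\<Oplus>i\<in>{..<Suc n}. \<Oplus>j\<in>{..<Suc n}. t i j)
      = (\<Oplus>i\<in>{..<Suc n}. t i n \<oplus> (\<Oplus>j\<in>{..<n}. t i j))"
    using t by (intro finsum_cong') (auto simp: row simp del: lessThan_Suc)
  also have "\<dots> = (\<Oplus>i\<in>{..<Suc n}. t i n) \<oplus> (\<Oplus>i\<in>{..<Suc n}. \<Oplus>j\<in>{..<n}. t i j)"
    using t by (intro finsum_addf) auto
  also have "(\<Oplus>i\<in>{..<Suc n}. \<Oplus>j\<in>{..<n}. t i j) = \<zero>"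
    using Suc.prems by (intro Suc.IH) auto
  finally have upper: "(\<Oplus>i\<in>{..<Suc n}. \<Oplus>j\<in>{..<Suc n}. t i j) = (\<Oplus>i\<in>{..<Suc n}. t i n)"
    using t by (simp del: lessThan_Suc)
  have last: "(\<Oplus>j\<in>{..<Suc n}. t (Suc n) j) \<oplus> (\<Oplus>j\<in>{..<Suc n}. t j n)
      = (\<Oplus>j\<in>{..<Suc n}. t (Suc n) j \<oplus> t j n)"
    using t by (intro finsum_addf[symmetric]) auto
  also have "\<dots> = \<zero>"
    using Suc.prems(2)[of _ "Suc n"] t
    by (intro add.finprod_one_eqI) (auto simp: l_neg)
  finally have last: "(\<Oplus>j\<in>{..<Suc n}. t (Suc n) j) \<oplus> (\<Oplus>j\<in>{..<Suc n}. t j n) = \<zero>" .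
  have "(\<Oplus>i\<in>{..<Suc (Suc n)}. \<Oplus>j\<in>{..<Suc n}. t i j)
      = (\<Oplus>j\<in>{..<Suc n}. t (Suc n) j) \<oplus> (\<Oplus>i\<in>{..<Suc n}. \<Oplus>j\<in>{..<Suc n}. t i j)"
    unfolding lessThan_Suc[of "Suc n"] using t by (intro finsum_insert) auto
  then show ?case using upper last by simp
qed simp

end

lemma signed_closed: "module k M \<Longrightarrow> x \<in> carrier M \<Longrightarrow> signed M i x \<in> carrier M"
  and signed_Suc: "module k M \<Longrightarrow> x \<in> carrier M \<Longrightarrow> signed M (Suc i) x = \<ominus>\<^bsub>M\<^esub> signed M i x"
  and signed_commute: "signed M i (signed M j x) = signed M j (signed M i x)"
  by (auto simp: signed_def module_def abelian_group.a_inv_closed abelian_group.minus_minus)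

lemma (in linear_map) signed: "x \<in> carrier M \<Longrightarrow> f (signed M i x) = signed N i (f x)"
  by (simp add: signed_def minus)

lemma (in linear_map) linear_map_signed: "linear_map k M N (\<lambda>x. signed N i (f x))"
  by unfold_locales
    (auto simp: signed_def add smult target.M.minus_add target.smult_r_minus)

lemma (in submodule_of) signed_in: "x \<in> H \<Longrightarrow> signed M i x \<in> H"
  by (simp add: signed_def minus_in)

section \<open>Cofaces and codegeneracies\<close>

lemma Delta_hom_less: "\<theta> \<in> Delta_hom p m \<Longrightarrow> j < p \<Longrightarrow> \<theta> j < m"
  by (auto simp: Delta_hom_def)

lemma Delta_hom_mono: "\<theta> \<in> Delta_hom p m \<Longrightarrow> i \<le> j \<Longrightarrow> j < p \<Longrightarrow> \<theta> i \<le> \<theta> j"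
  by (auto simp: Delta_hom_def mono_on_def)

lemma Delta_hom_extensional: "\<theta> \<in> Delta_hom p m \<Longrightarrow> \<theta> \<in> extensional {..<p}"
  by (simp add: Delta_hom_def PiE_def)

lemma Delta_homI:
  assumes "\<theta> \<in> extensional {..<p}" "\<And>j. j < p \<Longrightarrow> \<theta> j < m"
    "\<And>i j. i \<le> j \<Longrightarrow> j < p \<Longrightarrow> \<theta> i \<le> \<theta> j"
  shows "\<theta> \<in> Delta_hom p m"
  using assms by (auto simp: Delta_hom_def PiE_def mono_on_def)

lemma Delta_hom_eqI:
  assumes "\<theta> \<in> Delta_hom p m" "\<phi> \<in> Delta_hom p m" "\<And>j. j < p \<Longrightarrow> \<theta> j = \<phi> j"
  shows "\<theta> = \<phi>"
  using assms by (intro extensionalityI[of \<theta> "{..<p}" \<phi>]) (auto simp: Delta_hom_extensional)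

lemma finite_Delta_hom [simp]: "finite (Delta_hom p m)"
  by (rule finite_subset[of _ "{..<p} \<rightarrow>\<^sub>E {..<m}"]) (auto simp: Delta_hom_def intro: finite_PiE)

lemma Delta_id_in [simp]: "Delta_id m \<in> Delta_hom m m"
  by (rule Delta_homI) (auto simp: Delta_id_def)

lemma coface_in [simp]: "i \<le> m \<Longrightarrow> coface m i \<in> Delta_hom m (Suc m)"
  by (rule Delta_homI) (auto simp: coface_def)

lemma codegen_in [simp]: "i < m \<Longrightarrow> codegen m i \<in> Delta_hom (Suc m) m"
  by (rule Delta_homI) (auto simp: codegen_def)

lemma compose_in [simp]:
  assumes "\<psi> \<in> Delta_hom q p" "\<theta> \<in> Delta_hom p m"
  shows "compose {..<q} \<theta> \<psi> \<in> Delta_hom q m"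
proof (rule Delta_homI)
  fix i j assume "i \<le> j" "j < q"
  with assms show "compose {..<q} \<theta> \<psi> i \<le> compose {..<q} \<theta> \<psi> j"
    by (simp add: compose_eq Delta_hom_mono[OF assms(2)] Delta_hom_mono[OF assms(1)] Delta_hom_less[OF assms(1)])
qed (simp_all add: compose_eq Delta_hom_less[OF assms(2)] Delta_hom_less[OF assms(1)])

lemma compose_Delta_id: "\<theta> \<in> Delta_hom p m \<Longrightarrow> compose {..<p} \<theta> (Delta_id p) = \<theta>"
  by (rule Delta_hom_eqI[of _ p m, OF compose_in[OF Delta_id_in]]) (auto simp: compose_def Delta_id_def)

lemma Delta_id_compose: "\<theta> \<in> Delta_hom p m \<Longrightarrow> compose {..<p} (Delta_id m) \<theta> = \<theta>"
  by (rule Delta_hom_eqI[of _ p m, OF compose_in[OF _ Delta_id_in]])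
    (auto simp: compose_def Delta_id_def Delta_hom_less)

lemma compose_Delta_assoc:
  "\<chi> \<in> Delta_hom r q \<Longrightarrow> compose {..<r} (compose {..<q} \<theta> \<psi>) \<chi> = compose {..<r} \<theta> (compose {..<r} \<psi> \<chi>)"
  by (auto simp: compose_def Delta_hom_less)

text \<open>The cosimplicial identities. As \<open>sact\<close> is contravariant, each of them
  reverses into a relation between faces and degeneracies of an augmented simplicial module.\<close>

lemma coface_coface:
  "j < i \<Longrightarrow> compose {..<m} (coface (Suc m) i) (coface m j) = compose {..<m} (coface (Suc m) j) (coface m (i - 1))"
  unfolding compose_def coface_def restrict_def fun_eq_iff lessThan_iff by simp arith

lemma codegen_coface_less:
  "j < i \<Longrightarrow> i < Suc m \<Longrightarrow>
    compose {..<Suc m} (codegen (Suc m) i) (coface (Suc m) j) = compose {..<Suc m} (coface m j) (codegen m (i - 1))"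
  unfolding compose_def coface_def codegen_def restrict_def fun_eq_iff lessThan_iff by simp arith

lemma codegen_coface_id:
  "j = i \<or> j = Suc i \<Longrightarrow> i < m \<Longrightarrow> compose {..<m} (codegen m i) (coface m j) = Delta_id m"
  by (auto simp: compose_def coface_def codegen_def restrict_def fun_eq_iff Delta_id_def)

lemma codegen_coface_greater:
  "Suc i < j \<Longrightarrow> j \<le> Suc m \<Longrightarrow>
    compose {..<Suc m} (codegen (Suc m) i) (coface (Suc m) j) = compose {..<Suc m} (coface m (j - 1)) (codegen m i)"
  unfolding compose_def coface_def codegen_def restrict_def fun_eq_iff lessThan_iff by simp arith

lemma codegen_codegen:
  "i < j \<Longrightarrow> j \<le> m \<Longrightarrow>
    compose {..<Suc (Suc m)} (codegen m i) (codegen (Suc m) j)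
      = compose {..<Suc (Suc m)} (codegen m (j - 1)) (codegen (Suc m) i)"
  unfolding compose_def coface_def codegen_def restrict_def fun_eq_iff lessThan_iff by simp arith

section \<open>Augmented simplicial modules\<close>

locale aug_smod = cring k for k :: "('r, 'x) ring_scheme" (structure) +
  fixes A :: "('r, 'a) asmod"
  assumes in_SpMod: "A \<in> SpMod k"
begin

lemma module_smod: "module k (smod A m)"
  using in_SpMod by (simp add: SpMod_def)

sublocale sm: module k "smod A m" for m
  by (rule module_smod)

lemma sact_linear: "\<theta> \<in> Delta_hom p m \<Longrightarrow> linear_map k (smod A m) (smod A p) (sact A p m \<theta>)"
  using in_SpMod by (intro mod_hom_linear_map module_smod) (auto simp: SpMod_def)

lemmas sact_closed [simp] = linear_map.closed[OF sact_linear]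
  and sact_add = linear_map.add[OF sact_linear]
  and sact_smult = linear_map.smult[OF sact_linear]
  and sact_zero [simp] = linear_map.zero[OF sact_linear]

lemma sact_id [simp]: "x \<in> carrier (smod A m) \<Longrightarrow> sact A m m (Delta_id m) x = x"
  using in_SpMod by (simp add: SpMod_def)

lemma sact_comp:
  assumes "\<psi> \<in> Delta_hom q p" "\<theta> \<in> Delta_hom p m" "x \<in> carrier (smod A m)"
  shows "sact A q p \<psi> (sact A p m \<theta> x) = sact A q m (compose {..<q} \<theta> \<psi>) x"
proof -
  have "sact A q m (compose {..<q} \<theta> \<psi>) = compose (carrier (smod A m)) (sact A q p \<psi>) (sact A p m \<theta>)"
    using in_SpMod assms(1,2) unfolding SpMod_def by blast
  then show ?thesis by (simp add: compose_eq assms(3))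
qed

text \<open>Both \<open>face m i\<close> and \<open>degen m i\<close> carry the smaller of their two
  indices, so that no truncated subtraction \<open>m - 1\<close> occurs.\<close>

definition face :: "nat \<Rightarrow> nat \<Rightarrow> 'a \<Rightarrow> 'a" where
  "face m i = sact A m (Suc m) (coface m i)"

definition degen :: "nat \<Rightarrow> nat \<Rightarrow> 'a \<Rightarrow> 'a" where
  "degen m i = sact A (Suc m) m (codegen m i)"

lemma face_linear: "i \<le> m \<Longrightarrow> linear_map k (smod A (Suc m)) (smod A m) (face m i)"
  and degen_linear: "i < m \<Longrightarrow> linear_map k (smod A m) (smod A (Suc m)) (degen m i)"
  by (simp_all add: face_def degen_def sact_linear)

lemmas face_closed [simp] = linear_map.closed[OF face_linear]
  and degen_closed [simp] = linear_map.closed[OF degen_linear]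

lemma face_face:
  "j < i \<Longrightarrow> i \<le> Suc m \<Longrightarrow> x \<in> carrier (smod A (Suc (Suc m))) \<Longrightarrow>
    face m j (face (Suc m) i x) = face m (i - 1) (face (Suc m) j x)"
  by (simp add: face_def sact_comp coface_coface)

lemma face_degen_less:
  "j < i \<Longrightarrow> i < Suc m \<Longrightarrow> x \<in> carrier (smod A (Suc m)) \<Longrightarrow>
    face (Suc m) j (degen (Suc m) i x) = degen m (i - 1) (face m j x)"
  by (simp add: face_def degen_def sact_comp codegen_coface_less)

lemma face_degen_id:
  assumes "j = i \<or> j = Suc i" "i < m" "x \<in> carrier (smod A m)"
  shows "face m j (degen m i x) = x"
proof -
  have "j \<le> m" using assms by auto
  then show ?thesis
    using assms(2,3) codegen_coface_id[OF assms(1,2)] by (simp add: face_def degen_def sact_comp)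
qed

lemma face_degen_greater:
  "Suc i < j \<Longrightarrow> j \<le> Suc m \<Longrightarrow> x \<in> carrier (smod A (Suc m)) \<Longrightarrow>
    face (Suc m) j (degen (Suc m) i x) = degen m i (face m (j - 1) x)"
  by (simp add: face_def degen_def sact_comp codegen_coface_greater)

lemma degen_degen:
  "i < j \<Longrightarrow> j \<le> m \<Longrightarrow> x \<in> carrier (smod A m) \<Longrightarrow>
    degen (Suc m) j (degen m i x) = degen (Suc m) i (degen m (j - 1) x)"
  by (simp add: degen_def sact_comp codegen_codegen)

lemma degenerate_0: "degenerate A 0 = {\<zero>\<^bsub>smod A 0\<^esub>}"
  by (auto simp: degenerate_def)

lemma degenerate_Suc:
  "degenerate A (Suc m) = {(\<Oplus>\<^bsub>smod A (Suc m)\<^esub>i\<in>{..<m}. degen m i (x i)) | x. x \<in> {..<m} \<rightarrow> carrier (smod A m)}"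
  by (simp add: degenerate_def degen_def)

lemma degenerate_SucI:
  assumes "\<And>i. i < m \<Longrightarrow> x i \<in> carrier (smod A m)"
    "a = (\<Oplus>\<^bsub>smod A (Suc m)\<^esub>i\<in>{..<m}. degen m i (x i))"
  shows "a \<in> degenerate A (Suc m)"
  unfolding degenerate_Suc using assms by blast

lemma degenerate_SucE:
  assumes "a \<in> degenerate A (Suc m)"
  obtains x where "a = (\<Oplus>\<^bsub>smod A (Suc m)\<^esub>i\<in>{..<m}. degen m i (x i))"
    "\<And>i. i < m \<Longrightarrow> x i \<in> carrier (smod A m)"
  using assms unfolding degenerate_Suc by blast

lemma submodule_degenerate: "submodule (degenerate A m) k (smod A m)"
proof (cases m)
  case 0
  then show ?thesis by (intro sm.submoduleI) (simp_all add: degenerate_0)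
next
  case (Suc n)
  let ?M = "smod A n" and ?N = "smod A (Suc n)"
  note lin = degen_linear[of _ n]
  show ?thesis
    unfolding Suc
  proof (rule sm.submoduleI)
    show "degenerate A (Suc n) \<subseteq> carrier ?N"
      by (auto elim!: degenerate_SucE intro!: sm.M.finsum_closed)
    have "\<zero>\<^bsub>?N\<^esub> = (\<Oplus>\<^bsub>?N\<^esub>i\<in>{..<n}. degen n i \<zero>\<^bsub>?M\<^esub>)"
      by (rule sm.M.add.finprod_one_eqI[symmetric]) (simp add: linear_map.zero[OF lin])
    then show "\<zero>\<^bsub>?N\<^esub> \<in> degenerate A (Suc n)"
      by (rule degenerate_SucI[rotated]) simp
  next
    fix a b assume ab: "a \<in> degenerate A (Suc n)" "b \<in> degenerate A (Suc n)"
    from ab(1) obtain x where x: "a = (\<Oplus>\<^bsub>?N\<^esub>i\<in>{..<n}. degen n i (x i))" "\<And>i. i < n \<Longrightarrow> x i \<in> carrier ?M"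
      unfolding degenerate_Suc by blast
    from ab(2) obtain y where y: "b = (\<Oplus>\<^bsub>?N\<^esub>i\<in>{..<n}. degen n i (y i))" "\<And>i. i < n \<Longrightarrow> y i \<in> carrier ?M"
      unfolding degenerate_Suc by blast
    have "(\<Oplus>\<^bsub>?N\<^esub>i\<in>{..<n}. degen n i (x i \<oplus>\<^bsub>?M\<^esub> y i))
        = (\<Oplus>\<^bsub>?N\<^esub>i\<in>{..<n}. degen n i (x i) \<oplus>\<^bsub>?N\<^esub> degen n i (y i))"
      by (intro sm.M.finsum_cong') (auto simp: linear_map.add[OF lin] x y)
    also have "\<dots> = a \<oplus>\<^bsub>?N\<^esub> b"
      unfolding x(1) y(1) by (intro sm.M.finsum_addf) (auto simp: x y)
    finally have "a \<oplus>\<^bsub>?N\<^esub> b = (\<Oplus>\<^bsub>?N\<^esub>i\<in>{..<n}. degen n i (x i \<oplus>\<^bsub>?M\<^esub> y i))" ..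
    then show "a \<oplus>\<^bsub>?N\<^esub> b \<in> degenerate A (Suc n)"
      by (rule degenerate_SucI[rotated]) (simp add: x y)
  next
    fix r a assume r: "r \<in> carrier k" "a \<in> degenerate A (Suc n)"
    from r(2) obtain x where x: "a = (\<Oplus>\<^bsub>?N\<^esub>i\<in>{..<n}. degen n i (x i))" "\<And>i. i < n \<Longrightarrow> x i \<in> carrier ?M"
      unfolding degenerate_Suc by blast
    have "r \<odot>\<^bsub>?N\<^esub> a = (\<Oplus>\<^bsub>?N\<^esub>i\<in>{..<n}. degen n i (r \<odot>\<^bsub>?M\<^esub> x i))"
      unfolding x(1) using x(2) r(1)
      by (subst sm.finsum_smult_ldistr) (auto intro!: sm.M.finsum_cong' simp: linear_map.smult[OF lin])
    then show "r \<odot>\<^bsub>?N\<^esub> a \<in> degenerate A (Suc n)"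
      by (rule degenerate_SucI[rotated]) (simp add: x r)
  next
    fix a assume "a \<in> degenerate A (Suc n)"
    then obtain x where x: "a = (\<Oplus>\<^bsub>?N\<^esub>i\<in>{..<n}. degen n i (x i))" "\<And>i. i < n \<Longrightarrow> x i \<in> carrier ?M"
      unfolding degenerate_Suc by blast
    interpret neg: linear_map k ?N ?N "\<lambda>x. \<ominus>\<^bsub>?N\<^esub> x"
      by unfold_locales (auto simp: sm.M.minus_add sm.smult_r_minus)
    have "\<ominus>\<^bsub>?N\<^esub> a = (\<Oplus>\<^bsub>?N\<^esub>i\<in>{..<n}. degen n i (\<ominus>\<^bsub>?M\<^esub> x i))"
      unfolding x(1) using x(2)
      by (subst neg.finsum) (auto intro!: sm.M.finsum_cong' simp: linear_map.minus[OF lin])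
    then show "\<ominus>\<^bsub>?N\<^esub> a \<in> degenerate A (Suc n)"
      by (rule degenerate_SucI[rotated]) (simp add: x)
  qed
qed

sublocale dg: submodule_of k "smod A m" "degenerate A m" for m
  by (simp add: submodule_of_def submodule_of_axioms_def module_smod submodule_degenerate)

lemma degen_in_degenerate:
  assumes "i < m" "x \<in> carrier (smod A m)"
  shows "degen m i x \<in> degenerate A (Suc m)"
proof -
  let ?x = "\<lambda>j. if j = i then x else \<zero>\<^bsub>smod A m\<^esub>"
  have "(\<Oplus>\<^bsub>smod A (Suc m)\<^esub>j\<in>{..<m}. degen m j (?x j))
      = (\<Oplus>\<^bsub>smod A (Suc m)\<^esub>j\<in>{..<m}. if i = j then degen m i x else \<zero>\<^bsub>smod A (Suc m)\<^esub>)"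
    using assms by (intro sm.M.finsum_cong') (auto simp: linear_map.zero[OF degen_linear])
  also have "\<dots> = degen m i x"
    using assms sm.M.finsum_singleton[of i "{..<m}" "\<lambda>_. degen m i x" "Suc m"] by simp
  finally have "(\<Oplus>\<^bsub>smod A (Suc m)\<^esub>j\<in>{..<m}. degen m j (?x j)) = degen m i x" .
  then show ?thesis
    by (intro degenerate_SucI[OF _ sym]) (auto simp: assms)
qed

text \<open>This serves as the induction principle for degenerate elements: a property that cuts out
  a submodule has to be checked on the images of single degeneracies only.\<close>

lemma degenerate_least:
  assumes "submodule P k (smod A m)"
    "\<And>n i x. m = Suc n \<Longrightarrow> i < n \<Longrightarrow> x \<in> carrier (smod A n) \<Longrightarrow> degen n i x \<in> P"
  shows "degenerate A m \<subseteq> P"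
proof -
  interpret P: submodule_of k "smod A m" P
    using assms(1) by (simp add: submodule_of_def submodule_of_axioms_def module_smod)
  show ?thesis
  proof (cases m)
    case 0 then show ?thesis using P.zero_in by (simp add: degenerate_0)
  next
    case (Suc n)
    show ?thesis
    proof
      fix a assume "a \<in> degenerate A m"
      then show "a \<in> P"
        unfolding Suc
      proof (rule degenerate_SucE)
        fix x assume a: "a = (\<Oplus>\<^bsub>smod A (Suc n)\<^esub>i\<in>{..<n}. degen n i (x i))"
          and x: "\<And>i. i < n \<Longrightarrow> x i \<in> carrier (smod A n)"
        show "a \<in> P"
          unfolding a Suc[symmetric] by (rule P.finsum_in) (simp add: assms(2)[OF Suc] x)
      qed
    qed
  qed
qed

end

section \<open>The normalized complex\<close>

lemma int_nonnegE:
  assumes "\<not> n < 0" obtains m where "n = int m"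
  using assms that[of "nat n"] by simp

lemma int_posE:
  assumes "\<not> n \<le> 0" obtains m where "n = int (Suc m)"
  using assms that[of "nat (n - 1)"] by simp

lemma int_ge_2E:
  assumes "\<not> n \<le> 1" obtains m where "n = int (Suc (Suc m))"
  using assms that[of "nat (n - 2)"] by simp

context aug_smod
begin

lemmas smod_signed_closed [simp] = signed_closed[OF module_smod]
  and smod_signed_Suc = signed_Suc[OF module_smod]

lemma alt_face_Suc:
  "alt_face A (Suc m) x = (\<Oplus>\<^bsub>smod A m\<^esub>i\<in>{..<Suc m}. signed (smod A m) i (face m i x))"
  unfolding alt_face_def signed_def face_def diff_Suc_1 ..

lemma signed_face_linear:
  "i \<le> m \<Longrightarrow> linear_map k (smod A (Suc m)) (smod A m) (\<lambda>x. signed (smod A m) i (face m i x))"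
  by (rule linear_map.linear_map_signed) (rule face_linear)

lemma alt_face_linear: "linear_map k (smod A (Suc m)) (smod A m) (alt_face A (Suc m))"
  unfolding alt_face_Suc[abs_def]
  by (rule linear_map_finsum) (auto simp: module_smod intro: signed_face_linear)

text \<open>By d_j d_i = d_(i-1) d_j for j < i the two double faces coincide, and their signs differ
  by one parity step; \<open>alternating_double_sum\<close> does the rest.\<close>

lemma alt_face_alt_face:
  assumes "x \<in> carrier (smod A (Suc (Suc m)))"
  shows "alt_face A (Suc m) (alt_face A (Suc (Suc m)) x) = \<zero>\<^bsub>smod A m\<^esub>"
proof -
  interpret alt: linear_map k "smod A (Suc m)" "smod A m" "alt_face A (Suc m)" by (rule alt_face_linear)
  let ?s = "signed (smod A m)"
  let ?t = "\<lambda>i j. ?s j (?s i (face m j (face (Suc m) i x)))"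
  have "alt_face A (Suc m) (alt_face A (Suc (Suc m)) x)
      = (\<Oplus>\<^bsub>smod A m\<^esub>i\<in>{..<Suc (Suc m)}. alt_face A (Suc m) (signed (smod A (Suc m)) i (face (Suc m) i x)))"
    unfolding alt_face_Suc[of "Suc m"]
    by (rule alt.finsum) (auto simp: assms)
  also have "\<dots> = (\<Oplus>\<^bsub>smod A m\<^esub>i\<in>{..<Suc (Suc m)}. \<Oplus>\<^bsub>smod A m\<^esub>j\<in>{..<Suc m}. ?t i j)"
    unfolding alt_face_Suc
    by (intro sm.M.finsum_cong' refl)
      (auto simp: assms linear_map.signed[OF face_linear] intro!: sm.M.finsum_closed)
  also have "\<dots> = \<zero>\<^bsub>smod A m\<^esub>"
  proof (rule sm.M.alternating_double_sum)
    fix i j assume ij: "j < i" "i \<le> Suc m"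
    then obtain i' where i': "i = Suc i'" by (cases i) auto
    have "?t i j = ?s j (?s i (face m i' (face (Suc m) j x)))"
      using ij assms by (simp add: face_face i')
    also have "\<dots> = \<ominus>\<^bsub>smod A m\<^esub> ?t j i'"
      using ij assms by (subst signed_commute) (simp add: i' smod_signed_Suc)
    finally show "?t i j = \<ominus>\<^bsub>smod A m\<^esub> ?t j (i - 1)" by (simp add: i')
  qed (auto simp: assms)
  finally show ?thesis .
qed

text \<open>The faces i and i + 1 of s_i x are both x and enter with opposite signs. Every other
  face of s_i x is again degenerate.\<close>

lemma alt_face_degenerate: "alt_face A (Suc m) ` degenerate A (Suc m) \<subseteq> degenerate A m"
proof -
  interpret alt: linear_map k "smod A (Suc m)" "smod A m" "alt_face A (Suc m)" by (rule alt_face_linear)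
  have "degenerate A (Suc m) \<subseteq> {x \<in> carrier (smod A (Suc m)). alt_face A (Suc m) x \<in> degenerate A m}"
  proof (rule degenerate_least)
    fix n i x assume "Suc m = Suc n" "i < n" "x \<in> carrier (smod A n)"
    then have i: "i < m" and x: "x \<in> carrier (smod A m)" by simp_all
    \<comment> \<open>The relations between s_i and the other faces are stated at successor indices;
      here i < m excludes m = 0.\<close>
    then obtain m' where m': "m = Suc m'" by (cases m) auto
    let ?M = "smod A m"
    let ?F = "\<lambda>j. signed ?M j (face m j (degen m i x))"
    have F: "?F j \<in> carrier ?M" if "j \<le> m" for j
      using that i x by simp
    have rest: "?F j \<in> degenerate A m" if j: "j \<le> m" "j \<noteq> i" "j \<noteq> Suc i" for j
    proof (cases "j < i")
      case True
      with i x show ?thesis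
        by (auto simp: m' face_degen_less intro!: dg.signed_in degen_in_degenerate)
    next
      case False
      with i x j show ?thesis
        by (auto simp: m' face_degen_greater intro!: dg.signed_in degen_in_degenerate)
    qed
    let ?J = "{..<Suc m} - {i, Suc i}"
    have "{..<Suc m} = insert i (insert (Suc i) ?J)" using i by auto
    then have "alt_face A (Suc m) (degen m i x) = (\<Oplus>\<^bsub>?M\<^esub>j\<in>insert i (insert (Suc i) ?J). ?F j)"
      by (simp only: alt_face_Suc)
    also have "\<dots> = ?F i \<oplus>\<^bsub>?M\<^esub> (\<Oplus>\<^bsub>?M\<^esub>j\<in>insert (Suc i) ?J. ?F j)"
      using i F by (intro sm.M.finsum_insert) auto
    also have "(\<Oplus>\<^bsub>?M\<^esub>j\<in>insert (Suc i) ?J. ?F j) = ?F (Suc i) \<oplus>\<^bsub>?M\<^esub> (\<Oplus>\<^bsub>?M\<^esub>j\<in>?J. ?F j)"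
      using i F by (intro sm.M.finsum_insert) auto
    also have "?F i \<oplus>\<^bsub>?M\<^esub> (?F (Suc i) \<oplus>\<^bsub>?M\<^esub> (\<Oplus>\<^bsub>?M\<^esub>j\<in>?J. ?F j)) = (\<Oplus>\<^bsub>?M\<^esub>j\<in>?J. ?F j)"
    proof -
      have "(\<Oplus>\<^bsub>?M\<^esub>j\<in>?J. ?F j) \<in> carrier ?M" using F by (intro sm.M.finsum_closed) auto
      then show ?thesis using i x
        by (simp add: face_degen_id smod_signed_Suc sm.M.r_neg2)
    qed
    also have "\<dots> \<in> degenerate A m"
      using rest by (intro dg.finsum_in) auto
    finally show "degen n i x \<in> {x \<in> carrier (smod A (Suc m)). alt_face A (Suc m) x \<in> degenerate A m}"
      using i x \<open>Suc m = Suc n\<close> by simp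
  qed (rule alt.submodule_vimage[OF submodule_degenerate])
  then show ?thesis by blast
qed

end

abbreviation nclass :: "('r, 'a) asmod \<Rightarrow> nat \<Rightarrow> 'a \<Rightarrow> 'a set" where
  "nclass A m x \<equiv> degenerate A m +>\<^bsub>smod A m\<^esub> x"

lemma cmod_Nplus_nat: "cmod (Nplus A) (int m) = quot_module (smod A m) (degenerate A m)"
  and cmod_Nplus_neg: "n < 0 \<Longrightarrow> cmod (Nplus A) n = zero_module {}"
  by (simp_all add: Nplus_def Nplus_mod_def)

context aug_smod
begin

lemma module_Nplus: "module k (cmod (Nplus A) n)"
proof (cases "n < 0")
  case True
  then show ?thesis by (simp add: cmod_Nplus_neg zero_module_module is_cring)
next
  case False
  then obtain m where "n = int m" by (rule int_nonnegE)
  then show ?thesis by (simp add: cmod_Nplus_nat dg.module_quot)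
qed

lemma nclass_linear: "linear_map k (smod A m) (cmod (Nplus A) (int m)) (nclass A m)"
  unfolding cmod_Nplus_nat by (rule dg.linear_map_proj)

lemmas nclass_closed [simp] = linear_map.closed[OF nclass_linear]

lemma nclass_zero_iff:
  "x \<in> carrier (smod A m) \<Longrightarrow> nclass A m x = \<zero>\<^bsub>cmod (Nplus A) (int m)\<^esub> \<longleftrightarrow> x \<in> degenerate A m"
  by (simp add: cmod_Nplus_nat dg.zero_quot dg.coset_eq_zero_iff)

lemma Nplus_cases:
  assumes "X \<in> carrier (cmod (Nplus A) n)"
  obtains "n < 0" "X = {}" | m x where "n = int m" "x \<in> carrier (smod A m)" "X = nclass A m x"
proof (cases "n < 0")
  case True
  with that(1) assms show ?thesis by (simp add: cmod_Nplus_neg)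
next
  case False
  then obtain m where n: "n = int m" by (rule int_nonnegE)
  obtain x where "x \<in> carrier (smod A m)" "X = nclass A m x"
    using assms[unfolded n cmod_Nplus_nat] by (rule dg.quot_cases)
  with that(2) n show ?thesis by blast
qed

lemma Nplus_natE:
  assumes "X \<in> carrier (cmod (Nplus A) (int m))"
  obtains x where "x \<in> carrier (smod A m)" "X = nclass A m x"
  using assms unfolding cmod_Nplus_nat by (rule dg.quot_cases)

lemma cdiff_Nplus_Suc_in:
  "cdiff (Nplus A) (int (Suc m)) \<in> mod_hom k (cmod (Nplus A) (int (Suc m))) (cmod (Nplus A) (int m))"
  and cdiff_Nplus_nclass:
  "x \<in> carrier (smod A (Suc m)) \<Longrightarrow>
    cdiff (Nplus A) (int (Suc m)) (nclass A (Suc m) x) = nclass A m (alt_face A (Suc m) x)"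
  using quot_map_in_mod_hom[OF alt_face_linear submodule_degenerate submodule_degenerate alt_face_degenerate, of m]
    quot_map_coset[OF alt_face_linear submodule_degenerate submodule_degenerate alt_face_degenerate, of x m]
  by (simp_all add: Nplus_def Nplus_mod_def nat_add_distrib)

lemma cdiff_Nplus_le_0:
  "n \<le> 0 \<Longrightarrow> cdiff (Nplus A) n = (\<lambda>x\<in>carrier (cmod (Nplus A) n). \<zero>\<^bsub>cmod (Nplus A) (n - 1)\<^esub>)"
  by (simp add: Nplus_def)

lemma Nplus_in_Ch: "Nplus A \<in> Ch k"
proof -
  have "cdiff (Nplus A) n \<in> mod_hom k (cmod (Nplus A) n) (cmod (Nplus A) (n - 1))" for n
  proof (cases "n \<le> 0")
    case True
    then show ?thesis
      using linear_map.restrict_in_mod_hom[OF linear_map_zero[OF module_Nplus module_Nplus]]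
      by (simp add: cdiff_Nplus_le_0)
  next
    case False
    then obtain m where "n = int (Suc m)" by (rule int_posE)
    then show ?thesis using cdiff_Nplus_Suc_in[of m] by simp
  qed
  note lin = mod_hom_linear_map[OF module_Nplus module_Nplus this]
  have "cdiff (Nplus A) (n - 1) (cdiff (Nplus A) n X) = \<zero>\<^bsub>cmod (Nplus A) (n - 2)\<^esub>"
    if X: "X \<in> carrier (cmod (Nplus A) n)" for n X
  proof (cases "n \<le> 1")
    case True
    then show ?thesis
      using linear_map.closed[OF lin X] by (simp add: cdiff_Nplus_le_0)
  next
    case False
    then obtain m where n: "n = int (Suc (Suc m))"
      by (rule int_ge_2E)
    obtain x where x: "x \<in> carrier (smod A (Suc (Suc m)))" "X = nclass A (Suc (Suc m)) x"
      by (rule Nplus_natE[OF X[unfolded n]])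
    have "cdiff (Nplus A) (int (Suc m)) (cdiff (Nplus A) (int (Suc (Suc m))) X) = \<zero>\<^bsub>cmod (Nplus A) (int m)\<^esub>"
      using x by (simp only: cdiff_Nplus_nclass linear_map.closed[OF alt_face_linear] alt_face_alt_face
          linear_map.zero[OF nclass_linear])
    then show ?thesis by (simp add: n)
  qed
  with \<open>\<And>n. cdiff (Nplus A) n \<in> _\<close> show ?thesis
    by (simp add: Ch_def module_Nplus)
qed

lemma Nplus_in_Ch_nonneg: "Nplus A \<in> Ch_nonneg k"
  using Nplus_in_Ch by (simp add: Ch_nonneg_def cmod_Nplus_neg)

text \<open>In negative degrees \<open>{}\<close> is the only element, being the point chosen for
  \<open>zero_module\<close>; in the other degrees every element is a class.\<close>

lemma Nplus_eqI:
  assumes "\<And>n. F n \<in> extensional (carrier (cmod (Nplus A) n))" "\<And>n. G n \<in> extensional (carrier (cmod (Nplus A) n))"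
    and "\<And>n. n < 0 \<Longrightarrow> F n {} = G n {}"
    and "\<And>m x. x \<in> carrier (smod A m) \<Longrightarrow> F (int m) (nclass A m x) = G (int m) (nclass A m x)"
  shows "F = G"
proof
  fix n
  show "F n = G n"
  proof (rule extensionalityI[OF assms(1,2)])
    fix X assume "X \<in> carrier (cmod (Nplus A) n)"
    then show "F n X = G n X" by (cases rule: Nplus_cases) (simp_all add: assms)
  qed
qed

end

section \<open>Functoriality of \<open>Nplus\<close>\<close>

locale aug_smod_hom = A: aug_smod k A + B: aug_smod k B
  for k :: "('r, 'x) ring_scheme" and A :: "('r, 'a) asmod" and B :: "('r, 'b) asmod" +
  fixes f
  assumes hom: "f \<in> Sp_hom k A B"
begin

lemma linear: "linear_map k (smod A m) (smod B m) (f m)"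
  using hom by (intro mod_hom_linear_map A.module_smod B.module_smod) (simp add: Sp_hom_def)

lemmas closed [simp] = linear_map.closed[OF linear]

lemma sact: "\<theta> \<in> Delta_hom p m \<Longrightarrow> x \<in> carrier (smod A m) \<Longrightarrow> f p (sact A p m \<theta> x) = sact B p m \<theta> (f m x)"
  using hom by (simp add: Sp_hom_def)

lemma face: "i \<le> m \<Longrightarrow> x \<in> carrier (smod A (Suc m)) \<Longrightarrow> f m (A.face m i x) = B.face m i (f (Suc m) x)"
  by (simp add: A.face_def B.face_def sact)

lemma degen: "i < m \<Longrightarrow> x \<in> carrier (smod A m) \<Longrightarrow> f (Suc m) (A.degen m i x) = B.degen m i (f m x)"
  by (simp add: A.degen_def B.degen_def sact)

lemma degenerate: "f m ` degenerate A m \<subseteq> degenerate B m"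
proof -
  have "degenerate A m \<subseteq> {x \<in> carrier (smod A m). f m x \<in> degenerate B m}"
    by (rule A.degenerate_least[OF linear_map.submodule_vimage[OF linear B.submodule_degenerate]])
      (auto simp: degen B.degen_in_degenerate)
  then show ?thesis by blast
qed

lemma alt_face:
  assumes "x \<in> carrier (smod A (Suc m))"
  shows "f m (alt_face A (Suc m) x) = alt_face B (Suc m) (f (Suc m) x)"
proof -
  have "f m (alt_face A (Suc m) x) = (\<Oplus>\<^bsub>smod B m\<^esub>i\<in>{..<Suc m}. f m (signed (smod A m) i (A.face m i x)))"
    unfolding A.alt_face_Suc using assms
    by (intro linear_map.finsum[OF linear]) auto
  also have "\<dots> = alt_face B (Suc m) (f (Suc m) x)"
    unfolding B.alt_face_Suc using assms
    by (intro B.sm.M.finsum_cong') (auto simp: linear_map.signed[OF linear] face)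
  finally show ?thesis .
qed

lemma Nplus_map_nclass:
  "x \<in> carrier (smod A m) \<Longrightarrow> Nplus_map A B f (int m) (nclass A m x) = nclass B m (f m x)"
  using quot_map_coset[OF linear A.submodule_degenerate B.submodule_degenerate degenerate]
  by (simp add: Nplus_map_def)

lemma Nplus_map_neg: "n < 0 \<Longrightarrow> Nplus_map A B f n {} = {}"
  by (simp add: Nplus_map_def Nplus_mod_def)

lemma Nplus_map_in_mod_hom: "Nplus_map A B f n \<in> mod_hom k (cmod (Nplus A) n) (cmod (Nplus B) n)"
proof (cases "n < 0")
  case True
  then show ?thesis
    using linear_map.restrict_in_mod_hom[OF linear_map_zero[OF A.module_Nplus B.module_Nplus]]
    by (simp add: Nplus_map_def) (simp add: Nplus_def)
next
  case False
  then obtain m where "n = int m" by (rule int_nonnegE)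
  then show ?thesis
    using quot_map_in_mod_hom[OF linear A.submodule_degenerate B.submodule_degenerate degenerate]
    by (simp add: Nplus_map_def cmod_Nplus_nat)
qed

lemma Nplus_map_extensional: "Nplus_map A B f n \<in> extensional (carrier (cmod (Nplus A) n))"
  by (rule mod_hom_extensional) (rule Nplus_map_in_mod_hom)

lemma Nplus_map_linear: "linear_map k (cmod (Nplus A) n) (cmod (Nplus B) n) (Nplus_map A B f n)"
  by (intro mod_hom_linear_map A.module_Nplus B.module_Nplus Nplus_map_in_mod_hom)

lemma Nplus_map_in_Ch_hom: "Nplus_map A B f \<in> Ch_hom k (Nplus A) (Nplus B)"
proof -
  have "Nplus_map A B f (n - 1) (cdiff (Nplus A) n X) = cdiff (Nplus B) n (Nplus_map A B f n X)"
    if X: "X \<in> carrier (cmod (Nplus A) n)" for n X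
  proof (cases "n \<le> 0")
    case True
    then show ?thesis
      using X linear_map.closed[OF Nplus_map_linear X] linear_map.zero[OF Nplus_map_linear]
      by (simp add: A.cdiff_Nplus_le_0 B.cdiff_Nplus_le_0)
  next
    case False
    then obtain m where n: "n = int (Suc m)" by (rule int_posE)
    obtain x where x: "x \<in> carrier (smod A (Suc m))" "X = nclass A (Suc m) x"
      by (rule A.Nplus_natE[OF X[unfolded n]])
    have "Nplus_map A B f (int m) (cdiff (Nplus A) (int (Suc m)) X)
        = cdiff (Nplus B) (int (Suc m)) (Nplus_map A B f (int (Suc m)) X)"
      using x by (simp only: A.cdiff_Nplus_nclass B.cdiff_Nplus_nclass Nplus_map_nclass alt_face
          linear_map.closed[OF A.alt_face_linear] closed)
    then show ?thesis by (simp add: n)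
  qed
  then show ?thesis by (simp add: Ch_hom_def Nplus_map_in_mod_hom)
qed

end

context aug_smod
begin

lemma Sp_id_apply: "x \<in> carrier (smod A m) \<Longrightarrow> Sp_id A m x = x"
  by (simp add: Sp_id_def)

lemma Sp_id_in: "Sp_id A \<in> Sp_hom k A A"
proof -
  have "linear_map k (smod A m) (smod A m) (\<lambda>x. x)" for m by unfold_locales simp_all
  from linear_map.restrict_in_mod_hom[OF this] show ?thesis
    by (simp add: Sp_hom_def Sp_id_def)
qed

lemma Nplus_map_id: "Nplus_map A A (Sp_id A) = Ch_id (Nplus A)"
proof -
  interpret i: aug_smod_hom k A A "Sp_id A" by unfold_locales (rule Sp_id_in)
  show ?thesis
    by (rule Nplus_eqI)
     (simp_all add: i.Nplus_map_extensional i.Nplus_map_neg i.Nplus_map_nclass Ch_id_def Sp_id_apply cmod_Nplus_neg)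
qed

end

lemma Sp_comp_apply: "x \<in> carrier (smod A m) \<Longrightarrow> Sp_comp A g f m x = g m (f m x)"
  by (simp add: Sp_comp_def compose_eq)

lemma Sp_comp_in:
  assumes "aug_smod_hom k A B f" "aug_smod_hom k B E g"
  shows "aug_smod_hom k A E (Sp_comp A g f)"
proof -
  interpret f: aug_smod_hom k A B f by fact
  interpret g: aug_smod_hom k B E g by fact
  have "compose (carrier (smod A m)) (g m) (f m) \<in> mod_hom k (smod A m) (smod E m)" for m
    using linear_map.restrict_in_mod_hom[OF linear_map_comp[OF f.linear g.linear]]
    by (simp add: compose_def)
  then show ?thesis
    by unfold_locales (simp add: Sp_hom_def Sp_comp_def compose_eq f.sact g.sact)
qed

lemma Nplus_map_comp:
  assumes "aug_smod_hom k A B f" "aug_smod_hom k B E g"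
  shows "Nplus_map A E (Sp_comp A g f) = Ch_comp (Nplus A) (Nplus_map B E g) (Nplus_map A B f)"
proof -
  interpret f: aug_smod_hom k A B f by fact
  interpret g: aug_smod_hom k B E g by fact
  interpret gf: aug_smod_hom k A E "Sp_comp A g f" using assms by (rule Sp_comp_in)
  show ?thesis
    by (rule f.A.Nplus_eqI)
      (simp_all add: gf.Nplus_map_extensional gf.Nplus_map_neg gf.Nplus_map_nclass Ch_comp_def
        compose_eq f.Nplus_map_neg f.Nplus_map_nclass g.Nplus_map_neg g.Nplus_map_nclass
        Sp_comp_apply cmod_Nplus_neg)
qed

section \<open>Chain complexes\<close>

locale chain_complex = cring k for k :: "('r, 'x) ring_scheme" (structure) +
  fixes C :: "('r, 'c) complx"
  assumes in_Ch: "C \<in> Ch k"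
begin

lemma module_cmod: "module k (cmod C n)"
  using in_Ch by (simp add: Ch_def)

sublocale cm: module k "cmod C n" for n
  by (rule module_cmod)

lemma cdiff_linear: "linear_map k (cmod C n) (cmod C (n - 1)) (cdiff C n)"
  using in_Ch by (intro mod_hom_linear_map module_cmod) (simp add: Ch_def)

lemmas cdiff_closed [simp] = linear_map.closed[OF cdiff_linear]

lemma cdiff_cdiff: "x \<in> carrier (cmod C n) \<Longrightarrow> cdiff C (n - 1) (cdiff C n x) = \<zero>\<^bsub>cmod C (n - 2)\<^esub>"
  using in_Ch by (simp add: Ch_def)

end

sublocale aug_smod \<subseteq> NA: chain_complex k "Nplus A"
  by unfold_locales (rule Nplus_in_Ch)

locale chain_map = C: chain_complex k C + D: chain_complex k D
  for k :: "('r, 'x) ring_scheme" and C :: "('r, 'c) complx" and D :: "('r, 'd) complx" +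
  fixes f
  assumes hom: "f \<in> Ch_hom k C D"
begin

lemma linear: "linear_map k (cmod C n) (cmod D n) (f n)"
  using hom by (intro mod_hom_linear_map C.module_cmod D.module_cmod) (simp add: Ch_hom_def)

lemmas closed [simp] = linear_map.closed[OF linear]

lemma cdiff: "x \<in> carrier (cmod C n) \<Longrightarrow> f (n - 1) (cdiff C n x) = cdiff D n (f n x)"
  using hom by (simp add: Ch_hom_def)

lemma extensional: "f n \<in> extensional (carrier (cmod C n))"
  using hom by (auto simp: Ch_hom_def dest: mod_hom_extensional)

end

lemma Ch_hom_eqI:
  assumes "f \<in> Ch_hom k C D" "g \<in> Ch_hom k C D" "\<And>n x. x \<in> carrier (cmod C n) \<Longrightarrow> f n x = g n x"
  shows "f = g"
proof
  fix n
  have "f n \<in> mod_hom k (cmod C n) (cmod D n)" "g n \<in> mod_hom k (cmod C n) (cmod D n)"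
    using assms by (simp_all add: Ch_hom_def)
  then show "f n = g n"
    using assms(3) by (blast intro: extensionalityI mod_hom_extensional)
qed

lemma Ch_hom_restrictI:
  assumes "chain_complex k C" "\<And>n. linear_map k (cmod C n) (cmod D n) (F n)"
    and "\<And>n x. x \<in> carrier (cmod C n) \<Longrightarrow> F (n - 1) (cdiff C n x) = cdiff D n (F n x)"
  shows "(\<lambda>n. \<lambda>x\<in>carrier (cmod C n). F n x) \<in> Ch_hom k C D"
  using linear_map.restrict_in_mod_hom[OF assms(2)] chain_complex.cdiff_closed[OF assms(1)] assms(3)
  by (simp add: Ch_hom_def)

lemma Ch_id_in:
  assumes "chain_complex k C" shows "Ch_id C \<in> Ch_hom k C C"
proof -
  interpret chain_complex k C by fact
  have "linear_map k (cmod C n) (cmod C n) (\<lambda>x. x)" for n by unfold_locales simp_all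
  then show ?thesis unfolding Ch_id_def by (rule Ch_hom_restrictI[OF assms]) simp
qed

lemma Ch_comp_in:
  assumes "chain_map k C D f" "chain_map k D E g"
  shows "Ch_comp C g f \<in> Ch_hom k C E"
proof -
  interpret f: chain_map k C D f by fact
  interpret g: chain_map k D E g by fact
  show ?thesis
    unfolding Ch_comp_def compose_def
    by (rule Ch_hom_restrictI[OF f.C.chain_complex_axioms])
      (simp_all add: linear_map_comp[OF f.linear g.linear] f.cdiff g.cdiff)
qed

lemma Ch_comp_apply: "x \<in> carrier (cmod C n) \<Longrightarrow> Ch_comp C g f n x = g n (f n x)"
  by (simp add: Ch_comp_def compose_eq)

section \<open>The module of chain maps between two complexes\<close>

locale chain_pair = C: chain_complex k C + D: chain_complex k D
  for k :: "('r, 'x) ring_scheme" and C :: "('r, 'c) complx" and D :: "('r, 'd) complx"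
begin

lemma chain_mapI: "f \<in> Ch_hom k C D \<Longrightarrow> chain_map k C D f"
  by unfold_locales

lemma zero_in: "\<zero>\<^bsub>Ch_module k C D\<^esub> \<in> Ch_hom k C D"
  unfolding Ch_module_def
  by (simp, rule Ch_hom_restrictI[OF C.chain_complex_axioms])
    (simp_all add: linear_map_zero C.module_cmod D.module_cmod linear_map.zero[OF D.cdiff_linear])

lemma add_in:
  assumes "f \<in> Ch_hom k C D" "g \<in> Ch_hom k C D"
  shows "f \<oplus>\<^bsub>Ch_module k C D\<^esub> g \<in> Ch_hom k C D"
proof -
  interpret f: chain_map k C D f using assms(1) by (rule chain_mapI)
  interpret g: chain_map k C D g using assms(2) by (rule chain_mapI)
  show ?thesis
    unfolding Ch_module_def
    by (simp, rule Ch_hom_restrictI[OF C.chain_complex_axioms])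
      (simp_all add: linear_map_add f.linear g.linear f.cdiff g.cdiff linear_map.add[OF D.cdiff_linear])
qed

lemma smult_in:
  assumes "r \<in> carrier k" "f \<in> Ch_hom k C D"
  shows "r \<odot>\<^bsub>Ch_module k C D\<^esub> f \<in> Ch_hom k C D"
proof -
  interpret f: chain_map k C D f using assms(2) by (rule chain_mapI)
  have "linear_map k (cmod C n) (cmod D n) (\<lambda>x. r \<odot>\<^bsub>cmod D n\<^esub> f n x)" for n
  proof -
    interpret fn: linear_map k "cmod C n" "cmod D n" "f n" by (rule f.linear)
    show ?thesis
      using assms(1) by unfold_locales
       (simp_all add: fn.add fn.smult D.cm.smult_r_distr D.cm.smult_assoc1[symmetric] C.m_comm)
  qed
  then show ?thesis
    unfolding Ch_module_def
    by (simp, intro Ch_hom_restrictI[OF C.chain_complex_axioms])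
      (simp_all add: f.cdiff linear_map.smult[OF D.cdiff_linear] assms)
qed

lemma module_Ch_module: "module k (Ch_module k C D)"
proof -
  let ?H = "Ch_module k C D"
  have car: "carrier ?H = Ch_hom k C D" by (simp add: Ch_module_def)
  have ev: "\<zero>\<^bsub>?H\<^esub> n x = \<zero>\<^bsub>cmod D n\<^esub>" "(f \<oplus>\<^bsub>?H\<^esub> g) n x = f n x \<oplus>\<^bsub>cmod D n\<^esub> g n x"
    "(r \<odot>\<^bsub>?H\<^esub> f) n x = r \<odot>\<^bsub>cmod D n\<^esub> f n x"
    if "x \<in> carrier (cmod C n)" for f g n x r
    using that by (simp_all add: Ch_module_def)
  have cl: "f n x \<in> carrier (cmod D n)" if "f \<in> Ch_hom k C D" "x \<in> carrier (cmod C n)" for f n x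
    using chain_map.closed[OF chain_mapI] that .
  note [simp] = car ev cl zero_in add_in smult_in
  have "abelian_group ?H"
  proof (rule abelian_groupI)
    fix f assume f: "f \<in> carrier ?H"
    \<comment> \<open>Taking the negative as the multiple by -1 makes its being a chain map a case
      of \<open>smult_in\<close>.\<close>
    let ?g = "(\<ominus>\<^bsub>k\<^esub> \<one>\<^bsub>k\<^esub>) \<odot>\<^bsub>?H\<^esub> f"
    have "?g \<oplus>\<^bsub>?H\<^esub> f = \<zero>\<^bsub>?H\<^esub>"
      using f by (intro Ch_hom_eqI[of _ k C D]) (simp_all add: D.cm.smult_l_minus D.cm.M.l_neg)
    with f show "\<exists>g\<in>carrier ?H. g \<oplus>\<^bsub>?H\<^esub> f = \<zero>\<^bsub>?H\<^esub>"
      by (intro bexI[of _ ?g]) simp_all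
  qed (auto intro!: Ch_hom_eqI[of _ k C D] simp: D.cm.M.a_ac)
  then show ?thesis
    by (intro moduleI C.is_cring)
      (auto intro!: Ch_hom_eqI[of _ k C D] simp: D.cm.smult_l_distr D.cm.smult_r_distr D.cm.smult_assoc1)
qed

sublocale hm: module k "Ch_module k C D"
  by (rule module_Ch_module)

lemma eval_linear:
  "x \<in> carrier (cmod C n) \<Longrightarrow> linear_map k (Ch_module k C D) (cmod D n) (\<lambda>f. f n x)"
  by unfold_locales
    (auto simp: Ch_module_def intro: chain_map.closed[OF chain_mapI])

end

section \<open>Free modules on finite sets\<close>

text \<open>The sets \<open>Delta_hom p m\<close> are finite. So the support condition in
  \<open>free_module\<close> is automatic, and sums may run over all of S.\<close>

locale fin_free = cring k for k :: "('r, 'x) ring_scheme" (structure) +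
  fixes S :: "'s set"
  assumes fin [simp]: "finite S"
begin

lemma free_carrier: "carrier (free_module k S) = (S \<rightarrow>\<^sub>E carrier k)"
  by (auto simp: free_module_def)

lemma free_closed [simp]: "c \<in> carrier (free_module k S) \<Longrightarrow> s \<in> S \<Longrightarrow> c s \<in> carrier k"
  by (auto simp: free_carrier)

lemma free_eqI:
  "c \<in> carrier (free_module k S) \<Longrightarrow> d \<in> carrier (free_module k S) \<Longrightarrow> (\<And>s. s \<in> S \<Longrightarrow> c s = d s) \<Longrightarrow> c = d"
  unfolding free_carrier by (rule PiE_ext)

lemma free_zero [simp]: "s \<in> S \<Longrightarrow> \<zero>\<^bsub>free_module k S\<^esub> s = \<zero>"
  and free_add [simp]: "s \<in> S \<Longrightarrow> (c \<oplus>\<^bsub>free_module k S\<^esub> d) s = c s \<oplus> d s"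
  and free_smult [simp]: "s \<in> S \<Longrightarrow> (r \<odot>\<^bsub>free_module k S\<^esub> c) s = r \<otimes> c s"
  by (simp_all add: free_module_def)

lemma free_ops_closed [simp]:
  "\<zero>\<^bsub>free_module k S\<^esub> \<in> carrier (free_module k S)"
  "c \<in> carrier (free_module k S) \<Longrightarrow> d \<in> carrier (free_module k S) \<Longrightarrow>
    c \<oplus>\<^bsub>free_module k S\<^esub> d \<in> carrier (free_module k S)"
  "r \<in> carrier k \<Longrightarrow> c \<in> carrier (free_module k S) \<Longrightarrow> r \<odot>\<^bsub>free_module k S\<^esub> c \<in> carrier (free_module k S)"
  unfolding free_carrier by (auto simp: free_module_def)

lemma module_free: "module k (free_module k S)"
proof -
  have "abelian_group (free_module k S)"
  proof (rule abelian_groupI)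
    fix c assume c: "c \<in> carrier (free_module k S)"
    let ?d = "(\<ominus> \<one>) \<odot>\<^bsub>free_module k S\<^esub> c"
    have "?d \<oplus>\<^bsub>free_module k S\<^esub> c = \<zero>\<^bsub>free_module k S\<^esub>"
      using c by (intro free_eqI) (simp_all add: l_minus l_neg)
    with c show "\<exists>d\<in>carrier (free_module k S). d \<oplus>\<^bsub>free_module k S\<^esub> c = \<zero>\<^bsub>free_module k S\<^esub>"
      by (intro bexI[of _ ?d]) simp_all
  qed (auto intro!: free_eqI simp: a_ac)
  then show ?thesis
    by (intro moduleI is_cring) (auto intro!: free_eqI simp: l_distr r_distr m_assoc)
qed

sublocale fm: module k "free_module k S"
  by (rule module_free)

lemma free_finsum:
  assumes "\<And>i. i \<in> I \<Longrightarrow> g i \<in> carrier (free_module k S)" "s \<in> S"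
  shows "(\<Oplus>\<^bsub>free_module k S\<^esub>i\<in>I. g i) s = (\<Oplus>i\<in>I. g i s)"
  using assms(1)
proof (induction I rule: infinite_finite_induct)
  case (insert i I)
  then show ?case by (simp add: Pi_def assms(2))
qed (simp_all add: assms(2))

lemma free_gen_closed [simp]: "free_gen k S s \<in> carrier (free_module k S)"
  unfolding free_carrier by (auto simp: free_gen_def)

lemma free_expand:
  assumes "c \<in> carrier (free_module k S)"
  shows "c = (\<Oplus>\<^bsub>free_module k S\<^esub>s\<in>S. c s \<odot>\<^bsub>free_module k S\<^esub> free_gen k S s)"
proof (rule free_eqI[OF assms])
  show "(\<Oplus>\<^bsub>free_module k S\<^esub>s\<in>S. c s \<odot>\<^bsub>free_module k S\<^esub> free_gen k S s) \<in> carrier (free_module k S)"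
    using assms by (intro fm.M.finsum_closed) auto
  fix t assume t: "t \<in> S"
  have "(c s \<odot>\<^bsub>free_module k S\<^esub> free_gen k S s) t = (if t = s then c s else \<zero>)" if "s \<in> S" for s
    using that t assms by (simp add: free_gen_def)
  then have "(\<Oplus>\<^bsub>free_module k S\<^esub>s\<in>S. c s \<odot>\<^bsub>free_module k S\<^esub> free_gen k S s) t
      = (\<Oplus>s\<in>S. if t = s then c s else \<zero>)"
    using t assms by (subst free_finsum) (auto intro!: finsum_cong')
  also have "\<dots> = c t"
    using t assms by (intro finsum_singleton) auto
  finally show "c t = (\<Oplus>\<^bsub>free_module k S\<^esub>s\<in>S. c s \<odot>\<^bsub>free_module k S\<^esub> free_gen k S s) t" ..
qed

lemma linear_eq_on_gens:
  assumes f: "linear_map k (free_module k S) N f" and g: "linear_map k (free_module k S) N g"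
    and eq: "\<And>s. s \<in> S \<Longrightarrow> f (free_gen k S s) = g (free_gen k S s)"
    and c: "c \<in> carrier (free_module k S)"
  shows "f c = g c"
proof -
  interpret f: linear_map k "free_module k S" N f by fact
  interpret g: linear_map k "free_module k S" N g by fact
  have "f (\<Oplus>\<^bsub>free_module k S\<^esub>s\<in>S. c s \<odot>\<^bsub>free_module k S\<^esub> free_gen k S s)
      = (\<Oplus>\<^bsub>N\<^esub>s\<in>S. f (c s \<odot>\<^bsub>free_module k S\<^esub> free_gen k S s))"
    using c by (intro f.finsum) simp
  also have "\<dots> = (\<Oplus>\<^bsub>N\<^esub>s\<in>S. g (c s \<odot>\<^bsub>free_module k S\<^esub> free_gen k S s))"
    using c by (intro f.target.M.finsum_cong') (auto simp: f.smult g.smult eq)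
  also have "\<dots> = g (\<Oplus>\<^bsub>free_module k S\<^esub>s\<in>S. c s \<odot>\<^bsub>free_module k S\<^esub> free_gen k S s)"
    using c by (intro g.finsum[symmetric]) simp
  finally show ?thesis using free_expand[OF c] by simp
qed

text \<open>The linear extension of \<open>u\<close>. A sum over all of S is linear in
  \<open>c\<close> term by term, which a sum over the support of \<open>c\<close> is not;
  \<open>free_lift_support\<close> connects the two.\<close>

definition free_lift :: "('r, 'b) module \<Rightarrow> ('s \<Rightarrow> 'b) \<Rightarrow> ('s \<Rightarrow> 'r) \<Rightarrow> 'b" where
  "free_lift N u c = (\<Oplus>\<^bsub>N\<^esub>s\<in>S. c s \<odot>\<^bsub>N\<^esub> u s)"

lemma free_lift_linear:
  assumes "module k N" "\<And>s. s \<in> S \<Longrightarrow> u s \<in> carrier N"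
  shows "linear_map k (free_module k S) N (free_lift N u)"
proof -
  interpret N: module k N by fact
  have "linear_map k (free_module k S) N (\<lambda>c. c s \<odot>\<^bsub>N\<^esub> u s)" if "s \<in> S" for s
    using that assms by unfold_locales (simp_all add: N.smult_l_distr N.smult_assoc1)
  then show ?thesis
    unfolding free_lift_def[abs_def] by (intro linear_map_finsum module_free assms)
qed

lemma free_lift_gen:
  assumes "module k N" "\<And>s. s \<in> S \<Longrightarrow> u s \<in> carrier N" "t \<in> S"
  shows "free_lift N u (free_gen k S t) = u t"
proof -
  interpret N: module k N by fact
  have "free_lift N u (free_gen k S t) = (\<Oplus>\<^bsub>N\<^esub>s\<in>S. if t = s then u s else \<zero>\<^bsub>N\<^esub>)"
    unfolding free_lift_def using assms by (intro N.M.finsum_cong') (auto simp: free_gen_def)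
  also have "\<dots> = u t"
    using assms by (intro N.M.finsum_singleton) auto
  finally show ?thesis .
qed

lemma free_lift_support:
  assumes "module k N" "\<And>s. s \<in> S \<Longrightarrow> u s \<in> carrier N" "c \<in> carrier (free_module k S)"
  shows "(\<Oplus>\<^bsub>N\<^esub>s\<in>{s \<in> S. c s \<noteq> \<zero>}. c s \<odot>\<^bsub>N\<^esub> u s) = free_lift N u c"
proof -
  interpret N: module k N by fact
  show ?thesis
    unfolding free_lift_def using assms by (intro N.M.add.finprod_mono_neutral_cong_left) auto
qed

end

context cring
begin

lemma
  assumes S: "finite S" and T: "finite T" and f: "\<And>s. s \<in> S \<Longrightarrow> f s \<in> T"
  shows free_map_linear: "linear_map R (free_module R S) (free_module R T) (free_map R S T f)"
    and free_map_gen: "s \<in> S \<Longrightarrow> free_map R S T f (free_gen R S s) = free_gen R T (f s)"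
proof -
  interpret S: fin_free R S by unfold_locales fact
  interpret T: fin_free R T by unfold_locales fact
  \<comment> \<open>The index set of \<open>free_map\<close> depends on the support of
    \<open>c\<close>. Over the whole fibre the sum has a fixed index set, and additivity can be read
    off.\<close>
  have val: "free_map R S T f c t = (\<Oplus>s\<in>{s \<in> S. f s = t}. c s)"
    if "c \<in> carrier (free_module R S)" "t \<in> T" for c t
  proof -
    have "(\<Oplus>s\<in>{s \<in> S. c s \<noteq> \<zero> \<and> f s = t}. c s) = (\<Oplus>s\<in>{s \<in> S. f s = t}. c s)"
      using that S by (intro add.finprod_mono_neutral_cong_left) auto
    with that show ?thesis by (simp add: free_map_def)
  qed
  have cl: "free_map R S T f c \<in> carrier (free_module R T)" if "c \<in> carrier (free_module R S)" for c
    unfolding T.free_carrier using that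
    by (auto simp: val intro!: finsum_closed PiE_I) (simp add: free_map_def)
  show "linear_map R (free_module R S) (free_module R T) (free_map R S T f)"
  proof unfold_locales
    fix c d assume cd: "c \<in> carrier (free_module R S)" "d \<in> carrier (free_module R S)"
    show "free_map R S T f (c \<oplus>\<^bsub>free_module R S\<^esub> d)
        = free_map R S T f c \<oplus>\<^bsub>free_module R T\<^esub> free_map R S T f d"
    proof (rule T.free_eqI)
      fix t assume t: "t \<in> T"
      have "free_map R S T f (c \<oplus>\<^bsub>free_module R S\<^esub> d) t = (\<Oplus>s\<in>{s \<in> S. f s = t}. c s \<oplus> d s)"
        using cd t by (simp only: val S.free_ops_closed) (rule finsum_cong', auto)
      also have "\<dots> = (\<Oplus>s\<in>{s \<in> S. f s = t}. c s) \<oplus> (\<Oplus>s\<in>{s \<in> S. f s = t}. d s)"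
        using cd by (intro finsum_addf) auto
      finally show "free_map R S T f (c \<oplus>\<^bsub>free_module R S\<^esub> d) t
          = (free_map R S T f c \<oplus>\<^bsub>free_module R T\<^esub> free_map R S T f d) t"
        using cd t by (simp only: T.free_add val[of c] val[of d])
    qed (use cd in \<open>simp_all add: cl\<close>)
  next
    fix r c assume rc: "r \<in> carrier R" "c \<in> carrier (free_module R S)"
    show "free_map R S T f (r \<odot>\<^bsub>free_module R S\<^esub> c) = r \<odot>\<^bsub>free_module R T\<^esub> free_map R S T f c"
    proof (rule T.free_eqI)
      fix t assume t: "t \<in> T"
      have "free_map R S T f (r \<odot>\<^bsub>free_module R S\<^esub> c) t = (\<Oplus>s\<in>{s \<in> S. f s = t}. r \<otimes> c s)"
        using rc t by (simp only: val S.free_ops_closed) (auto intro!: finsum_cong')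
      also have "\<dots> = r \<otimes> (\<Oplus>s\<in>{s \<in> S. f s = t}. c s)"
        using rc S by (intro finsum_rdistr[symmetric]) auto
      finally show "free_map R S T f (r \<odot>\<^bsub>free_module R S\<^esub> c) t
          = (r \<odot>\<^bsub>free_module R T\<^esub> free_map R S T f c) t"
        using rc t by (simp only: T.free_smult val[of c])
    qed (use rc in \<open>simp_all add: cl\<close>)
  qed (rule cl)
  assume s: "s \<in> S"
  show "free_map R S T f (free_gen R S s) = free_gen R T (f s)"
  proof (rule T.free_eqI)
    fix t assume t: "t \<in> T"
    have "free_map R S T f (free_gen R S s) t = (\<Oplus>s'\<in>{s \<in> S. f s = t}. if s = s' then \<one> else \<zero>)"
      using t by (simp only: val S.free_gen_closed) (auto intro!: finsum_cong' simp: free_gen_def)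
    also have "\<dots> = (if f s = t then \<one> else \<zero>)"
    proof (cases "f s = t")
      case True
      with s S show ?thesis using finsum_singleton[of s "{s \<in> S. f s = t}" "\<lambda>_. \<one>"] by simp
    next
      case False
      then show ?thesis by (intro trans[OF add.finprod_one_eqI]) auto
    qed
    finally show "free_map R S T f (free_gen R S s) t = free_gen R T (f s) t"
      using t by (auto simp: free_gen_def)
  qed (simp_all add: cl)
qed

end

section \<open>Representables\<close>

text \<open>These classes span N^+ of the simplex in degree n. Those of non-injective \<phi> vanish,
  so the injective maps carry all the information.\<close>

definition gen_class :: "('r, 'x) ring_scheme \<Rightarrow> nat \<Rightarrow> nat \<Rightarrow> (nat \<Rightarrow> nat) \<Rightarrow> ((nat \<Rightarrow> nat) \<Rightarrow> 'r) set" where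
  "gen_class k m n \<phi> = nclass (k_simplex k m) n (free_gen k (Delta_hom n m) \<phi>)"

lemma smod_simplex: "smod (k_simplex k m) p = free_module k (Delta_hom p m)"
  by (simp add: free_asmod_def simplex_def)

lemma sact_simplex: "sact (k_simplex k m) q p \<psi>
    = free_map k (Delta_hom p m) (Delta_hom q m) (\<lambda>\<phi>\<in>Delta_hom p m. compose {..<q} \<phi> \<psi>)"
  by (simp add: free_asmod_def simplex_def)

lemma free_map_extensional: "free_map k S T f \<in> extensional (carrier (free_module k S))"
  by (simp add: free_map_def)

lemma top_class_eq: "top_class k m = gen_class k m m (Delta_id m)"
  by (simp add: top_class_def gen_class_def)

context cring
begin

lemma fin_free_Delta: "fin_free R (Delta_hom p m)"
  by unfold_locales simp

lemma module_smod_simplex: "module R (smod (k_simplex R m) p)"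
  unfolding smod_simplex by (rule fin_free.module_free[OF fin_free_Delta])

lemma simplex_eqI:
  assumes "linear_map R (smod (k_simplex R m) p) N f" "linear_map R (smod (k_simplex R m) p) N g"
    and "\<And>\<phi>. \<phi> \<in> Delta_hom p m \<Longrightarrow> f (free_gen R (Delta_hom p m) \<phi>) = g (free_gen R (Delta_hom p m) \<phi>)"
    and "c \<in> carrier (smod (k_simplex R m) p)"
  shows "f c = g c"
  using assms unfolding smod_simplex by (rule fin_free.linear_eq_on_gens[OF fin_free_Delta])

lemma
  assumes "\<psi> \<in> Delta_hom q p"
  shows sact_simplex_linear:
      "linear_map R (smod (k_simplex R m) p) (smod (k_simplex R m) q) (sact (k_simplex R m) q p \<psi>)"
    and sact_simplex_gen: "\<phi> \<in> Delta_hom p m \<Longrightarrow>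
      sact (k_simplex R m) q p \<psi> (free_gen R (Delta_hom p m) \<phi>)
        = free_gen R (Delta_hom q m) (compose {..<q} \<phi> \<psi>)"
  unfolding smod_simplex sact_simplex
  using free_map_linear[of "Delta_hom p m" "Delta_hom q m" "\<lambda>\<phi>\<in>Delta_hom p m. compose {..<q} \<phi> \<psi>"]
    free_map_gen[of "Delta_hom p m" "Delta_hom q m" "\<lambda>\<phi>\<in>Delta_hom p m. compose {..<q} \<phi> \<psi>" \<phi>] assms
  by simp_all

lemma gen_closed: "free_gen R (Delta_hom p m) \<phi> \<in> carrier (smod (k_simplex R m) p)"
  unfolding smod_simplex by (rule fin_free.free_gen_closed[OF fin_free_Delta])

lemma aug_smod_simplex: "aug_smod R (k_simplex R m)"
proof unfold_locales
  let ?A = "k_simplex R m"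
  have ext: "sact ?A q p \<psi> \<in> extensional (carrier (smod ?A p))" for q p \<psi>
    unfolding sact_simplex smod_simplex by (rule free_map_extensional)
  have lin: "linear_map R (smod ?A p) (smod ?A p) (\<lambda>x. x)" for p
    using module_smod_simplex by (simp add: linear_map_def linear_map_axioms_def)
  have "sact ?A p p (Delta_id p) x = x" if "x \<in> carrier (smod ?A p)" for p x
    by (rule simplex_eqI[OF sact_simplex_linear lin _ that])
      (simp_all add: sact_simplex_gen compose_Delta_id)
  then have id: "sact ?A p p (Delta_id p) = (\<lambda>x\<in>carrier (smod ?A p). x)" for p
    by (intro extensionalityI[OF ext]) simp_all
  have "sact ?A r p (compose {..<r} \<theta> \<psi>) x = sact ?A r q \<psi> (sact ?A q p \<theta> x)"
    if "\<psi> \<in> Delta_hom r q" "\<theta> \<in> Delta_hom q p" "x \<in> carrier (smod ?A p)" for r q p \<psi> \<theta> x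
    using that
    by (intro simplex_eqI[OF sact_simplex_linear linear_map_comp[OF sact_simplex_linear sact_simplex_linear] _ that(3)])
      (simp_all add: sact_simplex_gen compose_Delta_assoc)
  then have comp: "sact ?A r p (compose {..<r} \<theta> \<psi>) = compose (carrier (smod ?A p)) (sact ?A r q \<psi>) (sact ?A q p \<theta>)"
    if "\<psi> \<in> Delta_hom r q" "\<theta> \<in> Delta_hom q p" for r q p \<psi> \<theta>
    using that by (intro extensionalityI[OF ext]) (simp_all add: compose_eq)
  show "?A \<in> SpMod R"
    unfolding SpMod_def
    using module_smod_simplex sact_simplex_linear linear_map.in_mod_hom_iff[OF sact_simplex_linear] ext id comp
    by simp
qed

lemma simplex_homI:
  assumes "aug_smod R B" "\<And>p. linear_map R (smod (k_simplex R m) p) (smod B p) (F p)"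
    and "\<And>p. F p \<in> extensional (carrier (smod (k_simplex R m) p))"
    and "\<And>q p \<psi> \<phi>. \<psi> \<in> Delta_hom q p \<Longrightarrow> \<phi> \<in> Delta_hom p m \<Longrightarrow>
      F q (free_gen R (Delta_hom q m) (compose {..<q} \<phi> \<psi>))
        = sact B q p \<psi> (F p (free_gen R (Delta_hom p m) \<phi>))"
  shows "aug_smod_hom R (k_simplex R m) B F"
proof -
  interpret A: aug_smod R "k_simplex R m" by (rule aug_smod_simplex)
  interpret B: aug_smod R B by fact
  have "F q (sact (k_simplex R m) q p \<psi> x) = sact B q p \<psi> (F p x)"
    if "\<psi> \<in> Delta_hom q p" "x \<in> carrier (smod (k_simplex R m) p)" for q p \<psi> x
    using that
    by (intro simplex_eqI[OF linear_map_comp[OF sact_simplex_linear assms(2)]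
          linear_map_comp[OF assms(2) B.sact_linear] _ that(2)])
      (simp_all add: sact_simplex_gen assms(4))
  then show ?thesis
    using linear_map.in_mod_hom_iff[OF assms(2)] assms(3)
    by unfold_locales (simp add: Sp_hom_def)
qed

lemma k_simplex_map_gen:
  assumes "\<theta> \<in> Delta_hom p m" "\<phi> \<in> Delta_hom q p"
  shows "k_simplex_map R p m \<theta> q (free_gen R (Delta_hom q p) \<phi>)
    = free_gen R (Delta_hom q m) (compose {..<q} \<theta> \<phi>)"
  unfolding k_simplex_map_def using assms by (intro free_map_gen) simp_all

lemma k_simplex_map_hom:
  assumes "\<theta> \<in> Delta_hom p m"
  shows "aug_smod_hom R (k_simplex R p) (k_simplex R m) (k_simplex_map R p m \<theta>)"
proof (rule simplex_homI[OF aug_smod_simplex])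
  show "linear_map R (smod (k_simplex R p) q) (smod (k_simplex R m) q) (k_simplex_map R p m \<theta> q)" for q
    unfolding k_simplex_map_def smod_simplex using assms by (intro free_map_linear) simp_all
  show "k_simplex_map R p m \<theta> q \<in> extensional (carrier (smod (k_simplex R p) q))" for q
    unfolding k_simplex_map_def smod_simplex by (rule free_map_extensional)
qed (simp_all add: k_simplex_map_gen sact_simplex_gen assms compose_Delta_assoc)

lemma gen_class_closed [simp]: "gen_class R m n \<phi> \<in> carrier (cmod (Nplus (k_simplex R m)) (int n))"
proof -
  interpret A: aug_smod R "k_simplex R m" by (rule aug_smod_simplex)
  show ?thesis unfolding gen_class_def by (rule A.nclass_closed[OF gen_closed])
qed

lemma Nplus_simplex_eqI:
  assumes "linear_map R (cmod (Nplus (k_simplex R m)) (int n)) N f"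
    "linear_map R (cmod (Nplus (k_simplex R m)) (int n)) N g"
    and "\<And>\<phi>. \<phi> \<in> Delta_hom n m \<Longrightarrow> f (gen_class R m n \<phi>) = g (gen_class R m n \<phi>)"
    and "X \<in> carrier (cmod (Nplus (k_simplex R m)) (int n))"
  shows "f X = g X"
proof -
  interpret A: aug_smod R "k_simplex R m" by (rule aug_smod_simplex)
  obtain x where x: "x \<in> carrier (smod (k_simplex R m) n)" "X = nclass (k_simplex R m) n x"
    using assms(4) by (rule A.Nplus_natE)
  show ?thesis
    unfolding x(2)
    using assms(3) by (intro simplex_eqI[OF linear_map_comp[OF A.nclass_linear assms(1)]
          linear_map_comp[OF A.nclass_linear assms(2)] _ x(1)]) (simp add: gen_class_def)
qed

lemma chain_complex_simplex: "chain_complex R (Nplus (k_simplex R m))"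
proof -
  interpret A: aug_smod R "k_simplex R m" by (rule aug_smod_simplex)
  show ?thesis by (rule A.NA.chain_complex_axioms)
qed

lemma Ch_hom_simplex_eqI:
  assumes C: "chain_complex R C"
    and "f \<in> Ch_hom R (Nplus (k_simplex R m)) C" "g \<in> Ch_hom R (Nplus (k_simplex R m)) C"
    and "\<And>n \<phi>. \<phi> \<in> Delta_hom n m \<Longrightarrow> f (int n) (gen_class R m n \<phi>) = g (int n) (gen_class R m n \<phi>)"
  shows "f = g"
proof -
  interpret A: aug_smod R "k_simplex R m" by (rule aug_smod_simplex)
  interpret C: chain_complex R C by fact
  interpret f: chain_map R "Nplus (k_simplex R m)" C f by unfold_locales fact
  interpret g: chain_map R "Nplus (k_simplex R m)" C g by unfold_locales fact
  show ?thesis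
  proof (rule A.Nplus_eqI)
    \<comment> \<open>In negative degrees \<open>{}\<close> is the zero element of the source, hence
      both linear maps send it to zero.\<close>
    show "f n {} = g n {}" if "n < 0" for n
      using linear_map.zero[OF f.linear, of n] linear_map.zero[OF g.linear, of n] that
      by (simp add: cmod_Nplus_neg)
    show "f (int n) (nclass (k_simplex R m) n x) = g (int n) (nclass (k_simplex R m) n x)"
      if "x \<in> carrier (smod (k_simplex R m) n)" for n x
      by (rule Nplus_simplex_eqI[OF f.linear g.linear assms(4) A.nclass_closed[OF that]])
  qed (rule f.extensional g.extensional)+
qed

lemma Nplus_map_simplex:
  assumes "\<theta> \<in> Delta_hom p m" "\<phi> \<in> Delta_hom n p"
  shows "Nplus_map (k_simplex R p) (k_simplex R m) (k_simplex_map R p m \<theta>) (int n) (gen_class R p n \<phi>)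
    = gen_class R m n (compose {..<n} \<theta> \<phi>)"
proof -
  interpret h: aug_smod_hom R "k_simplex R p" "k_simplex R m" "k_simplex_map R p m \<theta>"
    using assms(1) by (rule k_simplex_map_hom)
  show ?thesis unfolding gen_class_def
    by (simp add: h.Nplus_map_nclass gen_closed k_simplex_map_gen assms)
qed

lemma cdiff_gen_class:
  assumes "\<phi> \<in> Delta_hom (Suc n) m"
  shows "cdiff (Nplus (k_simplex R m)) (int (Suc n)) (gen_class R m (Suc n) \<phi>)
    = (\<Oplus>\<^bsub>cmod (Nplus (k_simplex R m)) (int n)\<^esub>i\<in>{..<Suc n}.
        signed (cmod (Nplus (k_simplex R m)) (int n)) i (gen_class R m n (compose {..<n} \<phi> (coface n i))))"
proof -
  interpret A: aug_smod R "k_simplex R m" by (rule aug_smod_simplex)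
  interpret cl: linear_map R "smod (k_simplex R m) n" "cmod (Nplus (k_simplex R m)) (int n)" "nclass (k_simplex R m) n"
    by (rule A.nclass_linear)
  have face: "A.face n i (free_gen R (Delta_hom (Suc n) m) \<phi>)
      = free_gen R (Delta_hom n m) (compose {..<n} \<phi> (coface n i))" if "i \<le> n" for i
    using that assms by (simp add: A.face_def sact_simplex_gen)
  have "cdiff (Nplus (k_simplex R m)) (int (Suc n)) (gen_class R m (Suc n) \<phi>)
      = nclass (k_simplex R m) n (\<Oplus>\<^bsub>smod (k_simplex R m) n\<^esub>i\<in>{..<Suc n}.
          signed (smod (k_simplex R m) n) i (A.face n i (free_gen R (Delta_hom (Suc n) m) \<phi>)))"
    unfolding gen_class_def A.cdiff_Nplus_nclass[OF gen_closed] A.alt_face_Suc ..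
  also have "\<dots> = (\<Oplus>\<^bsub>cmod (Nplus (k_simplex R m)) (int n)\<^esub>i\<in>{..<Suc n}. nclass (k_simplex R m) n
          (signed (smod (k_simplex R m) n) i (A.face n i (free_gen R (Delta_hom (Suc n) m) \<phi>))))"
    by (rule cl.finsum) (auto simp: gen_closed)
  also have "\<dots> = (\<Oplus>\<^bsub>cmod (Nplus (k_simplex R m)) (int n)\<^esub>i\<in>{..<Suc n}.
        signed (cmod (Nplus (k_simplex R m)) (int n)) i (gen_class R m n (compose {..<n} \<phi> (coface n i))))"
    by (intro A.NA.cm.M.finsum_cong')
      (auto simp: face cl.signed gen_closed gen_class_def[symmetric] intro!: signed_closed[OF A.module_Nplus])
  finally show ?thesis .
qed

lemma gen_class_degenerate:
  assumes "\<psi> \<in> Delta_hom n m" "i < n"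
  shows "gen_class R m (Suc n) (compose {..<Suc n} \<psi> (codegen n i))
    = \<zero>\<^bsub>cmod (Nplus (k_simplex R m)) (int (Suc n))\<^esub>"
proof -
  interpret A: aug_smod R "k_simplex R m" by (rule aug_smod_simplex)
  have "free_gen R (Delta_hom (Suc n) m) (compose {..<Suc n} \<psi> (codegen n i))
      = A.degen n i (free_gen R (Delta_hom n m) \<psi>)"
    using assms by (simp add: A.degen_def sact_simplex_gen)
  then have "free_gen R (Delta_hom (Suc n) m) (compose {..<Suc n} \<psi> (codegen n i))
      \<in> degenerate (k_simplex R m) (Suc n)"
    using assms A.degen_in_degenerate[OF assms(2) gen_closed] by simp
  then show ?thesis
    unfolding gen_class_def by (subst A.nclass_zero_iff) (simp_all add: gen_closed)
qed

end

lemma Nplus_map_chain_map: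
  assumes "aug_smod_hom k A B f"
  shows "chain_map k (Nplus A) (Nplus B) (Nplus_map A B f)"
proof -
  interpret aug_smod_hom k A B f by fact
  show ?thesis by unfold_locales (rule Nplus_map_in_Ch_hom)
qed

section \<open>The functor \<open>\<Gamma>\<^sup>+\<close>\<close>

lemma smod_Gamma: "smod (Gamma_plus k C) m = Ch_module k (Nplus (k_simplex k m)) C"
  and Gamma_carrier: "carrier (smod (Gamma_plus k C) m) = Ch_hom k (Nplus (k_simplex k m)) C"
  by (simp_all add: Gamma_plus_def Ch_module_def)

lemma sact_Gamma: "f \<in> Ch_hom k (Nplus (k_simplex k m)) C \<Longrightarrow> sact (Gamma_plus k C) p m \<theta> f
    = Ch_comp (Nplus (k_simplex k p)) f (Nplus_map (k_simplex k p) (k_simplex k m) (k_simplex_map k p m \<theta>))"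
  by (simp add: Gamma_plus_def)

lemma Gamma_plus_map_apply:
  "f \<in> Ch_hom k (Nplus (k_simplex k m)) C \<Longrightarrow>
    Gamma_plus_map k C g m f = Ch_comp (Nplus (k_simplex k m)) g f"
  by (simp add: Gamma_plus_map_def)

context chain_complex
begin

lemma chain_pair_simplex: "chain_pair k (Nplus (k_simplex k m)) C"
  by (simp add: chain_pair_def chain_complex_simplex chain_complex_axioms)

lemma simplex_chain_map: "f \<in> Ch_hom k (Nplus (k_simplex k m)) C \<Longrightarrow> chain_map k (Nplus (k_simplex k m)) C f"
  by (rule chain_pair.chain_mapI[OF chain_pair_simplex])

lemma module_smod_Gamma: "module k (smod (Gamma_plus k C) m)"
  unfolding smod_Gamma by (rule chain_pair.module_Ch_module[OF chain_pair_simplex])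

lemma simplex_map_chain_map:
  "\<theta> \<in> Delta_hom p m \<Longrightarrow> chain_map k (Nplus (k_simplex k p)) (Nplus (k_simplex k m))
    (Nplus_map (k_simplex k p) (k_simplex k m) (k_simplex_map k p m \<theta>))"
  by (rule Nplus_map_chain_map) (rule k_simplex_map_hom)

lemma sact_Gamma_in:
  assumes "f \<in> Ch_hom k (Nplus (k_simplex k m)) C" "\<theta> \<in> Delta_hom p m"
  shows "sact (Gamma_plus k C) p m \<theta> f \<in> Ch_hom k (Nplus (k_simplex k p)) C"
  unfolding sact_Gamma[OF assms(1)]
  by (rule Ch_comp_in[OF simplex_map_chain_map[OF assms(2)] simplex_chain_map[OF assms(1)]])

text \<open>With this formula the laws for \<open>sact\<close> on \<open>Gamma_plus\<close> become
  associativity and unit laws in the simplex category.\<close>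

lemma sact_Gamma_gen_class:
  assumes "f \<in> Ch_hom k (Nplus (k_simplex k m)) C" "\<theta> \<in> Delta_hom p m" "\<phi> \<in> Delta_hom n p"
  shows "sact (Gamma_plus k C) p m \<theta> f (int n) (gen_class k p n \<phi>)
    = f (int n) (gen_class k m n (compose {..<n} \<theta> \<phi>))"
  by (simp add: sact_Gamma assms Ch_comp_apply Nplus_map_simplex)

lemma sact_Gamma_linear:
  assumes "\<theta> \<in> Delta_hom p m"
  shows "linear_map k (smod (Gamma_plus k C) m) (smod (Gamma_plus k C) p) (sact (Gamma_plus k C) p m \<theta>)"
proof -
  interpret m: chain_pair k "Nplus (k_simplex k m)" C by (rule chain_pair_simplex)
  interpret p: chain_pair k "Nplus (k_simplex k p)" C by (rule chain_pair_simplex)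
  interpret \<theta>: chain_map k "Nplus (k_simplex k p)" "Nplus (k_simplex k m)"
    "Nplus_map (k_simplex k p) (k_simplex k m) (k_simplex_map k p m \<theta>)"
    using assms by (rule simplex_map_chain_map)
  have car: "carrier (Ch_module k D C) = Ch_hom k D C" for D :: "('r, 'z) complx" by (simp add: Ch_module_def)
  show ?thesis
    unfolding smod_Gamma
  proof unfold_locales
    fix f g assume "f \<in> carrier (Ch_module k (Nplus (k_simplex k m)) C)"
      "g \<in> carrier (Ch_module k (Nplus (k_simplex k m)) C)"
    then have fg: "f \<in> Ch_hom k (Nplus (k_simplex k m)) C" "g \<in> Ch_hom k (Nplus (k_simplex k m)) C"
      by (simp_all add: car)
    show "sact (Gamma_plus k C) p m \<theta> (f \<oplus>\<^bsub>Ch_module k (Nplus (k_simplex k m)) C\<^esub> g)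
      = sact (Gamma_plus k C) p m \<theta> f \<oplus>\<^bsub>Ch_module k (Nplus (k_simplex k p)) C\<^esub> sact (Gamma_plus k C) p m \<theta> g"
      by (rule Ch_hom_eqI[OF sact_Gamma_in[OF m.add_in[OF fg] assms]
            p.add_in[OF sact_Gamma_in[OF fg(1) assms] sact_Gamma_in[OF fg(2) assms]]])
        (simp add: sact_Gamma fg m.add_in Ch_comp_apply, simp add: Ch_module_def Ch_comp_apply)
  next
    fix r f assume r: "r \<in> carrier k" and "f \<in> carrier (Ch_module k (Nplus (k_simplex k m)) C)"
    then have f: "f \<in> Ch_hom k (Nplus (k_simplex k m)) C" by (simp add: car)
    show "sact (Gamma_plus k C) p m \<theta> (r \<odot>\<^bsub>Ch_module k (Nplus (k_simplex k m)) C\<^esub> f)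
      = r \<odot>\<^bsub>Ch_module k (Nplus (k_simplex k p)) C\<^esub> sact (Gamma_plus k C) p m \<theta> f"
      by (rule Ch_hom_eqI[OF sact_Gamma_in[OF m.smult_in[OF r f] assms] p.smult_in[OF r sact_Gamma_in[OF f assms]]])
        (simp add: sact_Gamma f r m.smult_in Ch_comp_apply, simp add: Ch_module_def Ch_comp_apply)
  qed (simp add: car sact_Gamma_in assms)
qed

lemma aug_smod_Gamma: "aug_smod k (Gamma_plus k C)"
proof unfold_locales
  let ?G = "Gamma_plus k C"
  have ext: "sact ?G p m \<theta> \<in> extensional (carrier (smod ?G m))" for p m \<theta>
    by (simp add: Gamma_plus_def Ch_module_def)
  have "sact ?G m m (Delta_id m) f = f" if "f \<in> carrier (smod ?G m)" for m f
    using that unfolding Gamma_carrier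
    by (intro Ch_hom_simplex_eqI[OF chain_complex_axioms])
      (simp_all add: sact_Gamma_in, simp add: sact_Gamma_gen_class[OF _ Delta_id_in] Delta_id_compose)
  then have id: "sact ?G m m (Delta_id m) = (\<lambda>x\<in>carrier (smod ?G m). x)" for m
    by (intro extensionalityI[OF ext]) simp_all
  have "sact ?G q m (compose {..<q} \<theta> \<psi>) f = sact ?G q p \<psi> (sact ?G p m \<theta> f)"
    if "\<psi> \<in> Delta_hom q p" "\<theta> \<in> Delta_hom p m" "f \<in> carrier (smod ?G m)" for q p m \<psi> \<theta> f
    using that unfolding Gamma_carrier
    by (intro Ch_hom_simplex_eqI[OF chain_complex_axioms, where m = q])
      (simp_all add: sact_Gamma_in sact_Gamma_gen_class compose_Delta_assoc)
  then have comp: "sact ?G q m (compose {..<q} \<theta> \<psi>) = compose (carrier (smod ?G m)) (sact ?G q p \<psi>) (sact ?G p m \<theta>)"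
    if "\<psi> \<in> Delta_hom q p" "\<theta> \<in> Delta_hom p m" for q p m \<psi> \<theta>
    using that by (intro extensionalityI[OF ext]) (simp_all add: compose_eq)
  show "?G \<in> SpMod k"
    unfolding SpMod_def
    using module_smod_Gamma sact_Gamma_linear linear_map.in_mod_hom_iff[OF sact_Gamma_linear] ext id comp
    by simp
qed

lemma Gamma_plus_map_id: "Gamma_plus_map k C (Ch_id C) = Sp_id (Gamma_plus k C)"
proof
  fix m
  show "Gamma_plus_map k C (Ch_id C) m = Sp_id (Gamma_plus k C) m"
  proof (rule extensionalityI[of _ "Ch_hom k (Nplus (k_simplex k m)) C"])
    fix f assume f: "f \<in> Ch_hom k (Nplus (k_simplex k m)) C"
    then interpret f: chain_map k "Nplus (k_simplex k m)" C f by (rule simplex_chain_map)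
    have id: "chain_map k C C (Ch_id C)" by unfold_locales (rule Ch_id_in[OF chain_complex_axioms])
    have "Ch_comp (Nplus (k_simplex k m)) (Ch_id C) f = f"
      by (rule Ch_hom_eqI[OF Ch_comp_in[OF f.chain_map_axioms id] f]) (simp add: Ch_comp_apply Ch_id_def)
    then show "Gamma_plus_map k C (Ch_id C) m f = Sp_id (Gamma_plus k C) m f"
      using f by (simp add: Gamma_plus_map_apply Sp_id_def Gamma_carrier)
  qed (simp_all add: Gamma_plus_map_def Sp_id_def Gamma_carrier)
qed

end

lemma Gamma_plus_map_comp:
  assumes "chain_map k C D f"
  shows "Gamma_plus_map k C (Ch_comp C g f)
    = Sp_comp (Gamma_plus k C) (Gamma_plus_map k D g) (Gamma_plus_map k C f)"
proof
  interpret f: chain_map k C D f by fact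
  fix m
  show "Gamma_plus_map k C (Ch_comp C g f) m
    = Sp_comp (Gamma_plus k C) (Gamma_plus_map k D g) (Gamma_plus_map k C f) m"
  proof (rule extensionalityI[of _ "Ch_hom k (Nplus (k_simplex k m)) C"])
    fix h assume h: "h \<in> Ch_hom k (Nplus (k_simplex k m)) C"
    then interpret h: chain_map k "Nplus (k_simplex k m)" C h by (rule f.C.simplex_chain_map)
    have fh: "Ch_comp (Nplus (k_simplex k m)) f h \<in> Ch_hom k (Nplus (k_simplex k m)) D"
      by (rule Ch_comp_in[OF h.chain_map_axioms f.chain_map_axioms])
    have "Ch_comp (Nplus (k_simplex k m)) (Ch_comp C g f) h
        = Ch_comp (Nplus (k_simplex k m)) g (Ch_comp (Nplus (k_simplex k m)) f h)"
      by (auto simp: Ch_comp_def compose_def fun_eq_iff restrict_def)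
    then show "Gamma_plus_map k C (Ch_comp C g f) m h
      = Sp_comp (Gamma_plus k C) (Gamma_plus_map k D g) (Gamma_plus_map k C f) m h"
      using h fh by (simp add: Gamma_plus_map_apply Sp_comp_apply Gamma_carrier)
  qed (simp_all add: Gamma_plus_map_def Sp_comp_def Gamma_carrier compose_def)
qed

lemma Gamma_plus_map_hom:
  assumes "chain_map k C D g"
  shows "aug_smod_hom k (Gamma_plus k C) (Gamma_plus k D) (Gamma_plus_map k C g)"
proof -
  interpret g: chain_map k C D g by fact
  interpret GC: aug_smod k "Gamma_plus k C" by (rule g.C.aug_smod_Gamma)
  interpret GD: aug_smod k "Gamma_plus k D" by (rule g.D.aug_smod_Gamma)
  have closed: "Gamma_plus_map k C g m f \<in> Ch_hom k (Nplus (k_simplex k m)) D"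
    if "f \<in> Ch_hom k (Nplus (k_simplex k m)) C" for m f
    using that by (simp add: Gamma_plus_map_apply Ch_comp_in[OF g.C.simplex_chain_map g.chain_map_axioms])
  have lin: "linear_map k (smod (Gamma_plus k C) m) (smod (Gamma_plus k D) m) (Gamma_plus_map k C g m)" for m
  proof -
    interpret mC: chain_pair k "Nplus (k_simplex k m)" C by (rule g.C.chain_pair_simplex)
    interpret mD: chain_pair k "Nplus (k_simplex k m)" D by (rule g.D.chain_pair_simplex)
    note mc = g.C.simplex_chain_map
    show ?thesis
    proof (unfold_locales, unfold Gamma_carrier)
      fix f h assume fh: "f \<in> Ch_hom k (Nplus (k_simplex k m)) C" "h \<in> Ch_hom k (Nplus (k_simplex k m)) C"
      then show "Gamma_plus_map k C g m (f \<oplus>\<^bsub>smod (Gamma_plus k C) m\<^esub> h)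
          = Gamma_plus_map k C g m f \<oplus>\<^bsub>smod (Gamma_plus k D) m\<^esub> Gamma_plus_map k C g m h"
        unfolding smod_Gamma
        by (intro Ch_hom_eqI[OF closed[OF mC.add_in] mD.add_in[OF closed closed]])
          (simp_all add: Gamma_plus_map_apply mC.add_in Ch_comp_apply,
            simp add: Ch_module_def Ch_comp_apply linear_map.add[OF g.linear] chain_map.closed[OF mc])
    next
      fix r f assume rf: "r \<in> carrier k" "f \<in> Ch_hom k (Nplus (k_simplex k m)) C"
      then show "Gamma_plus_map k C g m (r \<odot>\<^bsub>smod (Gamma_plus k C) m\<^esub> f)
          = r \<odot>\<^bsub>smod (Gamma_plus k D) m\<^esub> Gamma_plus_map k C g m f"
        unfolding smod_Gamma
        by (intro Ch_hom_eqI[OF closed[OF mC.smult_in] mD.smult_in[OF _ closed]])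
          (simp_all add: Gamma_plus_map_apply mC.smult_in Ch_comp_apply,
            simp add: Ch_module_def Ch_comp_apply linear_map.smult[OF g.linear] chain_map.closed[OF mc])
    qed (rule closed)
  qed
  have "Gamma_plus_map k C g m \<in> extensional (carrier (smod (Gamma_plus k C) m))" for m
    by (simp add: Gamma_plus_map_def Gamma_carrier)
  moreover have "Gamma_plus_map k C g p (sact (Gamma_plus k C) p m \<theta> f)
      = sact (Gamma_plus k D) p m \<theta> (Gamma_plus_map k C g m f)"
    if "\<theta> \<in> Delta_hom p m" "f \<in> Ch_hom k (Nplus (k_simplex k m)) C" for p m \<theta> f
    using that closed g.C.sact_Gamma_in
    by (intro g.C.Ch_hom_simplex_eqI[OF g.D.chain_complex_axioms, where m = p])
      (simp_all add: g.D.sact_Gamma_in g.D.sact_Gamma_gen_class Gamma_plus_map_apply Ch_comp_apply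
        g.C.sact_Gamma_gen_class)
  ultimately show ?thesis
    using linear_map.in_mod_hom_iff[OF lin]
    by unfold_locales (simp add: Sp_hom_def Gamma_carrier)
qed

section \<open>The adjunction\<close>

context aug_smod
begin

text \<open>Replacing the sum over the support by the sum over all of \<open>Delta_hom p m\<close>
  identifies \<open>yoneda\<close> with a \<open>free_lift\<close>, whose linearity and values on
  generators are known.\<close>

lemma yoneda_eq:
  assumes a: "a \<in> carrier (smod A m)"
  shows "yoneda k A m a p = (\<lambda>c\<in>carrier (smod (k_simplex k m) p).
    fin_free.free_lift (Delta_hom p m) (smod A p) (\<lambda>\<phi>. sact A p m \<phi> a) c)"
proof
  fix c
  show "yoneda k A m a p c = (\<lambda>c\<in>carrier (smod (k_simplex k m) p).
    fin_free.free_lift (Delta_hom p m) (smod A p) (\<lambda>\<phi>. sact A p m \<phi> a) c) c"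
    using a by (simp add: yoneda_def smod_simplex fin_free.free_lift_support[OF fin_free_Delta module_smod])
qed

lemma yoneda_gen:
  assumes "a \<in> carrier (smod A m)" "\<phi> \<in> Delta_hom p m"
  shows "yoneda k A m a p (free_gen k (Delta_hom p m) \<phi>) = sact A p m \<phi> a"
  using assms by (simp add: yoneda_eq gen_closed fin_free.free_lift_gen[OF fin_free_Delta module_smod])

lemma yoneda_hom:
  assumes a: "a \<in> carrier (smod A m)"
  shows "aug_smod_hom k (k_simplex k m) A (yoneda k A m a)"
proof (rule simplex_homI[OF aug_smod_axioms])
  fix p
  have "linear_map k (smod (k_simplex k m) p) (smod A p)
      (fin_free.free_lift (Delta_hom p m) (smod A p) (\<lambda>\<phi>. sact A p m \<phi> a))"
    unfolding smod_simplex using a by (intro fin_free.free_lift_linear[OF fin_free_Delta module_smod]) simp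
  then show "linear_map k (smod (k_simplex k m) p) (smod A p) (yoneda k A m a p)"
    by (rule linear_map_cong[THEN iffD1, rotated]) (simp add: yoneda_eq[OF a])
  show "yoneda k A m a p \<in> extensional (carrier (smod (k_simplex k m) p))"
    by (simp add: yoneda_eq[OF a])
qed (simp add: yoneda_gen a sact_comp)

lemma unit_in:
  assumes "a \<in> carrier (smod A m)"
  shows "unit_NG k A m a \<in> Ch_hom k (Nplus (k_simplex k m)) (Nplus A)"
  using aug_smod_hom.Nplus_map_in_Ch_hom[OF yoneda_hom[OF assms]] assms by (simp add: unit_NG_def)

lemma unit_gen_class:
  assumes "a \<in> carrier (smod A m)" "\<phi> \<in> Delta_hom n m"
  shows "unit_NG k A m a (int n) (gen_class k m n \<phi>) = nclass A n (sact A n m \<phi> a)"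
proof -
  interpret y: aug_smod_hom k "k_simplex k m" A "yoneda k A m a" using assms(1) by (rule yoneda_hom)
  show ?thesis
    using assms by (simp add: unit_NG_def gen_class_def y.Nplus_map_nclass gen_closed yoneda_gen)
qed

lemma unit_hom: "aug_smod_hom k A (Gamma_plus k (Nplus A)) (unit_NG k A)"
proof -
  interpret G: aug_smod k "Gamma_plus k (Nplus A)" by (rule NA.aug_smod_Gamma)
  note eqI = Ch_hom_simplex_eqI[OF NA.chain_complex_axioms]
  have lin: "linear_map k (smod A m) (smod (Gamma_plus k (Nplus A)) m) (unit_NG k A m)" for m
  proof -
    interpret m: chain_pair k "Nplus (k_simplex k m)" "Nplus A" by (rule NA.chain_pair_simplex)
    show ?thesis
    proof unfold_locales
      fix a b assume ab: "a \<in> carrier (smod A m)" "b \<in> carrier (smod A m)"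
      show "unit_NG k A m (a \<oplus>\<^bsub>smod A m\<^esub> b)
          = unit_NG k A m a \<oplus>\<^bsub>smod (Gamma_plus k (Nplus A)) m\<^esub> unit_NG k A m b"
        unfolding smod_Gamma using ab
        by (intro eqI[OF unit_in m.add_in[OF unit_in unit_in]])
          (simp_all, simp add: unit_gen_class Ch_module_def sact_add linear_map.add[OF nclass_linear])
    next
      fix r a assume ra: "r \<in> carrier k" "a \<in> carrier (smod A m)"
      then show "unit_NG k A m (r \<odot>\<^bsub>smod A m\<^esub> a)
          = r \<odot>\<^bsub>smod (Gamma_plus k (Nplus A)) m\<^esub> unit_NG k A m a"
        unfolding smod_Gamma
        by (intro eqI[OF unit_in m.smult_in[OF _ unit_in]])
          (simp_all, simp add: unit_gen_class Ch_module_def sact_smult linear_map.smult[OF nclass_linear])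
    qed (simp add: Gamma_carrier unit_in)
  qed
  have "unit_NG k A m \<in> extensional (carrier (smod A m))" for m
    by (simp add: unit_NG_def)
  moreover have "unit_NG k A p (sact A p m \<theta> a) = sact (Gamma_plus k (Nplus A)) p m \<theta> (unit_NG k A m a)"
    if "\<theta> \<in> Delta_hom p m" "a \<in> carrier (smod A m)" for p m \<theta> a
    using that
    by (intro eqI[OF unit_in NA.sact_Gamma_in[OF unit_in]])
      (simp_all add: unit_gen_class NA.sact_Gamma_gen_class unit_in sact_comp)
  ultimately show ?thesis
    using linear_map.in_mod_hom_iff[OF lin]
    by unfold_locales (simp add: Sp_hom_def)
qed

end

lemma unit_natural:
  assumes "aug_smod_hom k A B f"
  shows "Sp_comp A (unit_NG k B) f
    = Sp_comp A (Gamma_plus_map k (Nplus A) (Nplus_map A B f)) (unit_NG k A)"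
proof
  interpret f: aug_smod_hom k A B f by fact
  interpret F: chain_map k "Nplus A" "Nplus B" "Nplus_map A B f" using assms by (rule Nplus_map_chain_map)
  fix m
  show "Sp_comp A (unit_NG k B) f m = Sp_comp A (Gamma_plus_map k (Nplus A) (Nplus_map A B f)) (unit_NG k A) m"
  proof (rule extensionalityI[of _ "carrier (smod A m)"])
    fix a assume a: "a \<in> carrier (smod A m)"
    then have "unit_NG k B m (f m a) = Ch_comp (Nplus (k_simplex k m)) (Nplus_map A B f) (unit_NG k A m a)"
      by (intro f.A.Ch_hom_simplex_eqI[OF f.B.NA.chain_complex_axioms f.B.unit_in
            Ch_comp_in[OF f.A.NA.simplex_chain_map[OF f.A.unit_in] assms[THEN Nplus_map_chain_map]]])
        (simp_all add: f.B.unit_gen_class f.A.unit_gen_class Ch_comp_apply f.Nplus_map_nclass f.sact)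
    with a show "Sp_comp A (unit_NG k B) f m a
      = Sp_comp A (Gamma_plus_map k (Nplus A) (Nplus_map A B f)) (unit_NG k A) m a"
      by (simp add: Sp_comp_apply Gamma_plus_map_apply f.A.unit_in)
  qed (simp_all add: Sp_comp_def compose_def)
qed

section \<open>The counit, its naturality and the triangle identities\<close>

context chain_complex
begin

lemma eval_top_linear:
  "linear_map k (smod (Gamma_plus k C) n) (cmod C (int n)) (\<lambda>f. f (int n) (top_class k n))"
  unfolding smod_Gamma top_class_eq
  by (rule chain_pair.eval_linear[OF chain_pair_simplex]) simp

text \<open>This makes evaluation at the top class well defined on N^+. The value of s_i f at the
  identity is the value of f at the codegeneracy \<open>codegen m i\<close>, whose class in N^+ of
  the smaller simplex is zero.\<close>

lemma degenerate_top:
  assumes "f \<in> degenerate (Gamma_plus k C) n"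
  shows "f (int n) (top_class k n) = \<zero>\<^bsub>cmod C (int n)\<^esub>"
proof -
  interpret G: aug_smod k "Gamma_plus k C" by (rule aug_smod_Gamma)
  interpret ev: linear_map k "smod (Gamma_plus k C) n" "cmod C (int n)" "\<lambda>f. f (int n) (top_class k n)"
    by (rule eval_top_linear)
  have "submodule {\<zero>\<^bsub>cmod C (int n)\<^esub>} k (cmod C (int n))"
    by (rule cm.submoduleI) auto
  then have "degenerate (Gamma_plus k C) n \<subseteq> {f \<in> carrier (smod (Gamma_plus k C) n).
      f (int n) (top_class k n) \<in> {\<zero>\<^bsub>cmod C (int n)\<^esub>}}"
  proof (rule G.degenerate_least[OF ev.submodule_vimage])
    fix m i f assume n: "n = Suc m" and i: "i < m" and f: "f \<in> carrier (smod (Gamma_plus k C) m)"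
    then have f': "f \<in> Ch_hom k (Nplus (k_simplex k m)) C" by (simp add: Gamma_carrier)
    interpret f: chain_map k "Nplus (k_simplex k m)" C f using f' by (rule simplex_chain_map)
    have "G.degen m i f (int (Suc m)) (top_class k (Suc m))
        = f (int (Suc m)) (gen_class k m (Suc m) (compose {..<Suc m} (codegen m i) (Delta_id (Suc m))))"
      unfolding G.degen_def top_class_eq by (rule sact_Gamma_gen_class) (use f' i in simp_all)
    \<comment> \<open>Moving the identity to the other side exhibits the generator in the form
      \<psi> after \<open>codegen m i\<close> that \<open>gen_class_degenerate\<close> expects, with
      \<psi> the identity.\<close>
    also have "compose {..<Suc m} (codegen m i) (Delta_id (Suc m)) = compose {..<Suc m} (Delta_id m) (codegen m i)"
      using i by (simp only: compose_Delta_id[OF codegen_in] Delta_id_compose[OF codegen_in])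
    finally show "G.degen m i f \<in> {f \<in> carrier (smod (Gamma_plus k C) n).
        f (int n) (top_class k n) \<in> {\<zero>\<^bsub>cmod C (int n)\<^esub>}}"
      unfolding n using f i linear_map.zero[OF f.linear]
      by (simp only: gen_class_degenerate[OF Delta_id_in i]) simp
  qed
  with assms show ?thesis by blast
qed

lemma counit_eq: "counit_NG k C (int n) = (\<lambda>X\<in>carrier (cmod (Nplus (Gamma_plus k C)) (int n)).
    the_elem ((\<lambda>f. f (int n) (top_class k n)) ` X))"
  by (simp add: counit_NG_def)

lemma counit_neg: "n < 0 \<Longrightarrow> counit_NG k C n
    = (\<lambda>X\<in>carrier (cmod (Nplus (Gamma_plus k C)) n). \<zero>\<^bsub>cmod C n\<^esub>)"
  by (simp add: counit_NG_def)

lemma counit_extensional: "counit_NG k C n \<in> extensional (carrier (cmod (Nplus (Gamma_plus k C)) n))"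
  by (simp add: counit_NG_def)

lemma counit_nclass:
  assumes "f \<in> Ch_hom k (Nplus (k_simplex k n)) C"
  shows "counit_NG k C (int n) (nclass (Gamma_plus k C) n f) = f (int n) (top_class k n)"
proof -
  interpret G: aug_smod k "Gamma_plus k C" by (rule aug_smod_Gamma)
  have f: "f \<in> carrier (smod (Gamma_plus k C) n)" using assms by (simp add: Gamma_carrier)
  have "the_elem ((\<lambda>f. f (int n) (top_class k n)) ` nclass (Gamma_plus k C) n f) = f (int n) (top_class k n)"
    by (rule G.dg.the_elem_coset[OF eval_top_linear _ f]) (rule degenerate_top)
  with f show ?thesis by (simp add: counit_eq)
qed

lemma counit_linear: "linear_map k (cmod (Nplus (Gamma_plus k C)) n) (cmod C n) (counit_NG k C n)"
proof -
  interpret G: aug_smod k "Gamma_plus k C" by (rule aug_smod_Gamma)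
  show ?thesis
  proof (cases "n < 0")
    case True
    show ?thesis
      by (rule linear_map_cong[THEN iffD1, OF _ linear_map_zero[OF G.module_Nplus module_cmod]])
        (simp add: counit_neg True)
  next
    case False
    then obtain m where n: "n = int m" by (rule int_nonnegE)
    have "linear_map k (quot_module (smod (Gamma_plus k C) m) (degenerate (Gamma_plus k C) m)) (cmod C (int m))
        (\<lambda>X. the_elem ((\<lambda>f. f (int m) (top_class k m)) ` X))"
      by (rule G.dg.the_elem_coset_linear[OF eval_top_linear]) (rule degenerate_top)
    then show ?thesis
      unfolding n cmod_Nplus_nat by (rule linear_map_cong[THEN iffD1, rotated]) (simp add: counit_eq cmod_Nplus_nat)
  qed
qed

text \<open>Face i of f takes at the top class the value of f at coface i. So the alternating sum of
  the faces, evaluated at the top class, is f of the differential of the top class, and f commutes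
  with differentials.\<close>

lemma counit_chain_map: "chain_map k (Nplus (Gamma_plus k C)) C (counit_NG k C)"
proof -
  interpret G: aug_smod k "Gamma_plus k C" by (rule aug_smod_Gamma)
  let ?N = "Nplus (Gamma_plus k C)"
  have "counit_NG k C (n - 1) (cdiff ?N n X) = cdiff C n (counit_NG k C n X)"
    if X: "X \<in> carrier (cmod ?N n)" for n X
    using X
  proof (cases rule: G.Nplus_cases)
    case 1
    then show ?thesis
      using X linear_map.zero[OF counit_linear, of "n - 1"] linear_map.zero[OF cdiff_linear]
      by (simp add: G.cdiff_Nplus_le_0 counit_neg)
  next
    case (2 m f)
    then have f: "f \<in> Ch_hom k (Nplus (k_simplex k m)) C" by (simp add: Gamma_carrier)
    interpret f: chain_map k "Nplus (k_simplex k m)" C f using f by (rule simplex_chain_map)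
    have top: "top_class k m \<in> carrier (cmod (Nplus (k_simplex k m)) (int m))"
      by (simp add: top_class_eq)
    show ?thesis
    proof (cases m)
      \<comment> \<open>Here C may be nonzero in degree -1. The boundary of the value vanishes
        because f is a chain map and the differential of the top class is zero.\<close>
      case 0
      interpret S: aug_smod k "k_simplex k m" by (rule aug_smod_simplex)
      have "cdiff C n (counit_NG k C n X) = f (n - 1) (cdiff (Nplus (k_simplex k m)) n (top_class k m))"
        unfolding 2 counit_nclass[OF f] using f.cdiff[OF top] by simp
      also have "\<dots> = \<zero>\<^bsub>cmod C (n - 1)\<^esub>"
        using top linear_map.zero[OF f.linear, of "n - 1"] S.cdiff_Nplus_le_0[of 0] by (simp add: 2 0)
      finally show ?thesis
        using X linear_map.zero[OF counit_linear, of "n - 1"] by (simp add: 2 0 G.cdiff_Nplus_le_0)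
    next
      case (Suc p)
      interpret ev: linear_map k "smod (Gamma_plus k C) p" "cmod C (int p)" "\<lambda>f. f (int p) (top_class k p)"
        by (rule eval_top_linear)
      have fc: "f \<in> carrier (smod (Gamma_plus k C) (Suc p))" using 2 Suc by simp
      have face: "G.face p i f (int p) (top_class k p) = f (int p) (gen_class k m p (coface p i))" if "i \<le> p" for i
        unfolding G.face_def top_class_eq using that f
        by (subst sact_Gamma_gen_class) (simp_all add: Suc compose_Delta_id[OF coface_in])
      let ?S = "cmod (Nplus (k_simplex k m)) (int p)"
      have s: "module k ?S" by (rule chain_complex.module_cmod[OF chain_complex_simplex])
      have "counit_NG k C (int p) (cdiff ?N (int (Suc p)) (nclass (Gamma_plus k C) (Suc p) f))
          = alt_face (Gamma_plus k C) (Suc p) f (int p) (top_class k p)"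
        using fc linear_map.closed[OF G.alt_face_linear fc]
        by (simp only: G.cdiff_Nplus_nclass counit_nclass Gamma_carrier)
      also have "\<dots> = (\<Oplus>\<^bsub>cmod C (int p)\<^esub>i\<in>{..<Suc p}.
          signed (smod (Gamma_plus k C) p) i (G.face p i f) (int p) (top_class k p))"
        unfolding G.alt_face_Suc using fc by (intro ev.finsum) simp
      also have "\<dots> = (\<Oplus>\<^bsub>cmod C (int p)\<^esub>i\<in>{..<Suc p}. f (int p) (signed ?S i (gen_class k m p (coface p i))))"
        using fc
        by (intro cm.M.finsum_cong')
          (auto simp: ev.signed face linear_map.signed[OF f.linear] intro!: f.closed signed_closed[OF s] signed_closed[OF module_cmod])
      also have "\<dots> = f (int p) (\<Oplus>\<^bsub>?S\<^esub>i\<in>{..<Suc p}. signed ?S i (gen_class k m p (coface p i)))"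
        by (rule linear_map.finsum[OF f.linear, symmetric]) (rule signed_closed[OF s], simp)
      \<comment> \<open>Inserting the identity of the simplex brings the sum into the shape of
        \<open>cdiff_gen_class\<close>.\<close>
      also have "(\<Oplus>\<^bsub>?S\<^esub>i\<in>{..<Suc p}. signed ?S i (gen_class k m p (coface p i)))
          = (\<Oplus>\<^bsub>?S\<^esub>i\<in>{..<Suc p}. signed ?S i (gen_class k m p (compose {..<p} (Delta_id (Suc p)) (coface p i))))"
        using s by (intro abelian_monoid.finsum_cong')
         (auto simp: module_def abelian_group_def Delta_id_compose[OF coface_in] intro!: signed_closed[OF s])
      also have "\<dots> = cdiff (Nplus (k_simplex k m)) (int (Suc p)) (gen_class k m (Suc p) (Delta_id (Suc p)))"
        by (rule cdiff_gen_class[symmetric]) (simp add: Suc)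
      also have "f (int p) \<dots> = cdiff C (int (Suc p)) (f (int (Suc p)) (top_class k (Suc p)))"
        using f.cdiff[of "gen_class k m (Suc p) (Delta_id (Suc p))" "int (Suc p)"]
          gen_class_closed[of m "Suc p" "Delta_id (Suc p)"] by (simp add: top_class_eq Suc)
      also have "\<dots> = cdiff C (int (Suc p)) (counit_NG k C (int (Suc p)) (nclass (Gamma_plus k C) (Suc p) f))"
        using f by (simp only: counit_nclass Suc)
      finally show ?thesis by (simp add: 2 Suc)
    qed
  qed
  moreover have "counit_NG k C n \<in> mod_hom k (cmod ?N n) (cmod C n)" for n
    using linear_map.in_mod_hom_iff[OF counit_linear] counit_extensional by blast
  ultimately show ?thesis by unfold_locales (simp add: Ch_hom_def)
qed

text \<open>At a generator \<phi> the unit gives the class of the pullback of f along \<phi>; the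
  counit evaluates this at the identity, which returns the value of f at \<phi>.\<close>

lemma triangle_Gamma:
  "Sp_comp (Gamma_plus k C) (Gamma_plus_map k (Nplus (Gamma_plus k C)) (counit_NG k C))
    (unit_NG k (Gamma_plus k C)) = Sp_id (Gamma_plus k C)"
proof
  interpret G: aug_smod k "Gamma_plus k C" by (rule aug_smod_Gamma)
  fix m
  show "Sp_comp (Gamma_plus k C) (Gamma_plus_map k (Nplus (Gamma_plus k C)) (counit_NG k C))
    (unit_NG k (Gamma_plus k C)) m = Sp_id (Gamma_plus k C) m"
  proof (rule extensionalityI[of _ "carrier (smod (Gamma_plus k C) m)"])
    fix f assume fc: "f \<in> carrier (smod (Gamma_plus k C) m)"
    then have f: "f \<in> Ch_hom k (Nplus (k_simplex k m)) C" by (simp add: Gamma_carrier)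
    note u = G.unit_in[OF fc]
    have "Ch_comp (Nplus (k_simplex k m)) (counit_NG k C) (unit_NG k (Gamma_plus k C) m f) = f"
    proof (rule Ch_hom_simplex_eqI[OF chain_complex_axioms Ch_comp_in[OF G.NA.simplex_chain_map[OF u] counit_chain_map] f])
      fix n \<phi> assume \<phi>: "\<phi> \<in> Delta_hom n m"
      then show "Ch_comp (Nplus (k_simplex k m)) (counit_NG k C) (unit_NG k (Gamma_plus k C) m f) (int n) (gen_class k m n \<phi>)
          = f (int n) (gen_class k m n \<phi>)"
        using f fc sact_Gamma_in[OF f \<phi>]
        by (simp add: Ch_comp_apply G.unit_gen_class counit_nclass top_class_eq
            sact_Gamma_gen_class[OF _ _ Delta_id_in] compose_Delta_id)
    qed
    then show "Sp_comp (Gamma_plus k C) (Gamma_plus_map k (Nplus (Gamma_plus k C)) (counit_NG k C))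
        (unit_NG k (Gamma_plus k C)) m f = Sp_id (Gamma_plus k C) m f"
      using fc by (simp add: Sp_comp_apply Gamma_plus_map_apply[OF u] Sp_id_def)
  qed (simp_all add: Sp_comp_def Sp_id_def compose_def)
qed

end

text \<open>On the class of x, the counit evaluates the chain map induced by x at the identity
  simplex, which is again the class of x.\<close>

lemma (in aug_smod) triangle_Nplus:
  "Ch_comp (Nplus A) (counit_NG k (Nplus A)) (Nplus_map A (Gamma_plus k (Nplus A)) (unit_NG k A))
    = Ch_id (Nplus A)"
proof -
  interpret u: aug_smod_hom k A "Gamma_plus k (Nplus A)" "unit_NG k A" by (rule unit_hom)
  show ?thesis
  proof (rule Nplus_eqI)
    fix n :: int assume "n < 0"
    then show "Ch_comp (Nplus A) (counit_NG k (Nplus A)) (Nplus_map A (Gamma_plus k (Nplus A)) (unit_NG k A)) n {}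
        = Ch_id (Nplus A) n {}"
      by (simp add: Ch_comp_apply cmod_Nplus_neg u.Nplus_map_neg NA.counit_neg Ch_id_def)
  next
    fix m x assume x: "x \<in> carrier (smod A m)"
    then show "Ch_comp (Nplus A) (counit_NG k (Nplus A)) (Nplus_map A (Gamma_plus k (Nplus A)) (unit_NG k A)) (int m) (nclass A m x)
        = Ch_id (Nplus A) (int m) (nclass A m x)"
      by (simp add: Ch_comp_apply u.Nplus_map_nclass NA.counit_nclass unit_in top_class_eq unit_gen_class Ch_id_def)
  qed (simp_all add: Ch_comp_def Ch_id_def compose_def)
qed

lemma counit_natural:
  assumes "chain_map k C D f"
  shows "Ch_comp (Nplus (Gamma_plus k C)) f (counit_NG k C)
    = Ch_comp (Nplus (Gamma_plus k C)) (counit_NG k D)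
        (Nplus_map (Gamma_plus k C) (Gamma_plus k D) (Gamma_plus_map k C f))"
proof -
  interpret f: chain_map k C D f by fact
  interpret F: aug_smod_hom k "Gamma_plus k C" "Gamma_plus k D" "Gamma_plus_map k C f"
    using assms by (rule Gamma_plus_map_hom)
  show ?thesis
  proof (rule F.A.Nplus_eqI)
    fix n :: int assume "n < 0"
    then show "Ch_comp (Nplus (Gamma_plus k C)) f (counit_NG k C) n {}
      = Ch_comp (Nplus (Gamma_plus k C)) (counit_NG k D)
          (Nplus_map (Gamma_plus k C) (Gamma_plus k D) (Gamma_plus_map k C f)) n {}"
      by (simp add: Ch_comp_apply cmod_Nplus_neg F.Nplus_map_neg f.C.counit_neg f.D.counit_neg
          linear_map.zero[OF f.linear])
  next
    fix m x assume x: "x \<in> carrier (smod (Gamma_plus k C) m)"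
    then have x': "x \<in> Ch_hom k (Nplus (k_simplex k m)) C" by (simp add: Gamma_carrier)
    have fx: "Gamma_plus_map k C f m x \<in> Ch_hom k (Nplus (k_simplex k m)) D"
      using F.closed[OF x] by (simp add: Gamma_carrier)
    show "Ch_comp (Nplus (Gamma_plus k C)) f (counit_NG k C) (int m) (nclass (Gamma_plus k C) m x)
      = Ch_comp (Nplus (Gamma_plus k C)) (counit_NG k D)
          (Nplus_map (Gamma_plus k C) (Gamma_plus k D) (Gamma_plus_map k C f)) (int m) (nclass (Gamma_plus k C) m x)"
      using x x' fx
      by (simp add: Ch_comp_apply F.Nplus_map_nclass f.C.counit_nclass f.D.counit_nclass,
        simp add: Gamma_plus_map_apply Ch_comp_apply top_class_eq f.C.gen_class_closed)
  qed (simp_all add: Ch_comp_def compose_def)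
qed

section \<open>Injective and degenerate simplices\<close>

text \<open>By monotonicity a repeated value is already repeated at neighbours i and i + 1. Then
  \<phi> is recovered from its restriction along \<open>coface n i\<close> by precomposing with
  \<open>codegen n i\<close>.\<close>

lemma Delta_hom_not_injE:
  assumes \<phi>: "\<phi> \<in> Delta_hom p m" and "\<not> inj_on \<phi> {..<p}"
  obtains n i \<psi> where "p = Suc n" "i < n" "\<psi> \<in> Delta_hom n m" "\<phi> = compose {..<Suc n} \<psi> (codegen n i)"
proof -
  obtain i j where ij: "i < j" "j < p" "\<phi> i = \<phi> j"
  proof -
    from assms(2) obtain x y where "x < p" "y < p" "x \<noteq> y" "\<phi> x = \<phi> y" by (auto simp: inj_on_def)
    then show ?thesis using that[of x y] that[of y x] by (cases "x < y") auto
  qed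
  then obtain n where p: "p = Suc n" by (cases p) auto
  have i: "i < n" using ij p by simp
  have eq: "\<phi> (Suc i) = \<phi> i"
    using Delta_hom_mono[OF \<phi>, of i "Suc i"] Delta_hom_mono[OF \<phi>, of "Suc i" j] ij by simp
  let ?\<psi> = "compose {..<n} \<phi> (coface n i)"
  have \<psi>: "?\<psi> \<in> Delta_hom n m" using \<phi> i unfolding p by (intro compose_in[OF coface_in]) simp_all
  have "\<phi> = compose {..<Suc n} ?\<psi> (codegen n i)"
  proof (rule Delta_hom_eqI[OF \<phi>])
    show "compose {..<Suc n} ?\<psi> (codegen n i) \<in> Delta_hom p m"
      unfolding p by (rule compose_in[OF codegen_in[OF i] \<psi>])
    fix j assume "j < p"
    then show "\<phi> j = compose {..<Suc n} ?\<psi> (codegen n i) j"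
      using i eq unfolding p by (cases "j = i") (auto simp: compose_def coface_def codegen_def)
  qed
  with that p i \<psi> show ?thesis by blast
qed

lemma compose_codegen_not_inj:
  assumes "i < n"
  shows "\<not> inj_on (compose {..<Suc n} \<psi> (codegen n i)) {..<Suc n}"
proof
  assume inj: "inj_on (compose {..<Suc n} \<psi> (codegen n i)) {..<Suc n}"
  have "compose {..<Suc n} \<psi> (codegen n i) i = compose {..<Suc n} \<psi> (codegen n i) (Suc i)"
    using assms by (simp add: compose_def codegen_def)
  then have "i = Suc i" by (rule inj_onD[OF inj]) (use assms in auto)
  then show False by simp
qed

text \<open>An injective monotone map increases by at least d over d steps. Counting from 0 gives
  the first bound, counting up to the last argument p - 1 gives the second.\<close>

lemma Delta_hom_inj_bounds:
  assumes \<phi>: "\<phi> \<in> Delta_hom p m" and inj: "inj_on \<phi> {..<p}" and x: "x < p"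
  shows "x \<le> \<phi> x" "\<phi> x + p \<le> m + x"
proof -
  have strict: "\<phi> i < \<phi> j" if "i < j" "j < p" for i j
  proof -
    have "\<phi> i \<le> \<phi> j" using that by (intro Delta_hom_mono[OF \<phi>]) simp_all
    moreover have "\<phi> i \<noteq> \<phi> j" using inj_onD[OF inj, of i j] that by fastforce
    ultimately show ?thesis by simp
  qed
  have gap: "y + d < p \<Longrightarrow> \<phi> y + d \<le> \<phi> (y + d)" for y d
  proof (induction d)
    case (Suc d)
    then show ?case using strict[of "y + d" "y + Suc d"] by simp
  qed simp
  show "x \<le> \<phi> x" using gap[of 0 x] x by simp
  obtain d where d: "p = Suc (x + d)" using x less_iff_Suc_add by auto
  then show "\<phi> x + p \<le> m + x"
    using gap[of x d] Delta_hom_less[OF \<phi>, of "x + d"] by linarith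
qed

text \<open>The factor is obtained by lowering all values above the omitted i by one.\<close>

lemma Delta_hom_omit:
  assumes \<phi>: "\<phi> \<in> Delta_hom p (Suc m)" and i: "i \<le> m" and omit: "\<And>x. x < p \<Longrightarrow> \<phi> x \<noteq> i"
  obtains \<psi> where "\<psi> \<in> Delta_hom p m" "\<phi> = compose {..<p} (coface m i) \<psi>"
proof
  let ?\<psi> = "\<lambda>x\<in>{..<p}. if \<phi> x < i then \<phi> x else \<phi> x - 1"
  show \<psi>: "?\<psi> \<in> Delta_hom p m"
  proof (rule Delta_homI)
    fix j assume j: "j < p"
    have "(if a < i then a else a - 1) < m" if "a < Suc m" "a \<noteq> i" for a
      using that i by (cases "a < i") auto
    from this[OF Delta_hom_less[OF \<phi> j] omit[OF j]] j show "?\<psi> j < m" by simp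
  next
    fix x y assume xy: "x \<le> y" "y < p"
    have "(if a < i then a else a - 1) \<le> (if b < i then b else b - 1)" if "a \<le> b" for a b
      using that by (cases "a < i"; cases "b < i") auto
    from this[OF Delta_hom_mono[OF \<phi> xy]] xy show "?\<psi> x \<le> ?\<psi> y" by simp
  qed simp
  show "\<phi> = compose {..<p} (coface m i) ?\<psi>"
  proof (rule Delta_hom_eqI[OF \<phi> compose_in[OF \<psi> coface_in[OF i]]])
    fix j assume j: "j < p"
    then have "?\<psi> j < m" using Delta_hom_less[OF \<psi>] by blast
    then show "\<phi> j = compose {..<p} (coface m i) ?\<psi> j"
      using j omit[OF j] by (auto simp: compose_eq coface_def)
  qed
qed

text \<open>The four cases are the four reasons why a chain map vanishes on a generator in
  \<open>counit_inj\<close>: degeneracy, a vanishing face with positive index, the vanishing top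
  value, and the boundary relation. An injective map that factors through no coface with positive
  index has all of 1, ..., m among its values, and this leaves only m or m + 1 as size of its
  domain.\<close>

lemma Delta_hom_cases [consumes 1, case_names not_inj coface id coface_0]:
  assumes \<phi>: "\<phi> \<in> Delta_hom p (Suc m)"
  obtains "\<not> inj_on \<phi> {..<p}"
  | i \<psi> where "1 \<le> i" "i \<le> m" "\<psi> \<in> Delta_hom p m" "\<phi> = compose {..<p} (coface m i) \<psi>"
  | "p = Suc m" "\<phi> = Delta_id (Suc m)"
  | "p = m" "\<phi> = coface m 0"
proof (cases "inj_on \<phi> {..<p} \<and> {1..m} \<subseteq> \<phi> ` {..<p}")
  case False
  then have "\<not> inj_on \<phi> {..<p} \<or> (\<exists>i. i \<in> {1..m} \<and> i \<notin> \<phi> ` {..<p})" by blast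
  then consider "\<not> inj_on \<phi> {..<p}" | i where "i \<in> {1..m}" "i \<notin> \<phi> ` {..<p}" by blast
  then show ?thesis
  proof cases
    case (2 i)
    then have i: "1 \<le> i" "i \<le> m" and omit: "\<And>x. x < p \<Longrightarrow> \<phi> x \<noteq> i" by auto
    obtain \<psi> where "\<psi> \<in> Delta_hom p m" "\<phi> = compose {..<p} (coface m i) \<psi>"
      by (rule Delta_hom_omit[OF \<phi> i(2) omit])
    with that(2) i show ?thesis by blast
  qed (rule that(1))
next
  case True
  then have inj: "inj_on \<phi> {..<p}" and sub: "{1..m} \<subseteq> \<phi> ` {..<p}" by auto
  have "card {1..m} \<le> card (\<phi> ` {..<p})" using sub by (intro card_mono) auto
  then have "m \<le> p" by (simp add: card_image[OF inj])
  moreover have "p \<le> Suc m"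
  proof (cases "p = 0")
    case False
    with Delta_hom_inj_bounds(2)[OF \<phi> inj, of 0] show ?thesis by linarith
  qed simp
  ultimately have "p = Suc m \<or> p = m" by linarith
  then consider "p = Suc m" | "p = m" by blast
  then show ?thesis
  proof cases
    case 1
    have "\<phi> = Delta_id (Suc m)"
    proof (rule Delta_hom_eqI[of _ "Suc m" "Suc m"])
      fix x assume x: "x < Suc m"
      then show "\<phi> x = Delta_id (Suc m) x"
        using Delta_hom_inj_bounds[OF \<phi> inj, of x] 1 by (simp add: Delta_id_def)
    qed (use \<phi> 1 in simp_all)
    with 1 that(3) show ?thesis by blast
  next
    case 2
    \<comment> \<open>The image has exactly m elements and contains the m numbers 1, ..., m, so 0 is
      not a value.\<close>
    have img: "{1..m} = \<phi> ` {..<p}"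
      using sub by (intro card_subset_eq) (simp_all add: card_image[OF inj[unfolded 2]] 2)
    have pos: "\<phi> x \<ge> 1" if "x < p" for x
    proof -
      have "\<phi> x \<in> {1..m}" unfolding img using that by blast
      then show ?thesis by simp
    qed
    \<comment> \<open>For p = m the upper bound of \<open>Delta_hom_inj_bounds\<close> reads \<phi>
      x \<le> x + 1. Positivity at 0 and injectivity at each later step force equality.\<close>
    have "\<phi> x = Suc x" if "x < p" for x
      using that
    proof (induction x)
      case 0
      then show ?case using pos[of 0] Delta_hom_inj_bounds(2)[OF \<phi> inj, of 0] 2 by simp
    next
      case (Suc x)
      have "\<phi> (Suc x) \<noteq> \<phi> x"
      proof
        assume "\<phi> (Suc x) = \<phi> x"
        from inj_onD[OF inj this] Suc.prems show False by simp
      qed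
      moreover have "\<phi> x = Suc x" using Suc.IH Suc.prems by (metis Suc_lessD)
      ultimately show ?case
        using Delta_hom_inj_bounds[OF \<phi> inj Suc.prems] 2 by linarith
    qed
    then have "\<phi> = coface m 0"
      using \<phi> 2 by (intro Delta_hom_eqI[of _ m "Suc m"]) (simp_all, simp add: coface_def)
    with 2 that(4) show ?thesis by blast
  qed
qed

section \<open>The normalization theorem\<close>

context aug_smod
begin

lemma face_diff: "i \<le> m \<Longrightarrow> x \<in> carrier (smod A (Suc m)) \<Longrightarrow> y \<in> carrier (smod A (Suc m)) \<Longrightarrow>
    face m i (x \<ominus>\<^bsub>smod A (Suc m)\<^esub> y) = face m i x \<ominus>\<^bsub>smod A m\<^esub> face m i y"
  by (rule linear_map.diff[OF face_linear])

text \<open>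
  The faces of \<open>g\<close> are killed one at a time in descending order: replacing \<open>g\<close> by
  \<open>g - s\<^sub>l d\<^bsub>l+1\<^esub> g\<close> kills the face \<open>d\<^bsub>l+1\<^esub>\<close> and keeps the higher ones zero.
\<close>

lemma decompose:
  assumes a: "a \<in> carrier (smod A (Suc m))"
  obtains g d where "g \<in> carrier (smod A (Suc m))" "d \<in> degenerate A (Suc m)"
    "a = g \<oplus>\<^bsub>smod A (Suc m)\<^esub> d" "\<And>i. 1 \<le> i \<Longrightarrow> i \<le> m \<Longrightarrow> face m i g = \<zero>\<^bsub>smod A m\<^esub>"
proof -
  let ?M = "smod A (Suc m)"
  \<comment> \<open>Here j counts the faces already killed, namely those with index above m - j. At
    j = m only the zeroth face is left.\<close>
  have "\<exists>g\<in>carrier ?M. \<exists>d\<in>degenerate A (Suc m). a = g \<oplus>\<^bsub>?M\<^esub> d \<and>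
      (\<forall>i. m - j < i \<and> i \<le> m \<longrightarrow> face m i g = \<zero>\<^bsub>smod A m\<^esub>)" if "j \<le> m" for j
    using that
  proof (induction j)
    case 0
    show ?case using a by (intro bexI[of _ a] bexI[of _ "\<zero>\<^bsub>?M\<^esub>"]) auto
  next
    case (Suc j)
    then obtain g d where g: "g \<in> carrier ?M" "d \<in> degenerate A (Suc m)" "a = g \<oplus>\<^bsub>?M\<^esub> d"
      and zero: "\<And>i. m - j < i \<Longrightarrow> i \<le> m \<Longrightarrow> face m i g = \<zero>\<^bsub>smod A m\<^esub>" by auto
    obtain l where l: "m - j = Suc l" using Suc.prems by (metis Suc_diff_Suc Suc_le_lessD)
    obtain m' where m': "m = Suc m'" using Suc.prems by (cases m) auto
    have lm: "l < m" "Suc l \<le> m" using l by auto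
    let ?s = "degen m l (face m (Suc l) g)"
    have s: "?s \<in> carrier ?M" "?s \<in> degenerate A (Suc m)"
      using lm g by (auto intro: degen_in_degenerate)
    have d: "d \<in> carrier ?M" using g by (simp add: dg.in_carrier)
    have "a = (g \<ominus>\<^bsub>?M\<^esub> ?s) \<oplus>\<^bsub>?M\<^esub> (?s \<oplus>\<^bsub>?M\<^esub> d)"
      using g s d by (simp add: a_minus_def sm.M.a_assoc sm.M.r_neg1)
    moreover have "face m i (g \<ominus>\<^bsub>?M\<^esub> ?s) = \<zero>\<^bsub>smod A m\<^esub>" if i: "m - Suc j < i" "i \<le> m" for i
    proof (cases "i = Suc l")
      case True
      then show ?thesis using g s lm by (simp add: face_diff face_degen_id sm.M.diff_eq_zero)
    next
      case False
      with i l have il: "Suc l < i" by simp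
      \<comment> \<open>For i > l + 1 the relations turn d_i s_l d_(l+1) g into s_l d_(l+1) d_i g,
        which vanishes because d_i g does.\<close>
      have "face m i ?s = degen m' l (face m' (i - 1) (face m (Suc l) g))"
        using il i g by (simp add: m' face_degen_greater)
      also have "\<dots> = degen m' l (face m' (Suc l) (face m i g))"
        using il i g by (simp add: m' face_face)
      also have "\<dots> = \<zero>\<^bsub>smod A m\<^esub>"
        using il i zero[of i] l
        by (simp add: m' linear_map.zero[OF face_linear] linear_map.zero[OF degen_linear])
      finally have "face m i ?s = \<zero>\<^bsub>smod A m\<^esub>" .
      then show ?thesis using g s i il l zero[of i] by (simp add: face_diff sm.M.diff_eq_zero)
    qed
    ultimately show ?case
      using g s d by (intro bexI[of _ "g \<ominus>\<^bsub>?M\<^esub> ?s"] bexI[of _ "?s \<oplus>\<^bsub>?M\<^esub> d"]) (auto intro: dg.add_in)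
  qed
  from this[of m] obtain g d where "g \<in> carrier ?M" "d \<in> degenerate A (Suc m)" "a = g \<oplus>\<^bsub>?M\<^esub> d"
    "\<forall>i. m - m < i \<and> i \<le> m \<longrightarrow> face m i g = \<zero>\<^bsub>smod A m\<^esub>" by blast
  then show ?thesis by (intro that) auto
qed

text \<open>
  If \<open>a = \<Sum>\<^bsub>i\<le>j\<^esub> s\<^sub>i x\<^sub>i\<close>, then \<open>d\<^bsub>j+1\<^esub> a = 0\<close> expresses \<open>x\<^sub>j\<close> through the \<open>x\<^sub>i\<close> with \<open>i < j\<close>, and
  \<open>s\<^sub>j s\<^sub>i = s\<^sub>i s\<^bsub>j-1\<^esub>\<close> absorbs the last summand into the others.
\<close>

lemma degenerate_faces_zero:
  assumes a: "a \<in> degenerate A (Suc m)" and faces: "\<And>i. i \<le> m \<Longrightarrow> face m i a = \<zero>\<^bsub>smod A m\<^esub>"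
  shows "a = \<zero>\<^bsub>smod A (Suc m)\<^esub>"
proof -
  let ?M = "smod A (Suc m)"
  \<comment> \<open>The induction is on the number j of degeneracies in a presentation of a. The
    coefficients x vary, since absorbing the last summand changes all the others.\<close>
  have "a = \<zero>\<^bsub>?M\<^esub>"
    if "j \<le> m" "\<And>i. i < j \<Longrightarrow> x i \<in> carrier (smod A m)" "a = (\<Oplus>\<^bsub>?M\<^esub>i\<in>{..<j}. degen m i (x i))" for j x
    using that
  proof (induction j arbitrary: x)
    case (Suc j)
    note x = Suc.prems(2)
    obtain m' where m': "m = Suc m'" using Suc.prems by (cases m) auto
    have j: "j \<le> m'" using Suc.prems m' by simp
    interpret f: linear_map k ?M "smod A m" "face m (Suc j)" using Suc.prems by (intro face_linear)
    interpret s: linear_map k "smod A m" ?M "degen m j" using Suc.prems by (intro degen_linear) simp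
    let ?T = "\<Oplus>\<^bsub>?M\<^esub>i\<in>{..<j}. degen m i (x i)"
    have T: "?T \<in> carrier ?M" using x j m' by (intro sm.M.finsum_closed) auto
    have split: "a = degen m j (x j) \<oplus>\<^bsub>?M\<^esub> ?T"
      unfolding Suc.prems(3) lessThan_Suc using x j m' by (intro sm.M.finsum_insert) auto
    \<comment> \<open>\<open>?z i\<close> is d_(j+1) s_i x_i rewritten as s_i d_j x_i. Applying s_j
      to it gives s_i of \<open>?y i\<close>, so \<open>?y i\<close> is the correction to the i-th
      coefficient.\<close>
    let ?z = "\<lambda>i. degen m' i (face m' j (x i))"
    let ?y = "\<lambda>i. degen m' (j - 1) (face m' j (x i))"
    have xm: "x i \<in> carrier (smod A (Suc m'))" if "i < Suc j" for i using x[OF that] m' by simp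
    have z: "?z i \<in> carrier (smod A m)" if "i < j" for i using that xm[of i] j by (simp add: m')
    have y: "?y i \<in> carrier (smod A m)" if "i < j" for i using that xm[of i] j by (simp add: m')
    have "face m (Suc j) ?T = (\<Oplus>\<^bsub>smod A m\<^esub>i\<in>{..<j}. face m (Suc j) (degen m i (x i)))"
      using x j m' by (intro f.finsum) auto
    also have "\<dots> = (\<Oplus>\<^bsub>smod A m\<^esub>i\<in>{..<j}. ?z i)"
      using z xm j by (intro sm.M.finsum_cong') (auto simp: m' face_degen_greater)
    finally have fT: "face m (Suc j) ?T = (\<Oplus>\<^bsub>smod A m\<^esub>i\<in>{..<j}. ?z i)" .
    have dxj: "degen m j (x j) \<in> carrier ?M" using x[of j] Suc.prems(1) by simp
    have "face m (Suc j) a = face m (Suc j) (degen m j (x j)) \<oplus>\<^bsub>smod A m\<^esub> face m (Suc j) ?T"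
      unfolding split by (rule f.add[OF dxj T])
    then have "x j \<oplus>\<^bsub>smod A m\<^esub> face m (Suc j) ?T = face m (Suc j) a"
      using x[of j] Suc.prems(1) by (simp add: face_degen_id)
    also have "\<dots> = \<zero>\<^bsub>smod A m\<^esub>" using Suc.prems by (intro faces) simp
    finally have "x j = \<ominus>\<^bsub>smod A m\<^esub> (\<Oplus>\<^bsub>smod A m\<^esub>i\<in>{..<j}. ?z i)"
      using x[of j] T unfolding fT[symmetric] by (intro sm.M.minus_equality[symmetric]) auto
    moreover have "(\<Oplus>\<^bsub>smod A m\<^esub>i\<in>{..<j}. ?z i) \<in> carrier (smod A m)"
      using z by (intro sm.M.finsum_closed) auto
    ultimately have "degen m j (x j) = \<ominus>\<^bsub>?M\<^esub> degen m j (\<Oplus>\<^bsub>smod A m\<^esub>i\<in>{..<j}. ?z i)"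
      by (simp only: s.minus)
    also have "degen m j (\<Oplus>\<^bsub>smod A m\<^esub>i\<in>{..<j}. ?z i) = (\<Oplus>\<^bsub>?M\<^esub>i\<in>{..<j}. degen m j (?z i))"
      using z by (intro s.finsum) auto
    also have "(\<Oplus>\<^bsub>?M\<^esub>i\<in>{..<j}. degen m j (?z i)) = (\<Oplus>\<^bsub>?M\<^esub>i\<in>{..<j}. degen m i (?y i))"
      using y xm j by (intro sm.M.finsum_cong') (auto simp: m' degen_degen)
    finally have dj: "degen m j (x j) = \<ominus>\<^bsub>?M\<^esub> (\<Oplus>\<^bsub>?M\<^esub>i\<in>{..<j}. degen m i (?y i))" .
    let ?Y = "\<Oplus>\<^bsub>?M\<^esub>i\<in>{..<j}. degen m i (?y i)"
    have Y: "?Y \<in> carrier ?M" using y j m' by (intro sm.M.finsum_closed) auto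
    \<comment> \<open>Since a is \<open>?T\<close> minus \<open>?Y\<close>, splitting
      \<open>?Y\<close> off \<open>?T\<close> leaves a presentation of a by j degeneracies with
      corrected coefficients.\<close>
    have "(\<Oplus>\<^bsub>?M\<^esub>i\<in>{..<j}. degen m i (x i \<ominus>\<^bsub>smod A m\<^esub> ?y i)) \<oplus>\<^bsub>?M\<^esub> ?Y
        = (\<Oplus>\<^bsub>?M\<^esub>i\<in>{..<j}. degen m i (x i \<ominus>\<^bsub>smod A m\<^esub> ?y i) \<oplus>\<^bsub>?M\<^esub> degen m i (?y i))"
      using x y j m' by (intro sm.M.finsum_addf[symmetric]) auto
    also have "\<dots> = ?T"
    proof (rule sm.M.finsum_cong')
      fix i assume "i \<in> {..<j}"
      then have i: "i < j" by simp
      interpret di: linear_map k "smod A m" ?M "degen m i" using i j m' by (intro degen_linear) simp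
      show "degen m i (x i \<ominus>\<^bsub>smod A m\<^esub> ?y i) \<oplus>\<^bsub>?M\<^esub> degen m i (?y i) = degen m i (x i)"
        using x[of i] y[OF i] i by (simp add: di.add[symmetric] a_minus_def sm.M.a_assoc sm.M.l_neg)
    qed (use x j m' in auto)
    finally have DY: "(\<Oplus>\<^bsub>?M\<^esub>i\<in>{..<j}. degen m i (x i \<ominus>\<^bsub>smod A m\<^esub> ?y i)) \<oplus>\<^bsub>?M\<^esub> ?Y = ?T" .
    have D: "(\<Oplus>\<^bsub>?M\<^esub>i\<in>{..<j}. degen m i (x i \<ominus>\<^bsub>smod A m\<^esub> ?y i)) \<in> carrier ?M"
      using x y j m' by (intro sm.M.finsum_closed) auto
    have "a = (\<Oplus>\<^bsub>?M\<^esub>i\<in>{..<j}. degen m i (x i \<ominus>\<^bsub>smod A m\<^esub> ?y i))"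
      unfolding split dj DY[symmetric] by (rule sm.M.neg_add_cancel[OF D Y])
    then show ?case
      using Suc.prems(1) x y by (intro Suc.IH[of "\<lambda>i. x i \<ominus>\<^bsub>smod A m\<^esub> ?y i"]) auto
  qed simp
  from degenerate_SucE[OF a] this[of m] show ?thesis by blast
qed

end

section \<open>The equivalence\<close>

lemma (in aug_smod_hom) Sp_isoI:
  assumes bij: "\<And>m. bij_betw (f m) (carrier (smod A m)) (carrier (smod B m))"
  shows "Sp_iso k A B f"
proof -
  define g where "g m = (\<lambda>y\<in>carrier (smod B m). inv_into (carrier (smod A m)) (f m) y)" for m
  have g: "g m y \<in> carrier (smod A m)" "f m (g m y) = y" if "y \<in> carrier (smod B m)" for m y
    using that bij[of m] by (auto simp: g_def bij_betw_def inv_into_into f_inv_into_f)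
  have gf: "g m (f m x) = x" if "x \<in> carrier (smod A m)" for m x
    using that bij[of m] by (simp add: g_def bij_betw_def)
  have "g p (sact B p m \<theta> y) = sact A p m \<theta> (g m y)"
    if "\<theta> \<in> Delta_hom p m" "y \<in> carrier (smod B m)" for p m \<theta> y
    using gf[of "sact A p m \<theta> (g m y)" p] that g by (simp add: sact)
  then have "g \<in> Sp_hom k B A"
    using linear_map.restrict_in_mod_hom[OF linear_map_bij_inv[OF linear bij]]
    by (simp add: Sp_hom_def g_def[abs_def])
  moreover have "Sp_comp A g f = Sp_id A"
    unfolding Sp_comp_def Sp_id_def compose_def by (rule ext, rule restrict_ext) (rule gf)
  moreover have "Sp_comp B f g = Sp_id B"
    unfolding Sp_comp_def Sp_id_def compose_def by (rule ext, rule restrict_ext) (rule g)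
  ultimately show ?thesis using hom by (auto simp: Sp_iso_def)
qed

lemma (in chain_map) Ch_isoI:
  assumes bij: "\<And>n. bij_betw (f n) (carrier (cmod C n)) (carrier (cmod D n))"
  shows "Ch_iso k C D f"
proof -
  define g where "g n = (\<lambda>y\<in>carrier (cmod D n). inv_into (carrier (cmod C n)) (f n) y)" for n
  have g: "g n y \<in> carrier (cmod C n)" "f n (g n y) = y" if "y \<in> carrier (cmod D n)" for n y
    using that bij[of n] by (auto simp: g_def bij_betw_def inv_into_into f_inv_into_f)
  have gf: "g n (f n x) = x" if "x \<in> carrier (cmod C n)" for n x
    using that bij[of n] by (simp add: g_def bij_betw_def)
  have "g (n - 1) (cdiff D n y) = cdiff C n (g n y)" if "y \<in> carrier (cmod D n)" for n y
    using gf[of "cdiff C n (g n y)" "n - 1"] that g by (simp add: cdiff)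
  then have "g \<in> Ch_hom k D C"
    using linear_map.restrict_in_mod_hom[OF linear_map_bij_inv[OF linear bij]]
    by (simp add: Ch_hom_def g_def[abs_def])
  moreover have "Ch_comp C g f = Ch_id C"
    unfolding Ch_comp_def Ch_id_def compose_def by (rule ext, rule restrict_ext) (rule gf)
  moreover have "Ch_comp D f g = Ch_id D"
    unfolding Ch_comp_def Ch_id_def compose_def by (rule ext, rule restrict_ext) (rule g)
  ultimately show ?thesis using hom by (auto simp: Ch_iso_def)
qed

section \<open>Reflection of isomorphisms by \<open>Nplus\<close>\<close>

context aug_smod_hom
begin

text \<open>Injectivity and surjectivity go through one induction. Both use bijectivity at the
  preceding index, the former through faces and the latter through degeneracies.\<close>

lemma bij_if_Nplus_bij:
  assumes "\<And>n. bij_betw (Nplus_map A B f (int n)) (carrier (cmod (Nplus A) (int n))) (carrier (cmod (Nplus B) (int n)))"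
  shows "bij_betw (f m) (carrier (smod A m)) (carrier (smod B m))"
proof (induction m rule: less_induct)
  case (less m)
  interpret fm: linear_map k "smod A m" "smod B m" "f m" by (rule linear)
  have "inj_on (f m) (carrier (smod A m))"
  proof (rule fm.inj_onI_kernel)
    fix a assume a: "a \<in> carrier (smod A m)" "f m a = \<zero>\<^bsub>smod B m\<^esub>"
    have "Nplus_map A B f (int m) (nclass A m a) = Nplus_map A B f (int m) (nclass A m \<zero>\<^bsub>smod A m\<^esub>)"
      using a by (simp add: Nplus_map_nclass)
    moreover have "inj_on (Nplus_map A B f (int m)) (carrier (cmod (Nplus A) (int m)))"
      using assms[of m] by (simp add: bij_betw_def)
    ultimately have "nclass A m a = nclass A m \<zero>\<^bsub>smod A m\<^esub>"
      using a by (auto dest: inj_onD)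
    then have deg: "a \<in> degenerate A m"
      using A.nclass_zero_iff[OF a(1)] A.nclass_zero_iff[of "\<zero>\<^bsub>smod A m\<^esub>" m] by simp
    show "a = \<zero>\<^bsub>smod A m\<^esub>"
    proof (cases m)
      case 0
      with deg show ?thesis by (simp add: A.degenerate_0)
    next
      case (Suc n)
      interpret fn: linear_map k "smod A n" "smod B n" "f n" by (rule linear)
      \<comment> \<open>The faces of a are sent to the faces of f a = 0, and f is injective one
        index below.\<close>
      have "A.face n i a = \<zero>\<^bsub>smod A n\<^esub>" if i: "i \<le> n" for i
      proof -
        have "f n (A.face n i a) = f n \<zero>\<^bsub>smod A n\<^esub>"
          using a i by (simp add: Suc face linear_map.zero[OF B.face_linear])
        moreover have "inj_on (f n) (carrier (smod A n))"
          using less[of n] Suc by (simp add: bij_betw_def)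
        ultimately show ?thesis
          using a i by (simp add: Suc inj_on_eq_iff del: fn.zero)
      qed
      with deg show ?thesis unfolding Suc by (intro A.degenerate_faces_zero)
    qed
  qed
  moreover have "carrier (smod B m) \<subseteq> f m ` carrier (smod A m)"
  proof
    fix b assume b: "b \<in> carrier (smod B m)"
    interpret im: submodule_of k "smod B m" "f m ` carrier (smod A m)"
      using fm.submodule_image by (simp add: submodule_of_def submodule_of_axioms_def B.module_smod)
    have "nclass B m b \<in> Nplus_map A B f (int m) ` carrier (cmod (Nplus A) (int m))"
      using assms[of m] B.nclass_closed[OF b] by (simp add: bij_betw_def)
    then obtain X where X: "X \<in> carrier (cmod (Nplus A) (int m))" "nclass B m b = Nplus_map A B f (int m) X"
      by blast
    obtain a where a: "a \<in> carrier (smod A m)" "X = nclass A m a"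
      by (rule A.Nplus_natE[OF X(1)])
    have "nclass B m b = nclass B m (f m a)" using X(2) a by (simp add: Nplus_map_nclass)
    then have "b \<ominus>\<^bsub>smod B m\<^esub> f m a \<in> degenerate B m"
      using a b by (simp add: B.dg.coset_eq_iff)
    \<comment> \<open>A degeneracy of y lies in the image because y itself does, by surjectivity one
      index below.\<close>
    moreover have "degenerate B m \<subseteq> f m ` carrier (smod A m)"
    proof (rule B.degenerate_least[OF fm.submodule_image])
      fix n i y assume n: "m = Suc n" "i < n" "y \<in> carrier (smod B n)"
      then obtain x where x: "x \<in> carrier (smod A n)" "y = f n x"
        using less[of n] by (auto simp: bij_betw_def)
      have "B.degen n i y = f m (A.degen n i x)" using n x by (simp add: degen)
      then show "B.degen n i y \<in> f m ` carrier (smod A m)"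
        using A.degen_closed[OF n(2) x(1)] n(1) by (metis image_eqI)
    qed
    ultimately have "(b \<ominus>\<^bsub>smod B m\<^esub> f m a) \<oplus>\<^bsub>smod B m\<^esub> f m a \<in> f m ` carrier (smod A m)"
      using a by (intro im.add_in) auto
    then show "b \<in> f m ` carrier (smod A m)"
      using a b by (simp add: a_minus_def B.sm.M.a_assoc B.sm.M.l_neg)
  qed
  ultimately show ?case by (auto simp: bij_betw_def)
qed

end

section \<open>Injectivity of the counit in non-negative degrees\<close>

context chain_complex
begin

lemma counit_inj: "inj_on (counit_NG k C (int m)) (carrier (cmod (Nplus (Gamma_plus k C)) (int m)))"
proof (rule linear_map.inj_onI_kernel[OF counit_linear])
  interpret G: aug_smod k "Gamma_plus k C" by (rule aug_smod_Gamma)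
  interpret m: chain_pair k "Nplus (k_simplex k m)" C by (rule chain_pair_simplex)
  fix X assume X: "X \<in> carrier (cmod (Nplus (Gamma_plus k C)) (int m))"
    and counit: "counit_NG k C (int m) X = \<zero>\<^bsub>cmod C (int m)\<^esub>"
  obtain f where fX: "f \<in> carrier (smod (Gamma_plus k C) m)" "X = nclass (Gamma_plus k C) m f"
    by (rule G.Nplus_natE[OF X])
  then have f: "f \<in> Ch_hom k (Nplus (k_simplex k m)) C" by (simp add: Gamma_carrier)
  have top: "f (int m) (top_class k m) = \<zero>\<^bsub>cmod C (int m)\<^esub>"
    using counit f fX by (simp add: counit_nclass)
  have "f \<in> degenerate (Gamma_plus k C) m"
  proof (cases m)
    case 0
    \<comment> \<open>At index 0 the only generator is the empty map at index 0, which is the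
      identity. So the vanishing top value already gives f = 0.\<close>
    have "f = \<zero>\<^bsub>smod (Gamma_plus k C) m\<^esub>"
      unfolding smod_Gamma
    proof (rule Ch_hom_simplex_eqI[OF chain_complex_axioms f m.zero_in])
      fix n \<phi> assume \<phi>: "\<phi> \<in> Delta_hom n m"
      then have n: "n = m" using 0 Delta_hom_less[OF \<phi>, of 0] by (cases n) auto
      have "\<phi> = Delta_id m" using \<phi> 0 n by (intro Delta_hom_eqI[of _ m m]) simp_all
      then show "f (int n) (gen_class k m n \<phi>) = \<zero>\<^bsub>Ch_module k (Nplus (k_simplex k m)) C\<^esub> (int n) (gen_class k m n \<phi>)"
        using top n by (simp add: top_class_eq Ch_module_def)
    qed
    then show ?thesis by simp
  next
    case (Suc p)
    have "f \<in> carrier (smod (Gamma_plus k C) (Suc p))" using fX Suc by simp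
    \<comment> \<open>The degenerate part d vanishes on the top class, so g inherits the vanishing
      of f there. It then suffices that g = 0.\<close>
    then obtain g d where g: "g \<in> carrier (smod (Gamma_plus k C) (Suc p))"
      and d: "d \<in> degenerate (Gamma_plus k C) (Suc p)"
      and fgd: "f = g \<oplus>\<^bsub>smod (Gamma_plus k C) (Suc p)\<^esub> d"
      and faces: "\<And>i. 1 \<le> i \<Longrightarrow> i \<le> p \<Longrightarrow> G.face p i g = \<zero>\<^bsub>smod (Gamma_plus k C) p\<^esub>"
      by (rule G.decompose) blast
    have g': "g \<in> Ch_hom k (Nplus (k_simplex k m)) C" using g Suc by (simp add: Gamma_carrier)
    interpret g: chain_map k "Nplus (k_simplex k m)" C g using g' by (rule simplex_chain_map)
    have dtop: "d (int m) (top_class k m) = \<zero>\<^bsub>cmod C (int m)\<^esub>"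
      using degenerate_top[OF d] Suc by simp
    have gtc: "g (int m) (top_class k m) \<in> carrier (cmod C (int m))"
      unfolding top_class_eq by (rule g.closed) simp
    have "g (int m) (top_class k m) \<oplus>\<^bsub>cmod C (int m)\<^esub> d (int m) (top_class k m) = f (int m) (top_class k m)"
      using linear_map.add[OF eval_top_linear[of m], of g d] g d G.dg.in_carrier[OF d] fgd Suc by simp
    then have gtop: "g (int m) (top_class k m) = \<zero>\<^bsub>cmod C (int m)\<^esub>"
      using dtop gtc top by simp
    \<comment> \<open>Composition with coface i computes the values of face i of g, and this face is
      zero by the choice of g.\<close>
    have gface: "g (int n) (gen_class k m n (compose {..<n} (coface p i) \<psi>)) = \<zero>\<^bsub>cmod C (int n)\<^esub>"
      if "1 \<le> i" "i \<le> p" "\<psi> \<in> Delta_hom n p" for n i \<psi>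
    proof -
      have "g (int n) (gen_class k m n (compose {..<n} (coface p i) \<psi>)) = G.face p i g (int n) (gen_class k p n \<psi>)"
        using sact_Gamma_gen_class[OF g'[unfolded Suc] coface_in[OF that(2)] that(3)]
        by (simp add: G.face_def Suc)
      also have "\<dots> = \<zero>\<^bsub>cmod C (int n)\<^esub>"
        unfolding faces[OF that(1,2)] smod_Gamma by (simp add: Ch_module_def)
      finally show ?thesis .
    qed
    have "g = \<zero>\<^bsub>smod (Gamma_plus k C) m\<^esub>"
      unfolding smod_Gamma
    proof (rule Ch_hom_simplex_eqI[OF chain_complex_axioms g' m.zero_in])
      fix n \<phi> assume \<phi>: "\<phi> \<in> Delta_hom n m"
      have "g (int n) (gen_class k m n \<phi>) = \<zero>\<^bsub>cmod C (int n)\<^esub>"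
        using \<phi>[unfolded Suc]
      proof (cases rule: Delta_hom_cases)
        case not_inj
        then obtain q i \<psi> where "n = Suc q" "i < q" "\<psi> \<in> Delta_hom q m" "\<phi> = compose {..<Suc q} \<psi> (codegen q i)"
          by (rule Delta_hom_not_injE[OF \<phi>])
        then show ?thesis
          using linear_map.zero[OF g.linear] by (simp only: gen_class_degenerate)
      next
        case (coface i \<psi>)
        then show ?thesis by (simp add: gface)
      next
        case id
        then show ?thesis using gtop Suc by (simp add: top_class_eq)
      next
        \<comment> \<open>The boundary of g at the identity is zero, and it equals the alternating
          sum of the values at all cofaces. Those with positive index vanish, which isolates the
          value at coface 0.\<close>
        case coface_0
        let ?S = "cmod (Nplus (k_simplex k m)) (int p)"
        let ?x = "\<lambda>i. g (int p) (signed ?S i (gen_class k m p (compose {..<p} (Delta_id m) (coface p i))))"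
        have s: "module k ?S" by (rule chain_complex.module_cmod[OF chain_complex_simplex])
        have idc: "compose {..<p} (Delta_id m) (coface p i) = coface p i" if "i \<le> p" for i
          unfolding Suc by (rule Delta_id_compose[OF coface_in[OF that]])
        have x: "?x i = (if 0 = i then g (int p) (gen_class k m p (coface p i)) else \<zero>\<^bsub>cmod C (int p)\<^esub>)" if "i \<le> p" for i
        proof (cases "i = 0")
          case True
          then show ?thesis using idc[OF that] by (simp add: signed_def)
        next
          case False
          have "g (int p) (gen_class k m p (coface p i)) = \<zero>\<^bsub>cmod C (int p)\<^esub>"
            using gface[of i "Delta_id p" p] False that compose_Delta_id[OF coface_in[OF that]] by simp
          moreover have "?x i = signed (cmod C (int p)) i (g (int p) (gen_class k m p (coface p i)))"
            unfolding idc[OF that] by (rule linear_map.signed[OF g.linear]) simp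
          ultimately show ?thesis using False by (simp add: signed_def)
        qed
        have "\<zero>\<^bsub>cmod C (int p)\<^esub> = cdiff C (int (Suc p)) (g (int (Suc p)) (gen_class k m (Suc p) (Delta_id m)))"
          using gtop linear_map.zero[OF cdiff_linear, of "int (Suc p)"] by (simp add: top_class_eq Suc)
        also have "\<dots> = g (int p) (cdiff (Nplus (k_simplex k m)) (int (Suc p)) (gen_class k m (Suc p) (Delta_id m)))"
          using g.cdiff[OF gen_class_closed[of m "Suc p" "Delta_id m"]] by simp
        also have "\<dots> = (\<Oplus>\<^bsub>cmod C (int p)\<^esub>i\<in>{..<Suc p}. ?x i)"
          using Suc by (subst cdiff_gen_class) (simp, intro linear_map.finsum[OF g.linear] signed_closed[OF s], simp)
        also have "\<dots> = (\<Oplus>\<^bsub>cmod C (int p)\<^esub>i\<in>{..<Suc p}. if 0 = i then g (int p) (gen_class k m p (coface p i)) else \<zero>\<^bsub>cmod C (int p)\<^esub>)"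
          by (intro cm.M.finsum_cong') (auto simp: x)
        also have "\<dots> = g (int p) (gen_class k m p (coface p 0))"
          by (intro cm.M.finsum_singleton) auto
        finally show ?thesis using coface_0 Suc by simp
      qed
      then show "g (int n) (gen_class k m n \<phi>) = \<zero>\<^bsub>Ch_module k (Nplus (k_simplex k m)) C\<^esub> (int n) (gen_class k m n \<phi>)"
        by (simp add: Ch_module_def)
    qed
    then have "f = d" using fgd G.dg.in_carrier[OF d] Suc by simp
    then show ?thesis using d Suc by simp
  qed
  then show "X = \<zero>\<^bsub>cmod (Nplus (Gamma_plus k C)) (int m)\<^esub>"
    using fX G.nclass_zero_iff by simp
qed

end

section \<open>Surjectivity of the counit on non-negative complexes\<close>

context chain_complex
begin

text \<open>Once the cofaces with positive index go to zero, the boundary relation at the identity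
  forces the value at the zeroth coface to be the boundary of c. The relation at that coface then
  asks for the boundary of a boundary to vanish. All remaining injective generators, and all their
  faces, go to zero.\<close>

lemma simplex_chain_map_ex:
  assumes nonneg: "C \<in> Ch_nonneg k" and c: "c \<in> carrier (cmod C (int m))"
  shows "\<exists>f\<in>Ch_hom k (Nplus (k_simplex k m)) C. f (int m) (top_class k m) = c"
proof -
  interpret S: aug_smod k "k_simplex k m" by (rule aug_smod_simplex)
  have dc: "cdiff C (int m) c \<in> carrier (cmod C (int q))" if "Suc q = m" for q
  proof -
    have "int q = int m - 1" using that by auto
    with cdiff_closed[OF c] show ?thesis by (simp only:)
  qed
  \<comment> \<open>An injective map from \<open>{..<m}\<close> to itself in \<open>Delta_hom\<close> is the identity.\<close>
  define u where "u n \<phi> = (if n = m \<and> inj_on \<phi> {..<n} then c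
      else if Suc n = m \<and> \<phi> = coface n 0 then cdiff C (int m) c
      else \<zero>\<^bsub>cmod C (int n)\<^esub>)" for n :: nat and \<phi> :: "nat \<Rightarrow> nat"
  have u: "u n \<phi> \<in> carrier (cmod C (int n))" for n \<phi>
    using c dc by (auto simp: u_def)
  have u_not_inj: "u n \<phi> = \<zero>\<^bsub>cmod C (int n)\<^esub>" if "\<not> inj_on \<phi> {..<n}" for n \<phi>
  proof -
    \<comment> \<open>Both nonzero branches of \<open>u\<close> require an injective generator, so
      \<open>u\<close> is compatible with passing to the quotient by degenerate elements.\<close>
    have "inj_on (coface n 0) {..<n}" by (auto simp: inj_on_def coface_def)
    with that show ?thesis by (auto simp: u_def)
  qed
  define F where "F n = fin_free.free_lift (Delta_hom n m) (cmod C (int n)) (u n)" for n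
  have F_linear: "linear_map k (smod (k_simplex k m) n) (cmod C (int n)) (F n)" for n
    unfolding F_def smod_simplex by (rule fin_free.free_lift_linear[OF fin_free_Delta module_cmod u])
  have F_gen: "F n (free_gen k (Delta_hom n m) \<phi>) = u n \<phi>" if "\<phi> \<in> Delta_hom n m" for n \<phi>
    unfolding F_def by (rule fin_free.free_lift_gen[OF fin_free_Delta module_cmod u that])
  have F_deg: "F n x = \<zero>\<^bsub>cmod C (int n)\<^esub>" if "x \<in> degenerate (k_simplex k m) n" for n x
  proof -
    interpret Fn: linear_map k "smod (k_simplex k m) n" "cmod C (int n)" "F n" by (rule F_linear)
    have "submodule {\<zero>\<^bsub>cmod C (int n)\<^esub>} k (cmod C (int n))"
      by (rule cm.submoduleI) auto
    then have "degenerate (k_simplex k m) n \<subseteq> {x \<in> carrier (smod (k_simplex k m) n). F n x \<in> {\<zero>\<^bsub>cmod C (int n)\<^esub>}}"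
    proof (rule S.degenerate_least[OF Fn.submodule_vimage])
      fix q i y assume q: "n = Suc q" "i < q" "y \<in> carrier (smod (k_simplex k m) q)"
      have "F (Suc q) (S.degen q i y) = \<zero>\<^bsub>cmod C (int (Suc q))\<^esub>"
      proof (rule simplex_eqI[OF linear_map_comp[OF S.degen_linear F_linear] linear_map_zero[OF S.module_smod module_cmod] _ q(3)])
        fix \<psi> assume \<psi>: "\<psi> \<in> Delta_hom q m"
        then have "F (Suc q) (S.degen q i (free_gen k (Delta_hom q m) \<psi>)) = u (Suc q) (compose {..<Suc q} \<psi> (codegen q i))"
          unfolding S.degen_def sact_simplex_gen[OF codegen_in[OF q(2)] \<psi>]
          by (intro F_gen compose_in[OF codegen_in[OF q(2)]])
        also have "\<dots> = \<zero>\<^bsub>cmod C (int (Suc q))\<^esub>"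
          by (rule u_not_inj[OF compose_codegen_not_inj[OF q(2)]])
        finally show "F (Suc q) (S.degen q i (free_gen k (Delta_hom q m) \<psi>)) = \<zero>\<^bsub>cmod C (int (Suc q))\<^esub>" .
      qed (use q in simp_all)
      then show "S.degen q i y \<in> {x \<in> carrier (smod (k_simplex k m) n). F n x \<in> {\<zero>\<^bsub>cmod C (int n)\<^esub>}}"
        using S.degen_closed[OF q(2,3)] by (simp add: q(1))
    qed
    with that show ?thesis by blast
  qed
  \<comment> \<open>\<open>F\<close> kills degenerate elements and descends to \<open>Nplus\<close>.
    In negative degrees the source is the zero module, so zero is the only possible value.\<close>
  define G where "G n X = (if n < 0 then \<zero>\<^bsub>cmod C n\<^esub> else the_elem (F (nat n) ` X))" for n X
  have G_linear: "linear_map k (cmod (Nplus (k_simplex k m)) n) (cmod C n) (G n)" for n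
  proof (cases "n < 0")
    case True
    then show ?thesis
      unfolding G_def[abs_def] by (simp add: linear_map_zero S.NA.module_cmod module_cmod)
  next
    case False
    then obtain q where n: "n = int q" by (rule int_nonnegE)
    show ?thesis
      unfolding G_def[abs_def] n cmod_Nplus_nat
      using S.dg.the_elem_coset_linear[OF F_linear F_deg] by simp
  qed
  have G_gen: "G (int n) (gen_class k m n \<phi>) = u n \<phi>" if "\<phi> \<in> Delta_hom n m" for n \<phi>
    unfolding G_def gen_class_def
    using S.dg.the_elem_coset[OF F_linear F_deg gen_closed] F_gen[OF that] by simp
  have G_cdiff: "G (n - 1) (cdiff (Nplus (k_simplex k m)) n X) = cdiff C n (G n X)"
    if X: "X \<in> carrier (cmod (Nplus (k_simplex k m)) n)" for n X
  proof (cases "n \<le> 0")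
    \<comment> \<open>This is where non-negativity is used: the target degree n - 1 is negative, so
      both sides lie in a zero module.\<close>
    case True
    have "carrier (cmod C (n - 1)) = {\<zero>\<^bsub>cmod C (n - 1)\<^esub>}"
      using nonneg True by (simp add: Ch_nonneg_def)
    moreover have "G (n - 1) (cdiff (Nplus (k_simplex k m)) n X) \<in> carrier (cmod C (n - 1))"
      "cdiff C n (G n X) \<in> carrier (cmod C (n - 1))"
      using X linear_map.closed[OF G_linear] by simp_all
    ultimately show ?thesis by simp
  next
    case False
    then obtain q where n: "n = int (Suc q)" by (rule int_posE)
    note dS = S.NA.cdiff_linear[of "int (Suc q)"] and dC = cdiff_linear[of "int (Suc q)"]
    have minus: "int (Suc q) - 1 = int q" by simp
    have "G (int q) (cdiff (Nplus (k_simplex k m)) (int (Suc q)) X) = cdiff C (int (Suc q)) (G (int (Suc q)) X)"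
    proof (rule Nplus_simplex_eqI[OF linear_map_comp[OF dS[unfolded minus] G_linear]
          linear_map_comp[OF G_linear dC[unfolded minus]] _ X[unfolded n]])
      fix \<phi> assume \<phi>: "\<phi> \<in> Delta_hom (Suc q) m"
      show "G (int q) (cdiff (Nplus (k_simplex k m)) (int (Suc q)) (gen_class k m (Suc q) \<phi>))
          = cdiff C (int (Suc q)) (G (int (Suc q)) (gen_class k m (Suc q) \<phi>))"
      proof (cases "inj_on \<phi> {..<Suc q}")
        case False
        obtain r i \<psi> where r: "Suc q = Suc r" "i < r" "\<psi> \<in> Delta_hom r m" "\<phi> = compose {..<Suc r} \<psi> (codegen r i)"
          by (rule Delta_hom_not_injE[OF \<phi> False])
        have "gen_class k m (Suc q) \<phi> = \<zero>\<^bsub>cmod (Nplus (k_simplex k m)) (int (Suc q))\<^esub>"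
          using r gen_class_degenerate[OF r(3,2)] by simp
        then show ?thesis
          by (simp only: linear_map.zero[OF dS[unfolded minus]] linear_map.zero[OF dC[unfolded minus]]
              linear_map.zero[OF G_linear])
      next
        case True
        \<comment> \<open>Injectivity bounds the degree by m. In degree m the generator is the
          identity; below it all values of \<open>u\<close> on faces are zero.\<close>
        have le: "Suc q \<le> m" using Delta_hom_inj_bounds(2)[OF \<phi> True, of 0] by simp
        let ?S = "cmod (Nplus (k_simplex k m)) (int q)"
        let ?x = "\<lambda>i. gen_class k m q (compose {..<q} \<phi> (coface q i))"
        have s: "module k ?S" by (rule S.NA.module_cmod)
        have "G (int q) (cdiff (Nplus (k_simplex k m)) (int (Suc q)) (gen_class k m (Suc q) \<phi>))
            = (\<Oplus>\<^bsub>cmod C (int q)\<^esub>i\<in>{..<Suc q}. G (int q) (signed ?S i (?x i)))"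
          unfolding cdiff_gen_class[OF \<phi>]
          by (rule linear_map.finsum[OF G_linear]) (rule signed_closed[OF s], simp)
        also have "\<dots> = (\<Oplus>\<^bsub>cmod C (int q)\<^esub>i\<in>{..<Suc q}.
            signed (cmod C (int q)) i (u q (compose {..<q} \<phi> (coface q i))))"
        proof (rule cm.M.finsum_cong')
          fix i assume "i \<in> {..<Suc q}"
          then have "compose {..<q} \<phi> (coface q i) \<in> Delta_hom q m"
            using \<phi> by (intro compose_in[OF coface_in]) simp_all
          then show "G (int q) (signed ?S i (?x i)) = signed (cmod C (int q)) i (u q (compose {..<q} \<phi> (coface q i)))"
            using linear_map.signed[OF G_linear gen_class_closed] G_gen by simp
        qed (auto intro!: signed_closed[OF module_cmod] u)
        also have "\<dots> = cdiff C (int (Suc q)) (u (Suc q) \<phi>)"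
        proof (cases "Suc q = m")
          case True
          have \<phi>_id: "\<phi> = Delta_id (Suc q)"
          proof (rule Delta_hom_eqI[of _ "Suc q" "Suc q"])
            fix x assume x: "x < Suc q"
            then show "\<phi> x = Delta_id (Suc q) x"
              using Delta_hom_inj_bounds[OF \<phi> \<open>inj_on \<phi> {..<Suc q}\<close> x] True by (simp add: Delta_id_def)
          qed (use \<phi> True in simp_all)
          have "signed (cmod C (int q)) i (u q (compose {..<q} \<phi> (coface q i)))
              = (if 0 = i then cdiff C (int m) c else \<zero>\<^bsub>cmod C (int q)\<^esub>)" if "i \<le> q" for i
          proof (cases "i = 0")
            case False
            \<comment> \<open>Evaluation at 0 separates them: coface 0 sends 0 to 1, while a coface
              with positive index fixes 0.\<close>
            have "coface q i \<noteq> coface q 0" if "i \<noteq> 0" "i \<le> q"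
            proof
              assume "coface q i = coface q 0"
              then have "coface q i 0 = coface q 0 0" by simp
              then show False using that by (simp add: coface_def)
            qed
            then have "u q (coface q i) = \<zero>\<^bsub>cmod C (int q)\<^esub>"
              using True False that by (auto simp: u_def)
            with False show ?thesis
              unfolding \<phi>_id Delta_id_compose[OF coface_in[OF that]] by (simp add: signed_def)
          next
            case i: True
            show ?thesis
              unfolding \<phi>_id Delta_id_compose[OF coface_in[OF that]] using True by (auto simp: signed_def u_def i)
          qed
          then have "(\<Oplus>\<^bsub>cmod C (int q)\<^esub>i\<in>{..<Suc q}. signed (cmod C (int q)) i (u q (compose {..<q} \<phi> (coface q i))))
              = (\<Oplus>\<^bsub>cmod C (int q)\<^esub>i\<in>{..<Suc q}. if 0 = i then cdiff C (int m) c else \<zero>\<^bsub>cmod C (int q)\<^esub>)"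
            using dc[OF True] by (intro cm.M.finsum_cong') auto
          also have "\<dots> = cdiff C (int m) c"
            using dc[OF True] by (intro cm.M.finsum_singleton) auto
          also have "\<dots> = cdiff C (int (Suc q)) (u (Suc q) \<phi>)"
            using \<open>inj_on \<phi> {..<Suc q}\<close> True by (simp add: u_def)
          finally show ?thesis .
        next
          \<comment> \<open>The faces have index q with q + 1 < m, where \<open>u\<close> is zero.
            On the other side there is the boundary of zero or, at the zeroth coface, of the
            boundary of c.\<close>
          case False
          with le have "u q \<psi> = \<zero>\<^bsub>cmod C (int q)\<^esub>" for \<psi> by (simp add: u_def)
          then have "(\<Oplus>\<^bsub>cmod C (int q)\<^esub>i\<in>{..<Suc q}. signed (cmod C (int q)) i (u q (compose {..<q} \<phi> (coface q i))))
              = \<zero>\<^bsub>cmod C (int q)\<^esub>"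
            by (intro cm.M.add.finprod_one_eqI) (simp add: signed_def)
          moreover have "cdiff C (int (Suc q)) (u (Suc q) \<phi>) = \<zero>\<^bsub>cmod C (int q)\<^esub>"
          proof (cases "Suc (Suc q) = m \<and> \<phi> = coface (Suc q) 0")
            case True
            then have m: "int m = int (Suc q) + 1" by auto
            have "u (Suc q) \<phi> = cdiff C (int m) c" using True by (auto simp: u_def)
            then show ?thesis using cdiff_cdiff[OF c] by (simp add: m)
          next
            case not: False
            then have "u (Suc q) \<phi> = \<zero>\<^bsub>cmod C (int (Suc q))\<^esub>" using False by (auto simp: u_def)
            then show ?thesis using linear_map.zero[OF dC[unfolded minus]] by simp
          qed
          ultimately show ?thesis by simp
        qed
        also have "u (Suc q) \<phi> = G (int (Suc q)) (gen_class k m (Suc q) \<phi>)"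
          using G_gen[OF \<phi>] by simp
        finally show ?thesis .
      qed
    qed
    then show ?thesis by (simp add: n)
  qed
  have "(\<lambda>n. \<lambda>X\<in>carrier (cmod (Nplus (k_simplex k m)) n). G n X) \<in> Ch_hom k (Nplus (k_simplex k m)) C"
    by (rule Ch_hom_restrictI[OF chain_complex_simplex G_linear G_cdiff])
  moreover have "inj_on (Delta_id m) {..<m}" by (simp add: inj_on_def Delta_id_def)
  then have "G (int m) (top_class k m) = c"
    using G_gen[OF Delta_id_in] by (simp add: top_class_eq u_def)
  ultimately show ?thesis
    by (intro bexI[of _ "\<lambda>n. \<lambda>X\<in>carrier (cmod (Nplus (k_simplex k m)) n). G n X"]) (simp_all add: top_class_eq)
qed

lemma counit_bij:
  assumes nonneg: "C \<in> Ch_nonneg k"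
  shows "bij_betw (counit_NG k C n) (carrier (cmod (Nplus (Gamma_plus k C)) n)) (carrier (cmod C n))"
proof (cases "n < 0")
  case True
  then show ?thesis
    using nonneg by (simp add: bij_betw_def cmod_Nplus_neg counit_neg Ch_nonneg_def)
next
  case False
  interpret G: aug_smod k "Gamma_plus k C" by (rule aug_smod_Gamma)
  from False obtain m where n: "n = int m" by (rule int_nonnegE)
  have "c \<in> counit_NG k C (int m) ` carrier (cmod (Nplus (Gamma_plus k C)) (int m))"
    if c: "c \<in> carrier (cmod C (int m))" for c
  proof -
    obtain f where f: "f \<in> Ch_hom k (Nplus (k_simplex k m)) C" "f (int m) (top_class k m) = c"
      using simplex_chain_map_ex[OF nonneg c] by blast
    then show ?thesis
      by (intro image_eqI[of _ _ "nclass (Gamma_plus k C) m f"] G.nclass_closed)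
        (simp_all add: counit_nclass Gamma_carrier)
  qed
  then show ?thesis
    unfolding n using counit_inj linear_map.closed[OF counit_linear] by (auto simp: bij_betw_def)
qed

end

lemma (in aug_smod) unit_bij: "bij_betw (unit_NG k A m) (carrier (smod A m)) (carrier (smod (Gamma_plus k (Nplus A)) m))"
proof -
  interpret u: aug_smod_hom k A "Gamma_plus k (Nplus A)" "unit_NG k A" by (rule unit_hom)
  let ?N = "Nplus_map A (Gamma_plus k (Nplus A)) (unit_NG k A)"
  show ?thesis
  proof (rule u.bij_if_Nplus_bij)
    fix n
    let ?X = "carrier (cmod (Nplus A) (int n))" and ?Y = "carrier (cmod (Nplus (Gamma_plus k (Nplus A))) (int n))"
    let ?e = "counit_NG k (Nplus A) (int n)"
    have e: "bij_betw ?e ?Y ?X" by (rule NA.counit_bij[OF Nplus_in_Ch_nonneg])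
    have eN: "?e (?N (int n) x) = x" if "x \<in> ?X" for x
      using that fun_cong[OF fun_cong[OF triangle_Nplus, of "int n"], of x] by (simp add: Ch_comp_apply Ch_id_def)
    have N: "?N (int n) x \<in> ?Y" if "x \<in> ?X" for x
      using linear_map.closed[OF u.Nplus_map_linear] that .
    \<comment> \<open>The triangle identity gives only a right inverse of the counit. Applied at
      \<open>?e y\<close> it yields two elements with the same counit value, and injectivity of the
      counit identifies them.\<close>
    have Ne: "?N (int n) (?e y) = y" if y: "y \<in> ?Y" for y
    proof -
      have ey: "?e y \<in> ?X" using e y by (auto simp: bij_betw_def)
      show ?thesis
        using e eN[OF ey] N[OF ey] y by (auto simp: bij_betw_def dest: inj_onD)
    qed
    show "bij_betw (?N (int n)) ?X ?Y"
      by (rule bij_betw_byWitness[of _ ?e]) (use eN Ne N e in \<open>auto simp: bij_betw_def\<close>)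
  qed
qed

section \<open>Locale predicates as membership in \<open>SpMod\<close>, \<open>Sp_hom\<close>,
  \<open>Ch\<close> and \<open>Ch_hom\<close>\<close>

lemma aug_smod_iff: "aug_smod k A \<longleftrightarrow> cring k \<and> A \<in> SpMod k"
  by (simp add: aug_smod_def aug_smod_axioms_def)

lemma aug_smod_hom_iff:
  "aug_smod_hom k A B f \<longleftrightarrow> cring k \<and> A \<in> SpMod k \<and> B \<in> SpMod k \<and> f \<in> Sp_hom k A B"
  by (auto simp: aug_smod_hom_def aug_smod_hom_axioms_def aug_smod_iff)

lemma chain_complex_iff: "chain_complex k C \<longleftrightarrow> cring k \<and> C \<in> Ch k"
  by (simp add: chain_complex_def chain_complex_axioms_def)

lemma chain_map_iff: "chain_map k C D f \<longleftrightarrow> cring k \<and> C \<in> Ch k \<and> D \<in> Ch k \<and> f \<in> Ch_hom k C D"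
  by (auto simp: chain_map_def chain_map_axioms_def chain_complex_iff)

lemma Ch_nonneg_subset: "C \<in> Ch_nonneg k \<Longrightarrow> C \<in> Ch k"
  by (simp add: Ch_nonneg_def)

text \<open>The adjunction is expressed by unit, counit and triangle identities. As
  \<open>Ch_nonneg\<close> is a full subcategory containing the values of \<open>Nplus\<close>, the
  adjunction restricts to it, and it is an adjoint equivalence there because unit and counit are
  isomorphisms.\<close>

theorem proposition3p3:
  fixes k :: "('r, 'x) ring_scheme"
  assumes "cring k"
  shows
    "\<comment> \<open>\<open>N\<^sup>+\<close> is a functor\<close>
     (\<forall>A\<in>(SpMod k :: ('r, 'a) asmod set).
        Nplus A \<in> Ch k \<and> Nplus_map A A (Sp_id A) = Ch_id (Nplus A)) \<and>
     (\<forall>A\<in>(SpMod k :: ('r, 'a) asmod set). \<forall>B\<in>(SpMod k :: ('r, 'b) asmod set).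
        \<forall>f\<in>Sp_hom k A B. Nplus_map A B f \<in> Ch_hom k (Nplus A) (Nplus B)) \<and>
     (\<forall>A\<in>(SpMod k :: ('r, 'a) asmod set). \<forall>B\<in>(SpMod k :: ('r, 'b) asmod set).
      \<forall>E\<in>(SpMod k :: ('r, 'e) asmod set). \<forall>f\<in>Sp_hom k A B. \<forall>g\<in>Sp_hom k B E.
        Nplus_map A E (Sp_comp A g f)
          = Ch_comp (Nplus A) (Nplus_map B E g) (Nplus_map A B f)) \<and>
     \<comment> \<open>\<open>\<Gamma>\<^sup>+\<close> is a functor\<close>
     (\<forall>C\<in>(Ch k :: ('r, 'a) complx set).
        Gamma_plus k C \<in> SpMod k \<and> Gamma_plus_map k C (Ch_id C) = Sp_id (Gamma_plus k C)) \<and>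
     (\<forall>C\<in>(Ch k :: ('r, 'a) complx set). \<forall>D\<in>(Ch k :: ('r, 'b) complx set).
        \<forall>f\<in>Ch_hom k C D. Gamma_plus_map k C f \<in> Sp_hom k (Gamma_plus k C) (Gamma_plus k D)) \<and>
     (\<forall>C\<in>(Ch k :: ('r, 'a) complx set). \<forall>D\<in>(Ch k :: ('r, 'b) complx set).
      \<forall>E\<in>(Ch k :: ('r, 'e) complx set). \<forall>f\<in>Ch_hom k C D. \<forall>g\<in>Ch_hom k D E.
        Gamma_plus_map k C (Ch_comp C g f)
          = Sp_comp (Gamma_plus k C) (Gamma_plus_map k D g) (Gamma_plus_map k C f)) \<and>
     \<comment> \<open>the unit is a natural transformation\<close>
     (\<forall>A\<in>(SpMod k :: ('r, 'a) asmod set).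
        unit_NG k A \<in> Sp_hom k A (Gamma_plus k (Nplus A))) \<and>
     (\<forall>A\<in>(SpMod k :: ('r, 'a) asmod set). \<forall>B\<in>(SpMod k :: ('r, 'b) asmod set).
        \<forall>f\<in>Sp_hom k A B.
          Sp_comp A (unit_NG k B) f
            = Sp_comp A (Gamma_plus_map k (Nplus A) (Nplus_map A B f)) (unit_NG k A)) \<and>
     \<comment> \<open>the counit is a natural transformation\<close>
     (\<forall>C\<in>(Ch k :: ('r, 'a) complx set).
        counit_NG k C \<in> Ch_hom k (Nplus (Gamma_plus k C)) C) \<and>
     (\<forall>C\<in>(Ch k :: ('r, 'a) complx set). \<forall>D\<in>(Ch k :: ('r, 'b) complx set).
        \<forall>f\<in>Ch_hom k C D.
          Ch_comp (Nplus (Gamma_plus k C)) f (counit_NG k C)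
            = Ch_comp (Nplus (Gamma_plus k C)) (counit_NG k D)
                (Nplus_map (Gamma_plus k C) (Gamma_plus k D) (Gamma_plus_map k C f))) \<and>
     \<comment> \<open>triangle identities\<close>
     (\<forall>A\<in>(SpMod k :: ('r, 'a) asmod set).
        Ch_comp (Nplus A) (counit_NG k (Nplus A))
            (Nplus_map A (Gamma_plus k (Nplus A)) (unit_NG k A))
          = Ch_id (Nplus A)) \<and>
     (\<forall>C\<in>(Ch k :: ('r, 'a) complx set).
        Sp_comp (Gamma_plus k C)
            (Gamma_plus_map k (Nplus (Gamma_plus k C)) (counit_NG k C))
            (unit_NG k (Gamma_plus k C))
          = Sp_id (Gamma_plus k C)) \<and>
     \<comment> \<open>adjoint equivalence with non-negative complexes\<close>
     (\<forall>A\<in>(SpMod k :: ('r, 'a) asmod set). Nplus A \<in> Ch_nonneg k) \<and>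
     (\<forall>A\<in>(SpMod k :: ('r, 'a) asmod set).
        Sp_iso k A (Gamma_plus k (Nplus A)) (unit_NG k A)) \<and>
     (\<forall>C\<in>(Ch_nonneg k :: ('r, 'a) complx set).
        Ch_iso k (Nplus (Gamma_plus k C)) C (counit_NG k C))"
proof (intro conjI ballI)
  note [simp] = assms aug_smod_iff aug_smod_hom_iff chain_complex_iff chain_map_iff Ch_nonneg_subset
  fix A :: "('r, 'a) asmod" and B :: "('r, 'b) asmod" and E :: "('r, 'e) asmod" and f g
  assume A: "A \<in> SpMod k"
  show "Nplus A \<in> Ch k" "Nplus_map A A (Sp_id A) = Ch_id (Nplus A)" "Nplus A \<in> Ch_nonneg k"
    using A aug_smod.Nplus_map_id[of k A]
    by (simp_all add: aug_smod.Nplus_in_Ch aug_smod.Nplus_in_Ch_nonneg)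
  show "unit_NG k A \<in> Sp_hom k A (Gamma_plus k (Nplus A))"
    using A aug_smod.unit_hom[of k A] by simp
  show "Ch_comp (Nplus A) (counit_NG k (Nplus A)) (Nplus_map A (Gamma_plus k (Nplus A)) (unit_NG k A))
      = Ch_id (Nplus A)"
    using A by (simp add: aug_smod.triangle_Nplus)
  show "Sp_iso k A (Gamma_plus k (Nplus A)) (unit_NG k A)"
    using A by (intro aug_smod_hom.Sp_isoI aug_smod.unit_hom aug_smod.unit_bij) simp_all
  assume B: "B \<in> SpMod k" and f: "f \<in> Sp_hom k A B"
  show "Nplus_map A B f \<in> Ch_hom k (Nplus A) (Nplus B)"
    using A B f by (simp add: aug_smod_hom.Nplus_map_in_Ch_hom)
  show "Sp_comp A (unit_NG k B) f = Sp_comp A (Gamma_plus_map k (Nplus A) (Nplus_map A B f)) (unit_NG k A)"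
    using A B f by (intro unit_natural) simp
  assume "E \<in> SpMod k" "g \<in> Sp_hom k B E"
  then show "Nplus_map A E (Sp_comp A g f) = Ch_comp (Nplus A) (Nplus_map B E g) (Nplus_map A B f)"
    using A B f by (intro Nplus_map_comp[of k]) simp_all
next
  note [simp] = assms aug_smod_iff aug_smod_hom_iff chain_complex_iff chain_map_iff Ch_nonneg_subset
  fix C :: "('r, 'a) complx" and D :: "('r, 'b) complx" and E :: "('r, 'e) complx" and f g
  show "Ch_iso k (Nplus (Gamma_plus k C)) C (counit_NG k C)" if "C \<in> Ch_nonneg k"
    using that
    by (intro chain_map.Ch_isoI chain_complex.counit_chain_map chain_complex.counit_bij) simp_all
  assume C: "C \<in> Ch k"
  show "Gamma_plus k C \<in> SpMod k" "Gamma_plus_map k C (Ch_id C) = Sp_id (Gamma_plus k C)"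
    using C chain_complex.aug_smod_Gamma[of k C] by (simp_all add: chain_complex.Gamma_plus_map_id)
  show "counit_NG k C \<in> Ch_hom k (Nplus (Gamma_plus k C)) C"
    using C chain_complex.counit_chain_map[of k C] by simp
  show "Sp_comp (Gamma_plus k C) (Gamma_plus_map k (Nplus (Gamma_plus k C)) (counit_NG k C))
      (unit_NG k (Gamma_plus k C)) = Sp_id (Gamma_plus k C)"
    using C by (simp add: chain_complex.triangle_Gamma)
  assume D: "D \<in> Ch k" and f: "f \<in> Ch_hom k C D"
  show "Gamma_plus_map k C f \<in> Sp_hom k (Gamma_plus k C) (Gamma_plus k D)"
    using C D f Gamma_plus_map_hom[of k C D f] by simp
  show "Ch_comp (Nplus (Gamma_plus k C)) f (counit_NG k C)
      = Ch_comp (Nplus (Gamma_plus k C)) (counit_NG k D)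
          (Nplus_map (Gamma_plus k C) (Gamma_plus k D) (Gamma_plus_map k C f))"
    using C D f by (intro counit_natural) simp
  assume "E \<in> Ch k" "g \<in> Ch_hom k D E"
  show "Gamma_plus_map k C (Ch_comp C g f)
      = Sp_comp (Gamma_plus k C) (Gamma_plus_map k D g) (Gamma_plus_map k C f)"
    using C D f by (intro Gamma_plus_map_comp[of k C D]) simp
qed

end
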